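(* Let $r\ge 3$ and $\sigma$ be integers with $0<\sigma<r-1$, and assume $r\le 8$ and $\rho=r-\sigma\le 5$. Put $s=2^{\rho-1}$, $t=2^{\sigma+1}-1$, $m_1=2^\rho-1$. Then $G_r^\sigma$ is a connected, $s(t-1)m_1$-regular $\{K_{2s},T_{ts,t}\}_{\ell_0,\ell_1}^{m_0,m_1}$-homogeneous graph, but if $r>3$ then $G_r^\sigma$ is not $\{K_{2s},T_{ts,t}\}_{\ell_0,\ell_1}^{m_0,m_1}$-ultrahomogeneous. Furthermore, $G_r^\sigma$ is the Menger graph of a configuration $(|V(G_r^\sigma)|_{m_0},(\ell_0)_{2s})$ whose points are the vertices of $G_r^\sigma$ and whose lines are the (vertex sets of the) copies of $K_{2s}$ in $J_0$. If $\sigma=1$, then: (a) $|V(G_r^\sigma)|=\ell_0$ and $m_0=2s$; (b) this configuration is self-dual; and (c) as a Menger graph, $G_r^\sigma$ coincides with the corresponding dual Menger graph. In addition, $G_r^\sigma=\mathcal{G}_r^\sigma$ if and only if $r-\sigma=2$, and in this case $G_r^\sigma$ is $K_4$-ultrahomogeneous.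
   Context: Identify the nonzero vectors of $\mathbb{F}_2^r$ with the integers $1,\dots,2^r-1$ via binary representation. An $(r,\sigma)$-ordered pencil is a tuple $v=(A_0,A_1,\dots,A_{m_1})$ where $S=A_0\cup\{\mathbf 0\}$ is a $\sigma$-dimensional $\mathbb{F}_2$-linear subspace of $\mathbb{F}_2^r$ and $A_1,\dots,A_{m_1}$ is an enumeration of the $m_1$ cosets of $S$ other than $S$. The graph $\mathcal{G}_r^\sigma$ has these ordered pencils as vertices, with $v=(A_0,\dots,A_{m_1})$ and $v'=(A'_0,\dots,A'_{m_1})$ adjacent iff: (1) $T=(A_0\cap A'_0)\cup\{\mathbf 0\}$ is a linear subspace of dimension $\sigma-1$; (2) for each $1\le i\le m_1$, $A_i\cap A'_i$ is a coset of $T$ different from $T$; (3) $\bigcup_{i=0}^{m_1}(A_i\cap A'_i)\cup\{\mathbf 0\}$ is a linear subspace of dimension $r-1$. Let $v_r^\sigma$ have $A_0=\{1,\dots,2^\sigma-1\}$ and $A_i=\{i2^\sigma,\dots,(i+1)2^\sigma-1\}$ for $1\le i\le m_1$; $G_r^\sigma$ is the connected component of $\mathcal{G}_r^\sigma$ containing $v_r^\sigma$. $K_n$ is the complete graph; $T_{ts,t}$ is the complete $t$-partite graph with $s$ vertices per part; "copy" means induced subgraph isomorphic to the given graph. For a collection $\mathcal C$ of arc-transitive graphs, a finite simple graph $G$ is $\mathcal C$-homogeneous if for any two isomorphic induced subgraphs $Y_1,Y_2$ of $G$ in $\mathcal C$ (up to isomorphism) and any arcs $(v_i,w_i)$ of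 $Y_i$, some automorphism $f$ of $G$ has $f(Y_1)=Y_2$, $f(v_1)=v_2$, $f(w_1)=w_2$; it is $\mathcal C$-ultrahomogeneous if every isomorphism between induced subgraphs of $G$ belonging to $\mathcal C$ extends to an automorphism of $G$. For non-isomorphic $X_0,X_1$, $G$ is $\{X_0,X_1\}_{\ell_0,\ell_1}^{m_0,m_1}$-homogeneous (resp. -ultrahomogeneous) if it is $\{X_0,X_1\}$-homogeneous (resp. -ultrahomogeneous) and is expressible uniquely as an edge-disjoint union of a family $J_0$ of $\ell_0$ copies of $X_0$ and as an edge-disjoint union of a family $J_1$ of $\ell_1$ copies of $X_1$, with every vertex in exactly $m_i$ members of $J_i$ ($i=0,1$), such that: every copy of $X_1$ in $G$ is in $J_1$ and every copy of $X_0$ is either contained in a copy of $X_1$ or in $J_0$; no two copies of $X_i$ share more than one vertex; each edge $\xi$ lies in exactly one copy $H_0$ of $X_0$ and one copy $H_1$ of $X_1$, with $\xi=H_0\cap H_1$. $K_4$-ultrahomogeneous means every isomorphism between induced $K_4$'s extends to an automorphism. A configuration $(m_c,n_d)$ is an incidence structure of $m$ points and $n$ lines with $c$ lines through each point and $d$ points on each line. Its Menger graph has the points as vertices, two adjacent iff they lie on a common line. The dual configuration exchanges the roles of points and lines; a configuration is self-dual if isomorphic to its dual; the dual Menger graph is the Menger graph of the dual (lines as vertices, adjacent iff they share a point).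
   Formalization: When 2s ≤ t (i.e. ρ ≤ σ), copies of K_{2s} (and of K_4 in the last clause) lying inside a copy of T_{ts,t} are excluded from the homogeneity, decomposition and ultrahomogeneity clauses, since read over all copies these fail, e.g. at (r,σ)=(4,2). *)

theory Defs
  imports Complex_Main "HOL-Library.Z2" "HOL-Library.Function_Algebras"
begin

section \<open>Simple graphs and homogeneity\<close>

record 'a graph =
  verts :: "'a set"
  edges :: "'a set set"

definition finite_simple_graph :: "'a graph \<Rightarrow> bool" where
  "finite_simple_graph G \<longleftrightarrow> finite (verts G) \<and>
     (\<forall>e \<in> edges G. \<exists>u \<in> verts G. \<exists>v \<in> verts G. u \<noteq> v \<and> e = {u, v})"

definition induced :: "'a graph \<Rightarrow> 'a set \<Rightarrow> 'a graph" where
  "induced G Y = \<lparr>verts = verts G \<inter> Y, edges = {e \<in> edges G. e \<subseteq> Y}\<rparr>"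

definition graph_iso :: "('a \<Rightarrow> 'b) \<Rightarrow> 'a graph \<Rightarrow> 'b graph \<Rightarrow> bool" where
  "graph_iso f G H \<longleftrightarrow> bij_betw f (verts G) (verts H) \<and>
     (\<forall>u \<in> verts G. \<forall>v \<in> verts G. {u, v} \<in> edges G \<longleftrightarrow> {f u, f v} \<in> edges H)"

definition isomorphic :: "'a graph \<Rightarrow> 'b graph \<Rightarrow> bool" where
  "isomorphic G H \<longleftrightarrow> (\<exists>f. graph_iso f G H)"

abbreviation automorphism :: "'a graph \<Rightarrow> ('a \<Rightarrow> 'a) \<Rightarrow> bool" where
  "automorphism G f \<equiv> graph_iso f G G"

definition arcs :: "'a graph \<Rightarrow> ('a \<times> 'a) set" where
  "arcs G = {(u, v). u \<in> verts G \<and> v \<in> verts G \<and> {u, v} \<in> edges G}"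

definition arc_transitive :: "'a graph \<Rightarrow> bool" where
  "arc_transitive G \<longleftrightarrow>
     (\<forall>(v, w) \<in> arcs G. \<forall>(v', w') \<in> arcs G. \<exists>f. automorphism G f \<and> f v = v' \<and> f w = w')"

definition regular :: "'a graph \<Rightarrow> nat \<Rightarrow> bool" where
  "regular G d \<longleftrightarrow> (\<forall>v \<in> verts G. card {w \<in> verts G. {v, w} \<in> edges G} = d)"

definition component :: "'a graph \<Rightarrow> 'a \<Rightarrow> 'a graph" where
  "component G v = induced G {w \<in> verts G. (v, w) \<in> (arcs G)\<^sup>*}"

definition connected_graph :: "'a graph \<Rightarrow> bool" where
  "connected_graph G \<longleftrightarrow>
     verts G \<noteq> {} \<and> (\<forall>v \<in> verts G. \<forall>w \<in> verts G. (v, w) \<in> (arcs G)\<^sup>*)"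

definition complete_graph :: "nat \<Rightarrow> nat graph" where
  "complete_graph n = \<lparr>verts = {..<n}, edges = {{i, j} | i j. i < n \<and> j < n \<and> i \<noteq> j}\<rparr>"

text \<open>\<open>T\<^bsub>ts,t\<^esub>\<close>: the \<open>i\<close>-th of the \<open>t\<close> parts is \<open>{i * s..<(i + 1) * s}\<close>.\<close>

definition complete_multipartite :: "nat \<Rightarrow> nat \<Rightarrow> nat graph" where
  "complete_multipartite t s = \<lparr>verts = {..<t * s},
     edges = {{i, j} | i j. i < t * s \<and> j < t * s \<and> i div s \<noteq> j div s}\<rparr>"

text \<open>Copies are induced subgraphs, hence are represented by their vertex sets.\<close>

definition copies :: "'a graph \<Rightarrow> 'b graph \<Rightarrow> 'a set set" where
  "copies G X = {Y. Y \<subseteq> verts G \<and> isomorphic (induced G Y) X}"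

text \<open>Homogeneity and ultrahomogeneity relative to a family \<open>F\<close> of induced subgraphs.\<close>

definition homogeneous_wrt :: "'a graph \<Rightarrow> 'a set set \<Rightarrow> bool" where
  "homogeneous_wrt G F \<longleftrightarrow>
     (\<forall>Y1 \<in> F. \<forall>Y2 \<in> F. isomorphic (induced G Y1) (induced G Y2) \<longrightarrow>
        (\<forall>(v1, w1) \<in> arcs (induced G Y1). \<forall>(v2, w2) \<in> arcs (induced G Y2).
           \<exists>f. automorphism G f \<and> f ` Y1 = Y2 \<and> f v1 = v2 \<and> f w1 = w2))"

definition ultrahomogeneous_wrt :: "'a graph \<Rightarrow> 'a set set \<Rightarrow> bool" where
  "ultrahomogeneous_wrt G F \<longleftrightarrow>
     (\<forall>Y1 \<in> F. \<forall>Y2 \<in> F. \<forall>f. graph_iso f (induced G Y1) (induced G Y2) \<longrightarrow>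
        (\<exists>g. automorphism G g \<and> (\<forall>y \<in> Y1. g y = f y)))"

definition C_homogeneous :: "'a graph \<Rightarrow> 'b graph set \<Rightarrow> bool" where
  "C_homogeneous G C \<longleftrightarrow> homogeneous_wrt G (\<Union>X \<in> C. copies G X)"

definition C_ultrahomogeneous :: "'a graph \<Rightarrow> 'b graph set \<Rightarrow> bool" where
  "C_ultrahomogeneous G C \<longleftrightarrow> ultrahomogeneous_wrt G (\<Union>X \<in> C. copies G X)"

text \<open>
  In the indexed notions below, a copy of \<open>X\<^sub>0\<close> may be contained in a copy of \<open>X\<^sub>1\<close>; this happens
  for \<open>K\<^bsub>2s\<^esub>\<close> and \<open>T\<^bsub>ts,t\<^esub>\<close> as soon as \<open>2 * s \<le> t\<close>. Such a copy cannot belong to \<open>J\<^sub>0\<close>, since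
  a member of \<open>J\<^sub>0\<close> meets a member of \<open>J\<^sub>1\<close> in at most one edge, and no automorphism takes it to a
  copy of \<open>X\<^sub>0\<close> that is not contained in a copy of \<open>X\<^sub>1\<close>. Except in the clause that mentions them
  explicitly, the indexed notions therefore refer to the copies of \<open>X\<^sub>0\<close> that are not contained in
  a copy of \<open>X\<^sub>1\<close>. If there is no containment at all, nothing is left out, see
  \<open>free_copies_eq_copies\<close>.
\<close>

definition free_copies :: "'a graph \<Rightarrow> 'b graph \<Rightarrow> 'b graph \<Rightarrow> 'a set set" where
  "free_copies G X0 X1 = {Y \<in> copies G X0. \<not> (\<exists>Z \<in> copies G X1. Y \<subseteq> Z)}"

lemma free_copies_eq_copies:
  assumes "\<And>Y Z. Y \<in> copies G X0 \<Longrightarrow> Z \<in> copies G X1 \<Longrightarrow> \<not> Y \<subseteq> Z"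
  shows "free_copies G X0 X1 = copies G X0"
    and "homogeneous_wrt G (free_copies G X0 X1 \<union> copies G X1) \<longleftrightarrow> C_homogeneous G {X0, X1}"
    and "ultrahomogeneous_wrt G (free_copies G X0 X1 \<union> copies G X1) \<longleftrightarrow>
           C_ultrahomogeneous G {X0, X1}"
proof -
  show "free_copies G X0 X1 = copies G X0"
    using assms by (auto simp: free_copies_def)
  then show "homogeneous_wrt G (free_copies G X0 X1 \<union> copies G X1) \<longleftrightarrow> C_homogeneous G {X0, X1}"
    and "ultrahomogeneous_wrt G (free_copies G X0 X1 \<union> copies G X1) \<longleftrightarrow>
           C_ultrahomogeneous G {X0, X1}"
    by (simp_all add: C_homogeneous_def C_ultrahomogeneous_def)
qed

definition edge_disjoint_union :: "'a graph \<Rightarrow> 'a set set \<Rightarrow> bool" where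
  "edge_disjoint_union G J \<longleftrightarrow>
     (\<Union>H \<in> J. verts (induced G H)) = verts G \<and>
     (\<Union>H \<in> J. edges (induced G H)) = edges G \<and>
     (\<forall>H \<in> J. \<forall>H' \<in> J. H \<noteq> H' \<longrightarrow> edges (induced G H) \<inter> edges (induced G H') = {})"

definition unique_decomposition :: "'a graph \<Rightarrow> 'a set set \<Rightarrow> 'a set set \<Rightarrow> bool" where
  "unique_decomposition G F J \<longleftrightarrow> J \<subseteq> F \<and> edge_disjoint_union G J \<and>
     (\<forall>J'. J' \<subseteq> F \<and> edge_disjoint_union G J' \<longrightarrow> J' = J)"

definition double_decomposition ::
  "'a graph \<Rightarrow> 'b graph \<Rightarrow> 'b graph \<Rightarrow> nat \<Rightarrow> nat \<Rightarrow> nat \<Rightarrow> nat \<Rightarrow> 'a set set \<Rightarrow> 'a set set \<Rightarrow> bool"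
  where
  "double_decomposition G X0 X1 l0 l1 m0 m1 J0 J1 \<longleftrightarrow>
     unique_decomposition G (free_copies G X0 X1) J0 \<and> card J0 = l0 \<and>
     unique_decomposition G (copies G X1) J1 \<and> card J1 = l1 \<and>
     (\<forall>v \<in> verts G. card {H \<in> J0. v \<in> H} = m0 \<and> card {H \<in> J1. v \<in> H} = m1) \<and>
     (\<forall>H \<in> copies G X1. H \<in> J1) \<and>
     (\<forall>H \<in> copies G X0. (\<exists>H1 \<in> copies G X1. H \<subseteq> H1) \<or> H \<in> J0) \<and>
     (\<forall>H \<in> free_copies G X0 X1. \<forall>H' \<in> free_copies G X0 X1. H \<noteq> H' \<longrightarrow> card (H \<inter> H') \<le> 1) \<and>
     (\<forall>H \<in> copies G X1. \<forall>H' \<in> copies G X1. H \<noteq> H' \<longrightarrow> card (H \<inter> H') \<le> 1) \<and>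
     (\<forall>e \<in> edges G. (\<exists>!H0. H0 \<in> free_copies G X0 X1 \<and> e \<subseteq> H0) \<and>
        (\<exists>!H1. H1 \<in> copies G X1 \<and> e \<subseteq> H1) \<and>
        (\<forall>H0 \<in> free_copies G X0 X1. \<forall>H1 \<in> copies G X1. e \<subseteq> H0 \<and> e \<subseteq> H1 \<longrightarrow> e = H0 \<inter> H1))"

definition indexed_homogeneous ::
  "'a graph \<Rightarrow> 'b graph \<Rightarrow> 'b graph \<Rightarrow> nat \<Rightarrow> nat \<Rightarrow> nat \<Rightarrow> nat \<Rightarrow> bool" where
  "indexed_homogeneous G X0 X1 l0 l1 m0 m1 \<longleftrightarrow>
     finite_simple_graph G \<and> arc_transitive X0 \<and> arc_transitive X1 \<and> \<not> isomorphic X0 X1 \<and>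
     homogeneous_wrt G (free_copies G X0 X1 \<union> copies G X1) \<and>
     (\<exists>J0 J1. double_decomposition G X0 X1 l0 l1 m0 m1 J0 J1)"

definition indexed_ultrahomogeneous ::
  "'a graph \<Rightarrow> 'b graph \<Rightarrow> 'b graph \<Rightarrow> nat \<Rightarrow> nat \<Rightarrow> nat \<Rightarrow> nat \<Rightarrow> bool" where
  "indexed_ultrahomogeneous G X0 X1 l0 l1 m0 m1 \<longleftrightarrow>
     finite_simple_graph G \<and> arc_transitive X0 \<and> arc_transitive X1 \<and> \<not> isomorphic X0 X1 \<and>
     ultrahomogeneous_wrt G (free_copies G X0 X1 \<union> copies G X1) \<and>
     (\<exists>J0 J1. double_decomposition G X0 X1 l0 l1 m0 m1 J0 J1)"


section \<open>Configurations\<close>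

record ('p, 'l) incidence_structure =
  points :: "'p set"
  lines :: "'l set"
  incident :: "'p \<Rightarrow> 'l \<Rightarrow> bool"

text \<open>\<open>configuration S m c n d\<close>: \<open>S\<close> is a configuration \<open>(m\<^sub>c, n\<^sub>d)\<close>.\<close>

definition configuration ::
  "('p, 'l) incidence_structure \<Rightarrow> nat \<Rightarrow> nat \<Rightarrow> nat \<Rightarrow> nat \<Rightarrow> bool" where
  "configuration S m c n d \<longleftrightarrow>
     finite (points S) \<and> card (points S) = m \<and> finite (lines S) \<and> card (lines S) = n \<and>
     (\<forall>p \<in> points S. card {l \<in> lines S. incident S p l} = c) \<and>
     (\<forall>l \<in> lines S. card {p \<in> points S. incident S p l} = d)"

definition menger_graph :: "('p, 'l) incidence_structure \<Rightarrow> 'p graph" where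
  "menger_graph S = \<lparr>verts = points S,
     edges = {{p, q} | p q. p \<in> points S \<and> q \<in> points S \<and> p \<noteq> q \<and>
                (\<exists>l \<in> lines S. incident S p l \<and> incident S q l)}\<rparr>"

definition dual :: "('p, 'l) incidence_structure \<Rightarrow> ('l, 'p) incidence_structure" where
  "dual S = \<lparr>points = lines S, lines = points S, incident = (\<lambda>l p. incident S p l)\<rparr>"

definition incidence_isomorphic ::
  "('p, 'l) incidence_structure \<Rightarrow> ('q, 'k) incidence_structure \<Rightarrow> bool" where
  "incidence_isomorphic S S' \<longleftrightarrow>
     (\<exists>f g. bij_betw f (points S) (points S') \<and> bij_betw g (lines S) (lines S') \<and>
        (\<forall>p \<in> points S. \<forall>l \<in> lines S. incident S p l \<longleftrightarrow> incident S' (f p) (g l)))"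

definition self_dual :: "('p, 'l) incidence_structure \<Rightarrow> bool" where
  "self_dual S \<longleftrightarrow> incidence_isomorphic S (dual S)"


section \<open>Ordered pencils\<close>

text \<open>
  The vectors of \<open>\<bbbF>\<^sub>2\<^sup>r\<close> are the functions \<^typ>\<open>nat \<Rightarrow> bit\<close> that vanish outside \<open>{..<r}\<close>. The integer
  \<open>n\<close> is identified with the vector of its binary digits, the \<open>k\<close>-th coordinate being the digit of
  weight \<open>2 ^ k\<close>.
\<close>

type_synonym vec2 = "nat \<Rightarrow> bit"

definition scale2 :: "bit \<Rightarrow> vec2 \<Rightarrow> vec2" where
  "scale2 c x = (\<lambda>i. c * x i)"

global_interpretation F2: vector_space scale2
  by unfold_locales (auto simp: scale2_def fun_eq_iff algebra_simps)

definition space2 :: "nat \<Rightarrow> vec2 set" where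
  "space2 r = {x. \<forall>i \<ge> r. x i = 0}"

definition vec_of_nat :: "nat \<Rightarrow> vec2" where
  "vec_of_nat n = (\<lambda>k. of_bool (bit n k))"

definition linear_subspace :: "nat \<Rightarrow> nat \<Rightarrow> vec2 set \<Rightarrow> bool" where
  "linear_subspace r d S \<longleftrightarrow> S \<subseteq> space2 r \<and> F2.subspace S \<and> F2.dim S = d"

definition cosets :: "nat \<Rightarrow> vec2 set \<Rightarrow> vec2 set set" where
  "cosets r S = (\<lambda>a. (\<lambda>x. a + x) ` S) ` space2 r"

text \<open>A pencil \<open>(A\<^sub>0, \<dots>, A\<^bsub>m\<^sub>1\<^esub>)\<close>, where \<open>m\<^sub>1 = 2 ^ (r - \<sigma>) - 1\<close>, is a list of length \<open>2 ^ (r - \<sigma>)\<close>.\<close>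

type_synonym pencil = "vec2 set list"

definition ordered_pencil :: "nat \<Rightarrow> nat \<Rightarrow> pencil \<Rightarrow> bool" where
  "ordered_pencil r \<sigma> v \<longleftrightarrow> length v = 2 ^ (r - \<sigma>) \<and> 0 \<notin> v ! 0 \<and>
     (let S = insert 0 (v ! 0) in
        linear_subspace r \<sigma> S \<and> distinct (tl v) \<and> set (tl v) = cosets r S - {S})"

definition pencil_adjacent :: "nat \<Rightarrow> nat \<Rightarrow> pencil \<Rightarrow> pencil \<Rightarrow> bool" where
  "pencil_adjacent r \<sigma> v v' \<longleftrightarrow>
     (let m1 = 2 ^ (r - \<sigma>) - 1; T = insert 0 (v ! 0 \<inter> v' ! 0) in
        linear_subspace r (\<sigma> - 1) T \<and>
        (\<forall>i \<in> {1..m1}. v ! i \<inter> v' ! i \<in> cosets r T - {T}) \<and>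
        linear_subspace r (r - 1) (insert 0 (\<Union>i \<in> {0..m1}. v ! i \<inter> v' ! i)))"

definition pencil_graph :: "nat \<Rightarrow> nat \<Rightarrow> pencil graph" where
  "pencil_graph r \<sigma> = \<lparr>verts = {v. ordered_pencil r \<sigma> v},
     edges = {{v, v'} | v v'. ordered_pencil r \<sigma> v \<and> ordered_pencil r \<sigma> v' \<and>
                pencil_adjacent r \<sigma> v v'}\<rparr>"

definition base_pencil :: "nat \<Rightarrow> nat \<Rightarrow> pencil" where
  "base_pencil r \<sigma> = vec_of_nat ` {1..2 ^ \<sigma> - 1} #
     map (\<lambda>i. vec_of_nat ` {i * 2 ^ \<sigma>..(i + 1) * 2 ^ \<sigma> - 1}) [1..<2 ^ (r - \<sigma>)]"

definition pencil_component :: "nat \<Rightarrow> nat \<Rightarrow> pencil graph" where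
  "pencil_component r \<sigma> = component (pencil_graph r \<sigma>) (base_pencil r \<sigma>)"

end

theory Submission
  imports Defs "HOL-Library.FuncSet" "HOL-Combinatorics.Transposition"
begin

text \<open>
  An ordered pencil labels the vectors of \<open>\<bbbF>\<^sub>2\<^sup>r\<close> by \<open>0, \<dots>, 2\<^sup>\<rho> - 1\<close>, the classes being the cosets of \<open>S\<close>. Two
  adjacent labellings agree exactly on a hyperplane that meets every class, so both induce the same addition
  on the labels. Along the component of the base pencil the label is therefore the value of a surjective
  linear map, given by a \<open>\<rho> \<times> r\<close> matrix \<open>\<phi>\<close> of full rank, and the neighbours of \<open>\<phi>\<close> are the matrices
  \<open>\<phi> + c f\<^sup>T\<close> with \<open>c \<noteq> 0\<close> and \<open>f\<close> outside the row space of \<open>\<phi>\<close>. Fixing \<open>f\<close> gives the cliques of \<open>J\<^sub>0\<close>, fixing \<open>c\<close>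
  the complete multipartite graphs of \<open>J\<^sub>1\<close>; there are no others, because two matrices of rank one whose sum
  has rank one share \<open>c\<close> or \<open>f\<close>. Invertible row and column operations act transitively on the arcs. For
  \<open>\<sigma> = 1\<close> the relation \<open>p q\<^sup>T = 1\<close> is a polarity.
\<close>

section \<open>Vectors over the field with two elements\<close>

text \<open>The condition that \<open>f\<close> lies outside the row space explains the constants.
  It leaves \<open>c\<close> free, so a direction \<open>f\<close> gives
  \<open>2 ^ n = 2 * s\<close> pairwise adjacent matrices. For fixed \<open>c\<close> the matrices
  share the space \<open>U\<close> of combinations \<open>comb n a \<phi>\<close> with
  \<open>dot n a c = 0\<close>, which has \<open>2 ^ (n - 1) = s\<close> elements. Two of them are
  non-adjacent exactly when their row spaces coincide, so the parts correspond to the nonzero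
  vectors of the quotient by \<open>U\<close>, which has dimension \<open>\<sigma> + 1\<close>;
  hence \<open>t\<close>.

  That the component contains every matrix of full rank rests on there being fewer rows than
  columns: a path is lifted to one more row by choosing the new row outside the span of the old rows
  and of the direction of the step.

  The value \<open>n = 2\<close> is special because every bijection of a four-element space that
  fixes zero is linear. So the labelling of every ordered pencil is linear, and every permutation of
  the four points of a line is affine. With eight or more labels both fail, which leaves room for
  pencils outside the component and for permutations of a line that no automorphism induces.\<close>

class char2 = ab_group_add +
  assumes add_self [simp]: "x + x = 0"
begin

lemma add_self_left [simp]: "x + (x + y) = y"
  by (metis add_0_left add_assoc add_self)

lemma uminus_char2 [simp]: "- x = x"
  using add_self minus_unique by blast

lemma diff_char2 [simp]: "x - y = x + y"
  by (metis add_uminus_conv_diff uminus_char2)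

lemma add_eq_0_char2 [simp]: "x + y = 0 \<longleftrightarrow> x = y"
  by (metis add_eq_0_iff uminus_char2)

lemma add_eq_char2: "x + y = z \<longleftrightarrow> x = y + z"
  by (metis add_commute add_self_left)

end

instance bit :: char2
proof
  fix x :: bit show "x + x = 0" by (cases x) auto
qed

text \<open>Applied twice this covers matrices, so bits, vectors and matrices share one set of
  cancellation rules.\<close>

instance "fun" :: (type, char2) char2
  by standard (simp add: fun_eq_iff)

text \<open>Otherwise the simplifier would turn sums and products of bits into bit operations.\<close>

declare add_bit_eq_xor [simp del] mult_bit_eq_and [simp del]

lemma bit_eq_1_or_0: "(b::bit) = 0 \<or> b = 1"
  by (cases b) auto

definition unit2 :: "nat \<Rightarrow> vec2" where
  "unit2 k = (\<lambda>i. of_bool (i = k))"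

definition dot :: "nat \<Rightarrow> vec2 \<Rightarrow> vec2 \<Rightarrow> bit" where
  "dot n x y = (\<Sum>i<n. x i * y i)"

text \<open>With only two scalars, additivity is linearity. The domain is explicit because
  labellings and transported bases are controlled on \<open>space2 n\<close> only.\<close>

definition additive_on :: "'a::plus set \<Rightarrow> ('a \<Rightarrow> 'b::plus) \<Rightarrow> bool" where
  "additive_on S f \<longleftrightarrow> (\<forall>x\<in>S. \<forall>y\<in>S. f (x + y) = f x + f y)"

lemma scale2_apply [simp]: "scale2 c x i = c * x i"
  by (simp add: scale2_def)

lemma scale2_0 [simp]: "scale2 0 x = 0" "scale2 c 0 = 0"
  by (simp_all add: fun_eq_iff)

lemma scale2_1 [simp]: "scale2 1 x = x"
  by (simp add: fun_eq_iff)

lemma space2_0 [simp]: "0 \<in> space2 n"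
  by (simp add: space2_def)

lemma space2_add [simp]: "x \<in> space2 n \<Longrightarrow> y \<in> space2 n \<Longrightarrow> x + y \<in> space2 n"
  by (simp add: space2_def)

lemma space2_scale [simp]: "x \<in> space2 n \<Longrightarrow> scale2 c x \<in> space2 n"
  by (simp add: space2_def)

lemma unit2_space2 [simp]: "k < n \<Longrightarrow> unit2 k \<in> space2 n"
  by (simp add: space2_def unit2_def)

lemma unit2_neq_0 [simp]: "unit2 k \<noteq> 0"
  by (simp add: unit2_def fun_eq_iff)

lemma unit2_apply: "unit2 k i = of_bool (i = k)"
  by (simp add: unit2_def)

lemma space2_mono: "m \<le> n \<Longrightarrow> space2 m \<subseteq> space2 n"
  by (auto simp: space2_def)

lemma bij_betw_space2:
  "bij_betw (\<lambda>A i. of_bool (i \<in> A)) (Pow {..<n}) (space2 n)"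
proof (rule bij_betwI [where g = "\<lambda>x. {i. i < n \<and> x i = 1}"])
  show "(\<lambda>A i. of_bool (i \<in> A)) \<in> Pow {..<n} \<rightarrow> space2 n"
    by (auto simp: space2_def)
  show "(\<lambda>x. {i. i < n \<and> x i = 1}) \<in> space2 n \<rightarrow> Pow {..<n}"
    by auto
  show "{i. i < n \<and> (of_bool (i \<in> A) :: bit) = 1} = A" if "A \<in> Pow {..<n}" for A
    using that by auto
  show "(\<lambda>i. of_bool (i \<in> {i. i < n \<and> y i = 1})) = y" if "y \<in> space2 n" for y
  proof
    fix i
    show "of_bool (i \<in> {i. i < n \<and> y i = 1}) = y i"
      using that by (cases "y i") (auto simp: space2_def not_less[symmetric])
  qed
qed

lemma finite_space2 [simp]: "finite (space2 n)"
  using bij_betw_finite [OF bij_betw_space2 [of n]] by simp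

lemma card_space2 [simp]: "card (space2 n) = 2 ^ n"
  using bij_betw_same_card [OF bij_betw_space2 [of n]] by (simp add: card_Pow)

lemma dot_commute: "dot n x y = dot n y x"
  by (simp add: dot_def mult.commute)

lemma dot_add_left [simp]: "dot n (x + y) z = dot n x z + dot n y z"
  by (simp add: dot_def distrib_right sum.distrib)

lemma dot_add_right [simp]: "dot n x (y + z) = dot n x y + dot n x z"
  by (simp add: dot_def distrib_left sum.distrib)

lemma dot_scale_left [simp]: "dot n (scale2 c x) y = c * dot n x y"
  by (simp add: dot_def sum_distrib_left mult.assoc)

lemma dot_0 [simp]: "dot n 0 x = 0" "dot n x 0 = 0"
  by (simp_all add: dot_def)

lemma dot_unit2_left [simp]: "k < n \<Longrightarrow> dot n (unit2 k) x = x k"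
  by (simp add: dot_def unit2_apply of_bool_def if_distrib [of "\<lambda>c. c * _"] sum.delta cong: if_cong)

lemma dot_unit2_right [simp]: "k < n \<Longrightarrow> dot n x (unit2 k) = x k"
  by (simp add: dot_commute [of n x])

lemma dot_nondegenerate:
  assumes "x \<in> space2 n" "\<And>y. y \<in> space2 n \<Longrightarrow> dot n y x = 0"
  shows "x = 0"
proof
  fix i
  show "x i = 0 i"
  proof (cases "i < n")
    case True
    then show ?thesis using assms(2) [of "unit2 i"] by simp
  next
    case False
    then show ?thesis using assms(1) by (simp add: space2_def)
  qed
qed

lemma additive_on_0:
  fixes f :: "'a::monoid_add \<Rightarrow> 'b::char2"
  assumes "additive_on S f" "0 \<in> S"
  shows "f 0 = 0"
proof -
  have "f 0 = f 0 + f 0"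
    using assms unfolding additive_on_def by (metis add_0_left)
  then show ?thesis by simp
qed

lemma additive_on_eqI:
  fixes f g :: "vec2 \<Rightarrow> 'b::char2"
  assumes "additive_on (space2 n) f" "additive_on (space2 n) g"
    and "\<And>k. k < n \<Longrightarrow> f (unit2 k) = g (unit2 k)"
    and "x \<in> space2 n"
  shows "f x = g x"
  using assms
proof (induction n arbitrary: x)
  case 0
  then have "x = 0" by (auto simp: space2_def)
  then show ?case
    using 0 additive_on_0 by (metis space2_0)
next
  case (Suc n)
  have add: "additive_on (space2 n) f" "additive_on (space2 n) g"
    using Suc.prems space2_mono [of n "Suc n"] by (auto simp: additive_on_def subset_iff)
  define x' where "x' = x(n := 0)"
  have x': "x' \<in> space2 n" "x' \<in> space2 (Suc n)"
    using Suc.prems by (auto simp: x'_def space2_def)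
  have eq: "f x' = g x'"
    using Suc.IH add Suc.prems x' by simp
  have "x = x' + scale2 (x n) (unit2 n)"
    by (auto simp: x'_def fun_eq_iff unit2_apply)
  then consider "x = x'" | "x = x' + unit2 n"
    by (metis bit_eq_1_or_0 scale2_0(1) scale2_1 add.right_neutral)
  then show ?case
  proof cases
    case 2
    have u: "unit2 n \<in> space2 (Suc n)" by simp
    have "f x = f x' + f (unit2 n)" "g x = g x' + g (unit2 n)"
      using Suc.prems(1,2) u x'(2) unfolding additive_on_def 2 by blast+
    with eq Suc.prems(3) [of n] show ?thesis by simp
  qed (use eq in simp)
qed

lemma additive_functional:
  assumes "additive_on (space2 n) (f :: vec2 \<Rightarrow> bit)"
  obtains a where "a \<in> space2 n" "\<And>x. x \<in> space2 n \<Longrightarrow> f x = dot n a x"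
proof
  define a where "a = (\<lambda>j. if j < n then f (unit2 j) else 0)"
  show "a \<in> space2 n" by (simp add: a_def space2_def)
  show "f x = dot n a x" if "x \<in> space2 n" for x
  proof (rule additive_on_eqI [OF assms _ _ that])
    show "additive_on (space2 n) (dot n a)" by (simp add: additive_on_def)
    show "f (unit2 k) = dot n a (unit2 k)" if "k < n" for k
      using that by (simp add: a_def)
  qed
qed

lemma inj_on_additive:
  fixes f :: "'a::char2 \<Rightarrow> 'b::char2"
  assumes "additive_on S f" "\<And>x y. x \<in> S \<Longrightarrow> y \<in> S \<Longrightarrow> x + y \<in> S"
    and "\<And>x. x \<in> S \<Longrightarrow> f x = 0 \<Longrightarrow> x = 0"
  shows "inj_on f S"
proof (rule inj_onI)
  fix x y assume *: "x \<in> S" "y \<in> S" "f x = f y"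
  then have "f (x + y) = 0" using assms(1) by (simp add: additive_on_def)
  with assms(2,3) * show "x = y" by (metis add_eq_0_char2)
qed

text \<open>All nonempty fibres are translates of the kernel, so they have the same size.\<close>

lemma card_fibre_additive:
  fixes f :: "vec2 \<Rightarrow> 'b::char2"
  assumes f: "additive_on (space2 m) f" and y: "y \<in> f ` space2 m"
  shows "card (f ` space2 m) * card {x \<in> space2 m. f x = y} = 2 ^ m"
proof -
  let ?F = "\<lambda>z. {x \<in> space2 m. f x = z}"
  have same: "card (?F z) = card (?F 0)" if z: "z \<in> f ` space2 m" for z
  proof -
    obtain w where w: "w \<in> space2 m" "f w = z" using z by auto
    have fw: "f (w + x) = z + f x" if "x \<in> space2 m" for x
      using w f that by (simp add: additive_on_def)
    have "bij_betw (\<lambda>x. w + x) (?F 0) (?F z)"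
      by (rule bij_betwI [where g = "\<lambda>x. w + x"]) (auto simp: w(1) fw)
    from bij_betw_same_card [OF this] show ?thesis by simp
  qed
  have "2 ^ m = card (\<Union>z\<in>f ` space2 m. ?F z)"
    by (subst card_space2 [symmetric]) (rule arg_cong [of _ _ card], auto)
  also have "\<dots> = (\<Sum>z\<in>f ` space2 m. card (?F z))"
    by (rule card_UN_disjoint) auto
  also have "\<dots> = (\<Sum>z\<in>f ` space2 m. card (?F y))"
    by (intro sum.cong refl) (rule trans [OF same sym [OF same [OF y]]])
  finally show ?thesis by simp
qed

text \<open>A nonzero functional takes both values, so each of its two fibres is half of the
  space.\<close>

lemma card_dot_eq:
  assumes "c \<in> space2 n" "c \<noteq> 0"
  shows "card {a \<in> space2 n. dot n a c = b} = 2 ^ (n - 1)"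
proof -
  obtain k where k: "c k = 1" using assms by (auto simp: fun_eq_iff)
  then have kn: "k < n" using assms(1) by (auto simp: space2_def not_less[symmetric])
  have add: "additive_on (space2 n) (\<lambda>a. dot n a c)"
    by (simp add: additive_on_def)
  have UNIV: "UNIV = {0, 1::bit}" using bit_eq_1_or_0 by auto
  have "0 \<in> (\<lambda>a. dot n a c) ` space2 n"
    by (rule image_eqI [of _ _ 0]) simp_all
  moreover have "1 \<in> (\<lambda>a. dot n a c) ` space2 n"
    by (rule image_eqI [of _ _ "unit2 k"]) (simp_all add: k kn)
  ultimately have im: "(\<lambda>a. dot n a c) ` space2 n = UNIV"
    using UNIV by (metis (lifting) UNIV_eq_I bit_eq_1_or_0)
  have "card (UNIV :: bit set) = 2" unfolding UNIV by simp
  then have "2 * card {a \<in> space2 n. dot n a c = b} = 2 ^ n"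
    using card_fibre_additive [OF add, of b] im by simp
  moreover have "(2::nat) ^ n = 2 * 2 ^ (n - 1)" using kn by (cases n) auto
  ultimately show ?thesis by simp
qed

section \<open>Matrices of full row rank\<close>

text \<open>Multiplication of a matrix by a row vector from the left. Its adjoint is
  \<open>mv\<close>, multiplication by a column vector from the right, see
  \<open>dot_mv\<close>.\<close>

definition comb :: "nat \<Rightarrow> vec2 \<Rightarrow> (nat \<Rightarrow> vec2) \<Rightarrow> vec2" where
  "comb n a \<phi> = (\<Sum>i<n. scale2 (a i) (\<phi> i))"

definition mv :: "nat \<Rightarrow> (nat \<Rightarrow> vec2) \<Rightarrow> vec2 \<Rightarrow> vec2" where
  "mv r \<phi> x = (\<lambda>i. dot r (\<phi> i) x)"

definition outer :: "vec2 \<Rightarrow> vec2 \<Rightarrow> nat \<Rightarrow> vec2" where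
  "outer c f = (\<lambda>i. scale2 (c i) f)"

text \<open>Rows from \<open>n\<close> on are required to be zero so that equality of matrices is
  equality of functions.\<close>

definition full_rank :: "nat \<Rightarrow> nat \<Rightarrow> (nat \<Rightarrow> vec2) set" where
  "full_rank n r = {\<phi>. (\<forall>i<n. \<phi> i \<in> space2 r) \<and> (\<forall>i\<ge>n. \<phi> i = 0) \<and>
     (\<forall>a\<in>space2 n. comb n a \<phi> = 0 \<longrightarrow> a = 0)}"

definition row_space :: "nat \<Rightarrow> (nat \<Rightarrow> vec2) \<Rightarrow> vec2 set" where
  "row_space n \<phi> = (\<lambda>a. comb n a \<phi>) ` space2 n"

lemma full_rankD:
  assumes "\<phi> \<in> full_rank n r"
  shows "\<phi> i \<in> space2 r" "i \<ge> n \<Longrightarrow> \<phi> i = 0" "a \<in> space2 n \<Longrightarrow> comb n a \<phi> = 0 \<Longrightarrow> a = 0"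
  using assms by (auto simp: full_rank_def) (metis linorder_not_less space2_0)

lemma full_rankI:
  assumes "\<And>i. i < n \<Longrightarrow> \<phi> i \<in> space2 r" "\<And>i. i \<ge> n \<Longrightarrow> \<phi> i = 0"
    and "\<And>a. a \<in> space2 n \<Longrightarrow> comb n a \<phi> = 0 \<Longrightarrow> a = 0"
  shows "\<phi> \<in> full_rank n r"
  using assms by (simp add: full_rank_def)

lemma outer_apply [simp]: "outer c f i = scale2 (c i) f"
  by (simp add: outer_def)

lemma comb_Suc: "comb (Suc n) a \<phi> = comb n a \<phi> + scale2 (a n) (\<phi> n)"
  by (simp add: comb_def)

lemma comb_cong: "(\<And>i. i < n \<Longrightarrow> a i = b i) \<Longrightarrow> (\<And>i. i < n \<Longrightarrow> \<phi> i = \<psi> i) \<Longrightarrow> comb n a \<phi> = comb n b \<psi>"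
  by (simp add: comb_def)

lemma comb_add_left [simp]: "comb n (a + b) \<phi> = comb n a \<phi> + comb n b \<phi>"
proof -
  have "scale2 (c + d) x = scale2 c x + scale2 d x" for c d x
    by (simp add: fun_eq_iff distrib_right)
  then show ?thesis by (simp add: comb_def sum.distrib)
qed

lemma comb_add_right [simp]: "comb n a (\<phi> + \<psi>) = comb n a \<phi> + comb n a \<psi>"
proof -
  have "scale2 c (x + y) = scale2 c x + scale2 c y" for c x y
    by (simp add: fun_eq_iff distrib_left)
  then show ?thesis by (simp add: comb_def sum.distrib)
qed

lemma comb_0 [simp]: "comb n 0 \<phi> = 0" "comb n a 0 = 0"
  by (simp_all add: comb_def)

lemma comb_apply: "comb n a \<phi> j = (\<Sum>i<n. a i * \<phi> i j)"
  by (induction n) (simp_all add: comb_def)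

lemma comb_outer [simp]: "comb n a (outer c f) = scale2 (dot n a c) f"
  by (simp add: fun_eq_iff comb_apply dot_def sum_distrib_right mult.assoc)

lemma comb_unit2 [simp]: "k < n \<Longrightarrow> comb n (unit2 k) \<phi> = \<phi> k"
  by (simp add: fun_eq_iff comb_apply unit2_apply of_bool_def if_distrib [of "\<lambda>c. c * _"] sum.delta cong: if_cong)

lemma comb_space2: "(\<And>i. i < n \<Longrightarrow> \<phi> i \<in> space2 r) \<Longrightarrow> comb n a \<phi> \<in> space2 r"
  by (simp add: space2_def comb_apply)

lemma comb_full_rank [simp]: "\<phi> \<in> full_rank n r \<Longrightarrow> comb n a \<phi> \<in> space2 r"
  by (simp add: comb_space2 full_rankD)

lemma additive_comb: "additive_on S (\<lambda>a. comb n a \<phi>)"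
  by (simp add: additive_on_def)

lemma inj_on_comb: "\<phi> \<in> full_rank n r \<Longrightarrow> inj_on (\<lambda>a. comb n a \<phi>) (space2 n)"
  by (rule inj_on_additive [OF additive_comb]) (auto dest: full_rankD)

lemma row_space_subset: "\<phi> \<in> full_rank n r \<Longrightarrow> row_space n \<phi> \<subseteq> space2 r"
  by (auto simp: row_space_def)

lemma card_row_space: "\<phi> \<in> full_rank n r \<Longrightarrow> card (row_space n \<phi>) = 2 ^ n"
  by (simp add: row_space_def card_image inj_on_comb)

lemma row_space_0 [simp]: "0 \<in> row_space n \<phi>"
  unfolding row_space_def by (metis comb_0(1) imageI space2_0)

lemma row_space_add: "x \<in> row_space n \<phi> \<Longrightarrow> y \<in> row_space n \<phi> \<Longrightarrow> x + y \<in> row_space n \<phi>"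
  unfolding row_space_def by (auto simp flip: comb_add_left)

lemma row_space_add_iff: "x \<in> row_space n \<phi> \<Longrightarrow> x + y \<in> row_space n \<phi> \<longleftrightarrow> y \<in> row_space n \<phi>"
  by (metis add_self_left row_space_add)

lemma row_space_cong: "(\<And>i. i < n \<Longrightarrow> \<phi> i = \<psi> i) \<Longrightarrow> row_space n \<phi> = row_space n \<psi>"
  by (auto simp: row_space_def intro!: image_cong comb_cong)

lemma rank_le: "\<phi> \<in> full_rank n r \<Longrightarrow> n \<le> r"
  using card_mono [OF finite_space2 row_space_subset] card_row_space
  by (metis card_space2 one_less_numeral_iff power_le_imp_le_exp semiring_norm(76))

lemma exists_not_in_row_space:
  assumes "\<phi> \<in> full_rank n r" "n < r"
  obtains y where "y \<in> space2 r" "y \<notin> row_space n \<phi>"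
proof -
  have "card (row_space n \<phi>) < card (space2 r)"
    using assms by (simp add: card_row_space)
  then have "\<not> space2 r \<subseteq> row_space n \<phi>"
    using row_space_subset [OF assms(1)] by (metis less_irrefl subset_antisym)
  then show ?thesis using that by auto
qed

text \<open>The direction \<open>f\<close> of an edge is a legal new row. Stacking it turns
  statements about an edge or a line into statements about one matrix of rank
  \<open>Suc n\<close>.\<close>

lemma full_rank_stack:
  "\<phi>(n := y) \<in> full_rank (Suc n) r" if \<phi>: "\<phi> \<in> full_rank n r" and y: "y \<in> space2 r" "y \<notin> row_space n \<phi>"
proof -
  have "a = 0" if a: "a \<in> space2 (Suc n)" "comb (Suc n) a (\<phi>(n := y)) = 0" for a
  proof -
    define b where "b = a(n := 0)"
    have b: "b \<in> space2 n" using a(1) by (auto simp: b_def space2_def)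
    have "comb n a (\<phi>(n := y)) = comb n b \<phi>"
      by (rule comb_cong) (auto simp: b_def)
    then have *: "comb n b \<phi> = scale2 (a n) y"
      using a(2) by (simp add: comb_Suc)
    have "a n = 0"
      using * y(2) b by (cases "a n") (auto simp: row_space_def)
    moreover from this have "b = 0" using * \<phi> b full_rankD(3) by simp
    ultimately show "a = 0"
      by (metis b_def fun_upd_triv)
  qed
  then show ?thesis
    using full_rankD(1,2) [OF \<phi>] y(1) by (intro full_rankI) auto
qed

lemma full_rank_unstack:
  assumes "\<phi> \<in> full_rank (Suc n) r"
  shows "\<phi>(n := 0) \<in> full_rank n r" "\<phi> n \<notin> row_space n (\<phi>(n := 0))"
proof -
  have "a = 0" if a: "a \<in> space2 n" "comb n a (\<phi>(n := 0)) = 0" for a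
  proof (rule full_rankD(3) [OF assms])
    show "a \<in> space2 (Suc n)" using a(1) space2_mono [of n "Suc n"] by auto
    have "comb n a (\<phi>(n := 0)) = comb n a \<phi>" by (rule comb_cong) auto
    then show "comb (Suc n) a \<phi> = 0" using a by (simp add: comb_Suc space2_def)
  qed
  then show "\<phi>(n := 0) \<in> full_rank n r"
    using full_rankD(1,2) [OF assms] by (intro full_rankI) (simp_all add: Suc_le_eq)
  show "\<phi> n \<notin> row_space n (\<phi>(n := 0))"
  proof
    assume "\<phi> n \<in> row_space n (\<phi>(n := 0))"
    then obtain a where a: "a \<in> space2 n" "\<phi> n = comb n a (\<phi>(n := 0))"
      by (auto simp: row_space_def)
    have "comb n a (\<phi>(n := 0)) = comb n (a(n := 1)) \<phi>" by (rule comb_cong) auto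
    then have "comb (Suc n) (a(n := 1)) \<phi> = 0" using a by (simp add: comb_Suc)
    moreover have "a(n := 1) \<in> space2 (Suc n)" using a(1) by (auto simp: space2_def)
    ultimately have "a(n := 1) = 0" using assms full_rankD(3) by blast
    then show False by (auto simp: fun_eq_iff split: if_splits)
  qed
qed

text \<open>Surjectivity of \<open>mv\<close> follows by counting for square matrices and is then
  read off the first \<open>n\<close> rows of a square extension.\<close>

lemma full_rank_square_extension:
  assumes "\<phi> \<in> full_rank n r"
  shows "\<exists>\<Phi>\<in>full_rank r r. \<forall>i<n. \<Phi> i = \<phi> i"
proof -
  have "n \<le> r" using assms rank_le by blast
  then show ?thesis
    using assms
  proof (induction arbitrary: \<phi> rule: inc_induct)
    case (step n)
    obtain y where y: "y \<in> space2 r" "y \<notin> row_space n \<phi>"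
      using exists_not_in_row_space step by blast
    obtain \<Phi> where "\<Phi>\<in>full_rank r r" "\<forall>i<Suc n. \<Phi> i = (\<phi>(n := y)) i"
      using step.IH full_rank_stack [OF step.prems y] by blast
    then show ?case by (metis fun_upd_other less_SucI less_irrefl)
  qed blast
qed

section \<open>Matrices as linear maps: image, kernel and fibres\<close>

lemma mv_apply: "mv r \<phi> x i = dot r (\<phi> i) x"
  by (simp add: mv_def)

lemma mv_add_left [simp]: "mv r (\<phi> + \<psi>) x = mv r \<phi> x + mv r \<psi> x"
  by (simp add: mv_apply fun_eq_iff)

lemma mv_add_right [simp]: "mv r \<phi> (x + y) = mv r \<phi> x + mv r \<phi> y"
  by (simp add: mv_apply fun_eq_iff)

lemma mv_0 [simp]: "mv r \<phi> 0 = 0"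
  by (simp add: mv_apply fun_eq_iff)

lemma mv_outer [simp]: "mv r (outer c f) x = scale2 (dot r f x) c"
  by (simp add: mv_apply fun_eq_iff mult.commute)

lemma mv_space2: "(\<And>i. i \<ge> n \<Longrightarrow> \<phi> i = 0) \<Longrightarrow> mv r \<phi> x \<in> space2 n"
  by (simp add: space2_def mv_apply)

lemma mv_full_rank [simp]: "\<phi> \<in> full_rank n r \<Longrightarrow> mv r \<phi> x \<in> space2 n"
  by (meson mv_space2 full_rankD(2))

lemma additive_mv: "additive_on S (mv r \<phi>)"
  by (simp add: additive_on_def)

lemma dot_mv: "dot n a (mv r \<phi> x) = dot r (comb n a \<phi>) x"
  by (simp add: dot_def mv_apply comb_apply sum_distrib_left sum_distrib_right mult.assoc)
    (rule sum.swap)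

text \<open>The rows span the whole space, so a vector of the kernel is orthogonal to
  everything.\<close>

lemma mv_square_bij:
  assumes "\<Phi> \<in> full_rank r r"
  shows "bij_betw (mv r \<Phi>) (space2 r) (space2 r)"
proof -
  have sur: "(\<lambda>a. comb r a \<Phi>) ` space2 r = space2 r"
    using card_row_space [OF assms] row_space_subset [OF assms]
    by (metis card_space2 card_subset_eq finite_space2 row_space_def)
  have inj: "inj_on (mv r \<Phi>) (space2 r)"
  proof (rule inj_on_additive [OF additive_mv])
    fix x assume x: "x \<in> space2 r" "mv r \<Phi> x = 0"
    show "x = 0"
    proof (rule dot_nondegenerate [OF x(1)])
      fix y assume "y \<in> space2 r"
      then obtain a where "y = comb r a \<Phi>" using sur by blast
      then show "dot r y x = 0" using x(2) dot_mv [of r a r \<Phi> x] by simp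
    qed
  qed auto
  have "mv r \<Phi> ` space2 r \<subseteq> space2 r" using assms by auto
  then show ?thesis
    using inj by (simp add: bij_betw_def endo_inj_surj)
qed

lemma mv_surj:
  assumes "\<phi> \<in> full_rank n r"
  shows "mv r \<phi> ` space2 r = space2 n"
proof
  show "mv r \<phi> ` space2 r \<subseteq> space2 n" using assms by auto
  obtain \<Phi> where \<Phi>: "\<Phi> \<in> full_rank r r" "\<forall>i<n. \<Phi> i = \<phi> i"
    using full_rank_square_extension [OF assms] by blast
  show "space2 n \<subseteq> mv r \<phi> ` space2 r"
  proof
    fix y assume y: "y \<in> space2 n"
    then have "y \<in> space2 r" using rank_le [OF assms] space2_mono by blast
    then obtain x where x: "x \<in> space2 r" "mv r \<Phi> x = y"
      using mv_square_bij [OF \<Phi>(1)] by (metis bij_betw_imp_surj_on imageE)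
    have "mv r \<phi> x i = y i" for i
      using x(2) \<Phi>(2) y full_rankD(2) [OF assms, of i]
      by (cases "i < n") (auto simp: mv_apply space2_def)
    then have "y = mv r \<phi> x" by (simp add: fun_eq_iff)
    then show "y \<in> mv r \<phi> ` space2 r" using x(1) by blast
  qed
qed

text \<open>The coefficients of a vanishing combination of rows are orthogonal to the image of
  \<open>mv\<close>, hence to all of \<open>space2 n\<close>.\<close>

lemma full_rankI_surj:
  assumes "\<And>i. i < n \<Longrightarrow> \<phi> i \<in> space2 r" "\<And>i. i \<ge> n \<Longrightarrow> \<phi> i = 0"
    and "space2 n \<subseteq> mv r \<phi> ` space2 r"
  shows "\<phi> \<in> full_rank n r"
proof -
  have "a = 0" if a: "a \<in> space2 n" "comb n a \<phi> = 0" for a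
  proof (rule dot_nondegenerate [OF a(1)])
    fix y assume "y \<in> space2 n"
    then obtain x where "y = mv r \<phi> x" using assms(3) by blast
    then show "dot n y a = 0" using dot_mv [of n a r \<phi> x] a(2) by (simp add: dot_commute)
  qed
  then show ?thesis using assms(1,2) by (intro full_rankI)
qed

lemma card_mv_fibre:
  assumes "\<phi> \<in> full_rank n r" "y \<in> space2 n"
  shows "card {x \<in> space2 r. mv r \<phi> x = y} = 2 ^ (r - n)"
proof -
  have "2 ^ n * card {x \<in> space2 r. mv r \<phi> x = y} = 2 ^ r"
    using card_fibre_additive [OF additive_mv [of "space2 r" r \<phi>]] mv_surj [OF assms(1)] assms(2) by simp
  also have "(2::nat) ^ r = 2 ^ n * 2 ^ (r - n)"
    using rank_le [OF assms(1)] by (simp flip: power_add)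
  finally show ?thesis by simp
qed

text \<open>Both frames are extended to bases one vector at a time.\<close>

lemma frame_transport:
  assumes "\<phi> \<in> full_rank k r" "\<psi> \<in> full_rank k r"
  shows "\<exists>A. additive_on (space2 r) A \<and> bij_betw A (space2 r) (space2 r) \<and> (\<forall>i<k. A (\<phi> i) = \<psi> i)"
proof -
  have "k \<le> r" using assms rank_le by blast
  then show ?thesis
    using assms
  proof (induction arbitrary: \<phi> \<psi> rule: inc_induct)
    case base
    let ?a = "\<lambda>a. comb r a \<phi>" and ?b = "\<lambda>a. comb r a \<psi>"
    have bij: "bij_betw (\<lambda>a. comb r a \<chi>) (space2 r) (space2 r)" if "\<chi> \<in> full_rank r r" for \<chi>
    proof -
      have "(\<lambda>a. comb r a \<chi>) ` space2 r = space2 r"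
        by (rule endo_inj_surj) (use inj_on_comb [OF that] that in auto)
      then show ?thesis using inj_on_comb [OF that] by (simp add: bij_betw_def)
    qed
    \<comment> \<open>\<open>A\<close> reads off the coordinates in the basis \<open>\<phi>\<close>
      and rebuilds the vector in the basis \<open>\<psi>\<close>.\<close>
    define A where "A = ?b \<circ> inv_into (space2 r) ?a"
    have A: "A (?a a) = ?b a" if "a \<in> space2 r" for a
      unfolding A_def comp_def by (subst inv_into_f_f [OF inj_on_comb [OF base(1)] that]) simp
    have "bij_betw A (space2 r) (space2 r)"
      unfolding A_def
      by (rule bij_betw_trans [OF bij_betw_inv_into [OF bij [OF base(1)]] bij [OF base(2)]])
    moreover have "additive_on (space2 r) A"
      unfolding additive_on_def
    proof (intro ballI)
      fix x y assume "x \<in> space2 r" "y \<in> space2 r"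
      then obtain a b where ab: "a \<in> space2 r" "b \<in> space2 r" "x = ?a a" "y = ?a b"
        using bij [OF base(1)] by (metis (no_types, lifting) bij_betw_imp_surj_on imageE)
      have "A (x + y) = A (?a (a + b))" by (simp add: ab)
      also have "\<dots> = ?b (a + b)" by (rule A) (use ab in simp)
      finally show "A (x + y) = A x + A y" using A ab by simp
    qed
    moreover have "A (\<phi> i) = \<psi> i" if "i < r" for i
      using A [of "unit2 i"] that by simp
    ultimately show ?case by (intro exI [of _ A] conjI allI impI)
  next
    case (step k)
    obtain y where y: "y \<in> space2 r" "y \<notin> row_space k \<phi>"
      using exists_not_in_row_space [OF step.prems(1) step.hyps(2)] by blast
    obtain z where z: "z \<in> space2 r" "z \<notin> row_space k \<psi>"
      using exists_not_in_row_space [OF step.prems(2) step.hyps(2)] by blast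
    obtain A where A: "additive_on (space2 r) A" "bij_betw A (space2 r) (space2 r)"
      "\<forall>i<Suc k. A ((\<phi>(k := y)) i) = (\<psi>(k := z)) i"
      using step.IH [OF full_rank_stack [OF step.prems(1) y] full_rank_stack [OF step.prems(2) z]]
      by blast
    have "A (\<phi> i) = \<psi> i" if "i < k" for i
      using A(3) [rule_format, of i] that by simp
    with A(1,2) show ?case by (intro exI [of _ A] conjI allI impI)
  qed
qed

section \<open>The graph of full rank matrices\<close>

text \<open>The two labellings agree where \<open>f\<close> vanishes. That \<open>f\<close> is
  independent of the rows means that this hyperplane meets every label class.\<close>

definition madj :: "nat \<Rightarrow> nat \<Rightarrow> (nat \<Rightarrow> vec2) \<Rightarrow> (nat \<Rightarrow> vec2) \<Rightarrow> bool" where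
  "madj n r \<phi> \<psi> \<longleftrightarrow> (\<exists>c f. c \<in> space2 n \<and> c \<noteq> 0 \<and> f \<in> space2 r \<and> f \<notin> row_space n \<phi> \<and> \<psi> = \<phi> + outer c f)"

definition mat_graph :: "nat \<Rightarrow> nat \<Rightarrow> (nat \<Rightarrow> vec2) graph" where
  "mat_graph n r = \<lparr>verts = full_rank n r, edges = {{\<phi>, \<psi>} | \<phi> \<psi>. \<phi> \<in> full_rank n r \<and> madj n r \<phi> \<psi>}\<rparr>"

text \<open>
  The decompositions \<open>J\<^sub>0\<close> and \<open>J\<^sub>1\<close> correspond to \<open>mat_lines\<close> and \<open>mat_tees\<close>. A member of \<open>tee n r \<phi> c\<close>
  is a lift of the composition of \<open>\<phi>\<close> with the projection along \<open>c\<close>.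
\<close>

definition line :: "nat \<Rightarrow> (nat \<Rightarrow> vec2) \<Rightarrow> vec2 \<Rightarrow> (nat \<Rightarrow> vec2) set" where
  "line n \<phi> f = (\<lambda>c. \<phi> + outer c f) ` space2 n"

definition tee :: "nat \<Rightarrow> nat \<Rightarrow> (nat \<Rightarrow> vec2) \<Rightarrow> vec2 \<Rightarrow> (nat \<Rightarrow> vec2) set" where
  "tee n r \<phi> c = (\<lambda>g. \<phi> + outer c g) ` space2 r \<inter> full_rank n r"

definition mat_lines :: "nat \<Rightarrow> nat \<Rightarrow> (nat \<Rightarrow> vec2) set set" where
  "mat_lines n r = {line n \<phi> f | \<phi> f. \<phi> \<in> full_rank n r \<and> f \<in> space2 r \<and> f \<notin> row_space n \<phi>}"

definition mat_tees :: "nat \<Rightarrow> nat \<Rightarrow> (nat \<Rightarrow> vec2) set set" where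
  "mat_tees n r = {tee n r \<phi> c | \<phi> c. \<phi> \<in> full_rank n r \<and> c \<in> space2 n \<and> c \<noteq> 0}"

lemma outer_add_left: "outer (c + d) f = outer c f + outer d f"
  by (simp add: fun_eq_iff distrib_right)

lemma outer_add_right: "outer c (f + g) = outer c f + outer c g"
  by (simp add: fun_eq_iff distrib_left)

lemma outer_0 [simp]: "outer 0 f = 0" "outer c 0 = 0"
  by (simp_all add: fun_eq_iff)

lemma nonzeroE:
  assumes "(c::vec2) \<noteq> 0" obtains i where "c i = 1"
  using assms by (auto simp: fun_eq_iff)

lemma scale2_eq_self: "x = scale2 b y \<Longrightarrow> x \<noteq> 0 \<Longrightarrow> b = 1 \<and> x = y"
  by (cases b) auto

lemma scale2_inj: "scale2 a x = scale2 b x \<Longrightarrow> x \<noteq> 0 \<Longrightarrow> a = b"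
  by (cases a; cases b) auto

text \<open>Over two elements there is no scalar to move between the factors of a matrix of rank
  one.\<close>

lemma outer_eq_outer:
  assumes "outer c f = outer d g" "c \<noteq> 0" "f \<noteq> 0"
  shows "c = d" "f = g"
proof -
  obtain i where "c i = 1" using assms(2) by (rule nonzeroE)
  then have "f = scale2 (d i) g" using fun_cong [OF assms(1), of i] by simp
  from scale2_eq_self [OF this assms(3)] show fg: "f = g" by simp
  show "c = d"
  proof
    fix j
    show "c j = d j"
      using fun_cong [OF assms(1), of j] scale2_inj [OF _ assms(3)] unfolding fg by simp
  qed
qed

text \<open>Row \<open>i\<close> of the sum is \<open>f\<close>, so the common row direction
  \<open>h\<close> is \<open>f\<close>. A row in which \<open>d\<close> is \<open>1\<close> then
  makes \<open>g\<close> a multiple of \<open>f\<close>.\<close>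

lemma rank_one_sum_aux:
  assumes "outer c f + outer d g = outer e h" "c i = 1" "d i = 0" "f \<noteq> 0" "g \<noteq> 0" "d \<noteq> 0"
  shows "f = g"
proof -
  have row: "scale2 (c j) f + scale2 (d j) g = scale2 (e j) h" for j
    using fun_cong [OF assms(1), of j] by simp
  have "f = scale2 (e i) h" using row [of i] assms(2,3) by simp
  from scale2_eq_self [OF this assms(4)] have h: "h = f" by simp
  obtain j where j: "d j = 1" using assms(6) by (rule nonzeroE)
  have "g + scale2 (c j) f = scale2 (e j) f"
    using row [of j] by (simp add: j h add.commute)
  then have "g = scale2 (c j) f + scale2 (e j) f" by (rule iffD1 [OF add_eq_char2])
  also have "\<dots> = scale2 (c j + e j) f" by (simp add: fun_eq_iff distrib_right)
  finally have "g = scale2 (c j + e j) f" .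
  from scale2_eq_self [OF this assms(5)] show ?thesis by simp
qed

lemma rank_one_sum:
  assumes "outer c f + outer d g = outer e h" "f \<noteq> 0" "g \<noteq> 0" "c \<noteq> 0" "d \<noteq> 0"
  shows "c = d \<or> f = g"
proof (cases "c = d")
  case False
  then obtain i where "c i \<noteq> d i" by (auto simp: fun_eq_iff)
  then consider "c i = 1" "d i = 0" | "d i = 1" "c i = 0"
    by (cases "c i"; cases "d i") auto
  then show ?thesis
  proof cases
    case 1
    then show ?thesis using rank_one_sum_aux assms by blast
  next
    case 2
    have "outer d g + outer c f = outer e h" using assms(1) by (simp add: add.commute)
    from rank_one_sum_aux [OF this 2] assms show ?thesis by blast
  qed
qed simp

lemma finite_full_rank [simp]: "finite (full_rank n r)"
proof (rule finite_subset)
  show "full_rank n r \<subseteq> {\<phi>. \<forall>i. (i \<in> {..<n} \<longrightarrow> \<phi> i \<in> space2 r) \<and> (i \<notin> {..<n} \<longrightarrow> \<phi> i = 0)}"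
    by (auto simp: full_rank_def)
  show "finite \<dots>"
    by (rule finite_set_of_finite_funs) auto
qed

text \<open>Adding \<open>outer c g\<close> changes the combination with coefficients
  \<open>a\<close> by \<open>dot n a c\<close> times \<open>g\<close>. Rank is therefore lost only
  if some \<open>a\<close> with \<open>dot n a c = 1\<close> already produced
  \<open>g\<close>.\<close>

lemma full_rank_add_outer_iff:
  assumes "\<phi> \<in> full_rank n r" "c \<in> space2 n" "g \<in> space2 r"
  shows "\<phi> + outer c g \<in> full_rank n r \<longleftrightarrow> (\<forall>a\<in>space2 n. dot n a c = 1 \<longrightarrow> g \<noteq> comb n a \<phi>)"
proof
  assume L: "\<phi> + outer c g \<in> full_rank n r"
  show "\<forall>a\<in>space2 n. dot n a c = 1 \<longrightarrow> g \<noteq> comb n a \<phi>"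
  proof (intro ballI impI notI)
    fix a assume a: "a \<in> space2 n" "dot n a c = 1" "g = comb n a \<phi>"
    then have "comb n a (\<phi> + outer c g) = 0" by simp
    then have "a = 0" using L a(1) full_rankD(3) by blast
    then show False using a by simp
  qed
next
  assume R: "\<forall>a\<in>space2 n. dot n a c = 1 \<longrightarrow> g \<noteq> comb n a \<phi>"
  show "\<phi> + outer c g \<in> full_rank n r"
  proof (rule full_rankI)
    show "(\<phi> + outer c g) i \<in> space2 r" for i
      using full_rankD(1) [OF assms(1)] assms(3) by simp
    show "(\<phi> + outer c g) i = 0" if "i \<ge> n" for i
      using full_rankD(2) [OF assms(1) that] assms(2) that by (simp add: space2_def)
    fix a assume a: "a \<in> space2 n" "comb n a (\<phi> + outer c g) = 0"
    then have eq: "comb n a \<phi> = scale2 (dot n a c) g" by simp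
    show "a = 0"
    proof (cases "dot n a c")
      case zero
      then show ?thesis using eq a(1) full_rankD(3) [OF assms(1)] by simp
    next
      case one
      then have "g = comb n a \<phi>" using eq by simp
      with one R a(1) show ?thesis by blast
    qed
  qed
qed

text \<open>This makes \<open>madj\<close> symmetric: the same \<open>f\<close> serves in both
  directions, and at every point of a line.\<close>

lemma not_row_space_add_outer:
  assumes "\<phi> \<in> full_rank n r" "f \<notin> row_space n \<phi>"
  shows "f \<notin> row_space n (\<phi> + outer c f)"
proof
  assume "f \<in> row_space n (\<phi> + outer c f)"
  then obtain a where a: "a \<in> space2 n" "f = comb n a \<phi> + scale2 (dot n a c) f"
    by (auto simp: row_space_def)
  show False
  proof (cases "dot n a c")
    case zero
    then have "f = comb n a \<phi>" using a(2) by (metis add.right_neutral scale2_0(1))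
    then show ?thesis using a(1) assms(2) by (auto simp: row_space_def)
  next
    case one
    then have "comb n a \<phi> = 0" using a(2) by (metis add.commute add_self add_self_left scale2_1)
    then have "a = 0" using a(1) assms(1) full_rankD(3) by blast
    with one show ?thesis by simp
  qed
qed

lemma not_row_spaceD: "f \<notin> row_space n \<phi> \<Longrightarrow> f \<noteq> 0"
  by auto

lemma full_rank_add_outer:
  assumes "\<phi> \<in> full_rank n r" "c \<in> space2 n" "f \<in> space2 r" "f \<notin> row_space n \<phi>"
  shows "\<phi> + outer c f \<in> full_rank n r"
  using assms(4) by (simp add: full_rank_add_outer_iff [OF assms(1-3)]) (auto simp: row_space_def)

lemma madjE:
  assumes "madj n r \<phi> \<psi>"
  obtains c f where "c \<in> space2 n" "c \<noteq> 0" "f \<in> space2 r" "f \<notin> row_space n \<phi>" "f \<noteq> 0" "\<psi> = \<phi> + outer c f"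
  using assms not_row_spaceD unfolding madj_def by blast

lemma madj_full_rank: "madj n r \<phi> \<psi> \<Longrightarrow> \<phi> \<in> full_rank n r \<Longrightarrow> \<psi> \<in> full_rank n r"
  by (auto elim!: madjE intro: full_rank_add_outer)

lemma madj_sym:
  assumes "madj n r \<phi> \<psi>" "\<phi> \<in> full_rank n r"
  shows "madj n r \<psi> \<phi>"
  using assms(1)
proof (rule madjE)
  fix c f assume *: "c \<in> space2 n" "c \<noteq> 0" "f \<in> space2 r" "f \<notin> row_space n \<phi>" "\<psi> = \<phi> + outer c f"
  have "\<phi> = \<psi> + outer c f" using *(5) by (simp add: add.assoc)
  with * not_row_space_add_outer [OF assms(2), of f c] show ?thesis unfolding madj_def by blast
qed

lemma madj_neq: "madj n r \<phi> \<psi> \<Longrightarrow> \<phi> \<noteq> \<psi>"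
proof (erule madjE)
  fix c f assume *: "c \<noteq> 0" "f \<noteq> (0::vec2)" "\<psi> = \<phi> + outer c f"
  show "\<phi> \<noteq> \<psi>"
  proof
    assume "\<phi> = \<psi>"
    then have "outer c f = outer 0 f" using *(3) by (metis add_self add_self_left outer_0(1))
    then show False using outer_eq_outer(1) * by blast
  qed
qed

lemma verts_mat_graph [simp]: "verts (mat_graph n r) = full_rank n r"
  by (simp add: mat_graph_def)

lemma edge_mat_graph_iff:
  assumes "\<phi> \<in> full_rank n r" "\<psi> \<in> full_rank n r"
  shows "{\<phi>, \<psi>} \<in> edges (mat_graph n r) \<longleftrightarrow> madj n r \<phi> \<psi>"
  using assms madj_sym by (auto simp: mat_graph_def doubleton_eq_iff)

lemma edge_mat_graphE:
  assumes "e \<in> edges (mat_graph n r)"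
  obtains \<phi> \<psi> where "e = {\<phi>, \<psi>}" "\<phi> \<in> full_rank n r" "\<psi> \<in> full_rank n r" "madj n r \<phi> \<psi>"
  using assms madj_full_rank by (auto simp: mat_graph_def)

lemma finite_simple_mat_graph: "finite_simple_graph (mat_graph n r)"
  unfolding finite_simple_graph_def by (auto elim!: edge_mat_graphE dest: madj_neq)

text \<open>The difference of the two neighbours of \<open>\<phi>\<close> is again of rank one, so
  \<open>rank_one_sum\<close> applies to their factors.\<close>

lemma madj_imp_rank_one:
  assumes "madj n r (\<phi> + outer c f) (\<phi> + outer d g)" "c \<noteq> 0" "d \<noteq> 0" "f \<noteq> 0" "g \<noteq> 0"
  shows "c = d \<or> f = g"
  using assms(1)
proof (rule madjE)
  fix e h assume "\<phi> + outer d g = \<phi> + outer c f + outer e h"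
  then have "outer c f + outer d g = outer e h"
    by (metis add.assoc add_left_imp_eq add_self_left)
  then show ?thesis using rank_one_sum assms by blast
qed

lemma card_degree:
  assumes "\<phi> \<in> full_rank n r"
  shows "card {\<psi>. madj n r \<phi> \<psi>} = (2 ^ n - 1) * (2 ^ r - 2 ^ n)"
proof -
  let ?S = "(space2 n - {0}) \<times> (space2 r - row_space n \<phi>)"
  have "{\<psi>. madj n r \<phi> \<psi>} = (\<lambda>(c, f). \<phi> + outer c f) ` ?S"
    by (auto simp: madj_def image_iff)
  moreover have "inj_on (\<lambda>(c, f). \<phi> + outer c f) ?S"
  proof (rule inj_onI)
    fix x y assume *: "x \<in> ?S" "y \<in> ?S" "(case x of (c, f) \<Rightarrow> \<phi> + outer c f) = (case y of (c, f) \<Rightarrow> \<phi> + outer c f)"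
    obtain c f d g where xy: "x = (c, f)" "y = (d, g)" by (cases x, cases y)
    then have "outer c f = outer d g" "c \<noteq> 0" "f \<noteq> 0" using * not_row_spaceD by auto
    from outer_eq_outer [OF this] show "x = y" unfolding xy by simp
  qed
  moreover have "card ?S = (2 ^ n - 1) * (2 ^ r - 2 ^ n)"
    using card_row_space [OF assms] row_space_subset [OF assms]
    by (simp add: card_cartesian_product card_Diff_subset finite_subset)
  ultimately show ?thesis by (simp add: card_image)
qed

section \<open>Lines and tees through a vertex\<close>

lemma space2_translate:
  assumes "x \<in> space2 n" shows "(\<lambda>y. x + y) ` space2 n = space2 n"
proof (intro equalityI subsetI)
  fix y assume "y \<in> space2 n"
  then show "y \<in> (\<lambda>y. x + y) ` space2 n"
    by (intro image_eqI [of _ _ "x + y"]) (simp_all add: assms)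
qed (use assms in auto)

lemma line_self: "\<phi> \<in> line n \<phi> f"
  unfolding line_def by (rule image_eqI [of _ _ 0]) simp_all

lemma line_subset:
  assumes "\<phi> \<in> full_rank n r" "f \<in> space2 r" "f \<notin> row_space n \<phi>"
  shows "line n \<phi> f \<subseteq> full_rank n r"
  using full_rank_add_outer [OF assms(1) _ assms(2,3)] by (auto simp: line_def)

lemma line_not_row_space:
  assumes "\<phi> \<in> full_rank n r" "f \<notin> row_space n \<phi>" "\<psi> \<in> line n \<phi> f"
  shows "f \<notin> row_space n \<psi>"
  using assms not_row_space_add_outer unfolding line_def by blast

text \<open>Lines are cosets, so any of their points can be taken as the base point;
  \<open>tee_eq\<close> does the same for tees.\<close>

lemma line_eq:
  assumes "\<psi> \<in> line n \<phi> f" shows "line n \<psi> f = line n \<phi> f"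
proof -
  obtain c where c: "c \<in> space2 n" "\<psi> = \<phi> + outer c f" using assms by (auto simp: line_def)
  have *: "\<psi> + outer d f = \<phi> + outer (c + d) f" for d
    by (simp add: c(2) outer_add_left add.assoc)
  have "line n \<psi> f = (\<lambda>c. \<phi> + outer c f) ` (\<lambda>d. c + d) ` space2 n"
    unfolding line_def * image_image ..
  then show ?thesis unfolding space2_translate [OF c(1)] line_def .
qed

lemma card_line: "f \<noteq> 0 \<Longrightarrow> card (line n \<phi> f) = 2 ^ n"
proof -
  assume f: "f \<noteq> 0"
  have "inj_on (\<lambda>c. \<phi> + outer c f) (space2 n)"
  proof (rule inj_onI)
    fix c d assume "\<phi> + outer c f = \<phi> + outer d f"
    then have "outer c f = outer d f" by simp
    then show "c = d"
      by (cases "c = 0"; cases "d = 0") (use outer_eq_outer(1) f in \<open>metis outer_0(1)\<close>)+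
  qed
  then show ?thesis by (simp add: line_def card_image)
qed

lemma madj_line:
  assumes "\<phi> \<in> full_rank n r" "f \<in> space2 r" "f \<notin> row_space n \<phi>"
    and "\<psi> \<in> line n \<phi> f" "\<chi> \<in> line n \<phi> f" "\<psi> \<noteq> \<chi>"
  shows "madj n r \<psi> \<chi>"
proof -
  have "\<chi> \<in> line n \<psi> f" using line_eq assms(4,5) by simp
  then obtain c where "c \<in> space2 n" "\<chi> = \<psi> + outer c f" by (auto simp: line_def)
  moreover from this have "c \<noteq> 0" using assms(6) by auto
  ultimately show ?thesis
    using assms(2) line_not_row_space [OF assms(1,3,4)] unfolding madj_def by blast
qed

lemma mat_linesE:
  assumes "L \<in> mat_lines n r" "\<psi> \<in> L"
  obtains f where "f \<in> space2 r" "f \<notin> row_space n \<psi>" "\<psi> \<in> full_rank n r" "L = line n \<psi> f"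
  using assms line_eq line_not_row_space line_subset unfolding mat_lines_def by blast

text \<open>The direction of a line is recovered from the difference of any two of its
  points.\<close>

lemma mat_lines_unique:
  assumes "L \<in> mat_lines n r" "\<phi> \<in> L" "\<phi> + outer c f \<in> L" "c \<noteq> 0" "f \<noteq> 0"
  shows "L = line n \<phi> f"
  using assms(1,2)
proof (rule mat_linesE)
  fix g assume g: "L = line n \<phi> g"
  then obtain d where "\<phi> + outer c f = \<phi> + outer d g" using assms(3) by (auto simp: line_def)
  then have "f = g" using outer_eq_outer(2) [of c f d g] assms(4,5) by simp
  with g show ?thesis by simp
qed

lemma tee_self: "\<phi> \<in> full_rank n r \<Longrightarrow> \<phi> \<in> tee n r \<phi> c"
  unfolding tee_def by (rule IntI [OF image_eqI [of _ _ 0]]) simp_all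

lemma tee_subset: "tee n r \<phi> c \<subseteq> full_rank n r"
  by (simp add: tee_def)

lemma tee_eq:
  assumes "\<psi> \<in> tee n r \<phi> c" shows "tee n r \<psi> c = tee n r \<phi> c"
proof -
  obtain g where g: "g \<in> space2 r" "\<psi> = \<phi> + outer c g" using assms by (auto simp: tee_def)
  have *: "\<psi> + outer c h = \<phi> + outer c (g + h)" for h
    by (simp add: g(2) outer_add_right add.assoc)
  have "(\<lambda>h. \<psi> + outer c h) ` space2 r = (\<lambda>h. \<phi> + outer c h) ` (\<lambda>h. g + h) ` space2 r"
    unfolding * image_image ..
  then show ?thesis unfolding tee_def space2_translate [OF g(1)] by simp
qed

lemma mat_teesE:
  assumes "X \<in> mat_tees n r" "\<psi> \<in> X"
  obtains c where "c \<in> space2 n" "c \<noteq> 0" "\<psi> \<in> full_rank n r" "X = tee n r \<psi> c"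
  using assms tee_eq tee_subset unfolding mat_tees_def by blast

lemma mat_tees_unique:
  assumes "X \<in> mat_tees n r" "\<phi> \<in> X" "\<phi> + outer c f \<in> X" "c \<noteq> 0" "f \<noteq> 0"
  shows "X = tee n r \<phi> c"
  using assms(1,2)
proof (rule mat_teesE)
  fix d assume d: "X = tee n r \<phi> d"
  then obtain g where "\<phi> + outer c f = \<phi> + outer d g" using assms(3) by (auto simp: tee_def)
  then have "c = d" using outer_eq_outer(1) [of c f d g] assms(4,5) by simp
  with d show ?thesis by simp
qed

lemma line_Int_tee:
  assumes "\<phi> \<in> full_rank n r" "c \<in> space2 n" "c \<noteq> 0" "f \<in> space2 r" "f \<notin> row_space n \<phi>"
  shows "line n \<phi> f \<inter> tee n r \<phi> c = {\<phi>, \<phi> + outer c f}"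
proof
  show "line n \<phi> f \<inter> tee n r \<phi> c \<subseteq> {\<phi>, \<phi> + outer c f}"
  proof clarify
    fix \<chi> assume "\<chi> \<in> line n \<phi> f" "\<chi> \<in> tee n r \<phi> c" "\<chi> \<noteq> \<phi>"
    obtain d where 1: "\<chi> = \<phi> + outer d f" using \<open>\<chi> \<in> line n \<phi> f\<close> by (auto simp: line_def)
    obtain g where 2: "\<chi> = \<phi> + outer c g" using \<open>\<chi> \<in> tee n r \<phi> c\<close> by (auto simp: tee_def)
    note * = 1 2
    then have d: "d \<noteq> 0" using \<open>\<chi> \<noteq> \<phi>\<close> by auto
    have "outer d f = outer c g" using * by simp
    from outer_eq_outer(1) [OF this d not_row_spaceD [OF assms(5)]] * show "\<chi> = \<phi> + outer c f" by simp
  qed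
  show "{\<phi>, \<phi> + outer c f} \<subseteq> line n \<phi> f \<inter> tee n r \<phi> c"
    using line_self tee_self [OF assms(1)] full_rank_add_outer assms
    by (auto simp: line_def tee_def)
qed

lemma card_mat_lines_through:
  assumes "\<phi> \<in> full_rank n r" "0 < n"
  shows "card {L \<in> mat_lines n r. \<phi> \<in> L} = 2 ^ r - 2 ^ n"
proof -
  let ?S = "space2 r - row_space n \<phi>"
  have "{L \<in> mat_lines n r. \<phi> \<in> L} = line n \<phi> ` ?S"
  proof (intro equalityI subsetI)
    fix L assume "L \<in> {L \<in> mat_lines n r. \<phi> \<in> L}"
    then have "L \<in> mat_lines n r" "\<phi> \<in> L" by auto
    then show "L \<in> line n \<phi> ` ?S" by (rule mat_linesE) auto
  next
    fix L assume "L \<in> line n \<phi> ` ?S"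
    then show "L \<in> {L \<in> mat_lines n r. \<phi> \<in> L}"
      using assms line_self by (auto simp: mat_lines_def)
  qed
  moreover have "inj_on (line n \<phi>) ?S"
  proof (rule inj_onI)
    fix f g assume *: "f \<in> ?S" "g \<in> ?S" "line n \<phi> f = line n \<phi> g"
    \<comment> \<open>A nonzero column vector is needed to reach a second point of the line;
      \<open>0 < n\<close> provides \<open>unit2 0\<close>.\<close>
    then have "\<phi> + outer (unit2 0) f \<in> line n \<phi> g"
      using assms(2) by (metis imageI line_def unit2_space2)
    then obtain d where "\<phi> + outer (unit2 0) f = \<phi> + outer d g" by (auto simp: line_def)
    then show "f = g" using outer_eq_outer(2) [of "unit2 0" f d g] * not_row_spaceD [of f n \<phi>] by simp
  qed
  moreover have "card ?S = 2 ^ r - 2 ^ n"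
    using card_row_space [OF assms(1)] row_space_subset [OF assms(1)]
    by (simp add: card_Diff_subset finite_subset)
  ultimately show ?thesis by (simp add: card_image)
qed

lemma card_mat_tees_through:
  assumes "\<phi> \<in> full_rank n r" "n < r"
  shows "card {X \<in> mat_tees n r. \<phi> \<in> X} = 2 ^ n - 1"
proof -
  let ?S = "space2 n - {0}"
  \<comment> \<open>A direction outside the row space gives every tee through \<open>\<phi>\<close>
    a second point, from which \<open>c\<close> can be recovered.\<close>
  obtain f where f: "f \<in> space2 r" "f \<notin> row_space n \<phi>"
    using exists_not_in_row_space [OF assms] by blast
  have "{X \<in> mat_tees n r. \<phi> \<in> X} = tee n r \<phi> ` ?S"
  proof (intro equalityI subsetI)
    fix X assume "X \<in> {X \<in> mat_tees n r. \<phi> \<in> X}"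
    then have "X \<in> mat_tees n r" "\<phi> \<in> X" by auto
    then show "X \<in> tee n r \<phi> ` ?S" by (rule mat_teesE) auto
  next
    fix X assume "X \<in> tee n r \<phi> ` ?S"
    then show "X \<in> {X \<in> mat_tees n r. \<phi> \<in> X}"
      using assms(1) tee_self by (auto simp: mat_tees_def)
  qed
  moreover have "inj_on (tee n r \<phi>) ?S"
  proof (rule inj_onI)
    fix c d assume *: "c \<in> ?S" "d \<in> ?S" "tee n r \<phi> c = tee n r \<phi> d"
    have "\<phi> + outer c f \<in> tee n r \<phi> d"
      using * line_Int_tee [OF assms(1) _ _ f, of c] by auto
    then obtain g where "\<phi> + outer c f = \<phi> + outer d g" by (auto simp: tee_def)
    then show "c = d" using outer_eq_outer(1) [of c f d g] * not_row_spaceD [OF f(2)] by simp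
  qed
  ultimately show ?thesis by (simp add: card_image)
qed

text \<open>Non-adjacency means that \<open>g + h\<close> is a combination of the rows of the first
  lift. If its coefficients had \<open>dot n a c = 1\<close>, then \<open>h\<close> would be
  \<open>comb n a \<phi>\<close> and the second lift would lose rank. Only coefficients with
  \<open>dot n a c = 0\<close> remain.\<close>

lemma madj_tee_iff:
  assumes \<phi>: "\<phi> \<in> full_rank n r" and c: "c \<in> space2 n" "c \<noteq> 0"
    and g: "g \<in> space2 r" "\<phi> + outer c g \<in> full_rank n r"
    and h: "h \<in> space2 r" "\<phi> + outer c h \<in> full_rank n r"
  shows "madj n r (\<phi> + outer c g) (\<phi> + outer c h) \<longleftrightarrow>
           g + h \<notin> (\<lambda>a. comb n a \<phi>) ` {a \<in> space2 n. dot n a c = 0}" (is "?A \<longleftrightarrow> ?B")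
proof -
  have gh: "\<phi> + outer c h = \<phi> + outer c g + outer c (g + h)"
    by (simp add: outer_add_right add.assoc)
  have "?A \<longleftrightarrow> g + h \<notin> row_space n (\<phi> + outer c g)"
  proof
    assume ?A
    then obtain d k where *: "d \<noteq> 0" "k \<notin> row_space n (\<phi> + outer c g)" "k \<noteq> 0"
      "\<phi> + outer c h = \<phi> + outer c g + outer d k" by (rule madjE)
    then have "outer d k = outer c (g + h)" using gh by simp
    then have "k = g + h" using outer_eq_outer(2) * by blast
    with *(2) show "g + h \<notin> row_space n (\<phi> + outer c g)" by simp
  next
    assume "g + h \<notin> row_space n (\<phi> + outer c g)"
    then show ?A unfolding madj_def using gh c g(1) h(1) space2_add by blast
  qed
  also have "\<dots> \<longleftrightarrow> ?B"
  proof -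
    have "g + h \<in> row_space n (\<phi> + outer c g) \<longleftrightarrow>
      (\<exists>a\<in>space2 n. g + h = comb n a \<phi> + scale2 (dot n a c) g)"
      by (auto simp: row_space_def)
    also have "\<dots> \<longleftrightarrow> (\<exists>a\<in>space2 n. g + h = comb n a \<phi> \<and> dot n a c = 0)"
    proof (rule bex_cong [OF refl])
      fix a assume a: "a \<in> space2 n"
      show "g + h = comb n a \<phi> + scale2 (dot n a c) g \<longleftrightarrow> g + h = comb n a \<phi> \<and> dot n a c = 0"
      proof (cases "dot n a c")
        case one
        then have "h \<noteq> comb n a \<phi>" using h full_rank_add_outer_iff [OF \<phi> c(1) h(1)] a by blast
        then show ?thesis using one by (metis add.commute add_left_imp_eq scale2_1 zero_neq_one)
      qed simp
    qed
    finally show ?thesis by blast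
  qed
  finally show ?thesis .
qed

text \<open>Translation by the common subspace stays among the full rank lifts: if
  \<open>g + u\<close> were forbidden by \<open>a\<close>, then \<open>g\<close> would be forbidden
  by \<open>a + b\<close>.\<close>

lemma tee_part:
  assumes \<phi>: "\<phi> \<in> full_rank n r" and c: "c \<in> space2 n"
    and g: "g \<in> space2 r" "\<phi> + outer c g \<in> full_rank n r"
    and u: "u \<in> (\<lambda>a. comb n a \<phi>) ` {a \<in> space2 n. dot n a c = 0}"
  shows "g + u \<in> space2 r" "\<phi> + outer c (g + u) \<in> full_rank n r"
proof -
  obtain b where b: "b \<in> space2 n" "dot n b c = 0" "u = comb n b \<phi>" using u by auto
  show gu: "g + u \<in> space2 r" using g(1) b(3) \<phi> by simp
  have "g + u \<noteq> comb n a \<phi>" if "a \<in> space2 n" "dot n a c = 1" for a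
  proof
    assume "g + u = comb n a \<phi>"
    then have "g = comb n (a + b) \<phi>" using b(3) by (metis add.commute add_eq_char2 comb_add_left)
    moreover have "a + b \<in> space2 n" "dot n (a + b) c = 1" using that b by simp_all
    ultimately show False using full_rank_add_outer_iff [OF \<phi> c g(1)] g(2) by blast
  qed
  then show "\<phi> + outer c (g + u) \<in> full_rank n r"
    using full_rank_add_outer_iff [OF \<phi> c gu] by blast
qed

lemma inj_outer_right: "c \<noteq> 0 \<Longrightarrow> inj (\<lambda>g. \<phi> + outer c g)"
proof (rule injI)
  fix g h assume c: "c \<noteq> 0" and "\<phi> + outer c g = \<phi> + outer c h"
  then have *: "outer c g = outer c h" by simp
  obtain i where "c i = 1" using c by (rule nonzeroE)
  then show "g = h" using fun_cong [OF *, of i] by simp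
qed

text \<open>The forbidden \<open>g\<close> are the combinations with \<open>dot n a c = 1\<close>,
  which is half of the row space.\<close>

lemma card_tee:
  assumes \<phi>: "\<phi> \<in> full_rank n r" and c: "c \<in> space2 n" "c \<noteq> 0"
  shows "card (tee n r \<phi> c) = 2 ^ r - 2 ^ (n - 1)"
proof -
  let ?U = "(\<lambda>a. comb n a \<phi>) ` {a \<in> space2 n. dot n a c = 1}"
  have "tee n r \<phi> c = (\<lambda>g. \<phi> + outer c g) ` (space2 r - ?U)"
    unfolding tee_def using full_rank_add_outer_iff [OF \<phi> c(1)] by (auto simp: image_iff)
  moreover have "inj_on (\<lambda>g. \<phi> + outer c g) (space2 r - ?U)"
    using inj_outer_right [OF c(2)] by (rule inj_on_subset) simp
  moreover have "card ?U = 2 ^ (n - 1)"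
    using inj_on_comb [OF \<phi>] card_dot_eq [OF c] by (subst card_image) (auto intro: inj_on_subset)
  moreover have "?U \<subseteq> space2 r" using \<phi> by auto
  ultimately show ?thesis by (simp add: card_image card_Diff_subset)
qed

lemma tee_parts:
  assumes \<phi>: "\<phi> \<in> full_rank n r" and c: "c \<in> space2 n" "c \<noteq> 0"
  obtains p :: "(nat \<Rightarrow> vec2) \<Rightarrow> vec2 set" where
    "\<And>\<psi> \<chi>. \<psi> \<in> tee n r \<phi> c \<Longrightarrow> \<chi> \<in> tee n r \<phi> c \<Longrightarrow> madj n r \<psi> \<chi> \<longleftrightarrow> p \<psi> \<noteq> p \<chi>"
    "\<And>\<psi>. \<psi> \<in> tee n r \<phi> c \<Longrightarrow> card {\<chi> \<in> tee n r \<phi> c. p \<chi> = p \<psi>} = 2 ^ (n - 1)"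
proof -
  let ?D = "{a \<in> space2 n. dot n a c = 0}"
  define U where "U = (\<lambda>a. comb n a \<phi>) ` ?D"
  obtain i where i: "c i = 1" using c(2) by (rule nonzeroE)
  \<comment> \<open>Since \<open>c i = 1\<close>, row \<open>i\<close> recovers \<open>g\<close>
    from \<open>\<phi> + outer c g\<close>. The label is the coset of \<open>g\<close> modulo
    \<open>U\<close>.\<close>
  define p where "p = (\<lambda>\<psi>::nat \<Rightarrow> vec2. {h. \<psi> i + \<phi> i + h \<in> U})"
  have Uadd: "u + v \<in> U" if "u \<in> U" "v \<in> U" for u v
    using that unfolding U_def by (auto simp flip: comb_add_left)
  have U0: "0 \<in> U" unfolding U_def by (rule image_eqI [of _ _ 0]) auto
  have p: "p (\<phi> + outer c g) = {h. g + h \<in> U}" for g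
    using i by (simp add: p_def add.commute add.left_commute)
  have p_eq: "p (\<phi> + outer c g) = p (\<phi> + outer c h) \<longleftrightarrow> g + h \<in> U" for g h
  proof
    assume "p (\<phi> + outer c g) = p (\<phi> + outer c h)"
    then have "h \<in> {k. g + k \<in> U}" using U0 unfolding p by simp
    then show "g + h \<in> U" by simp
  next
    assume gh: "g + h \<in> U"
    have "g + k \<in> U \<longleftrightarrow> h + k \<in> U" for k
    proof
      assume "g + k \<in> U"
      from Uadd [OF gh this] show "h + k \<in> U" by (simp add: add.commute add.left_commute)
    next
      assume "h + k \<in> U"
      from Uadd [OF gh this] show "g + k \<in> U" by (simp add: add.assoc)
    qed
    then show "p (\<phi> + outer c g) = p (\<phi> + outer c h)" unfolding p by simp
  qed
  show ?thesis
  proof (rule that [of p])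
    fix \<psi> \<chi> assume "\<psi> \<in> tee n r \<phi> c" "\<chi> \<in> tee n r \<phi> c"
    then obtain g h where "g \<in> space2 r" "\<psi> = \<phi> + outer c g" "\<psi> \<in> full_rank n r"
      "h \<in> space2 r" "\<chi> = \<phi> + outer c h" "\<chi> \<in> full_rank n r" by (auto simp: tee_def)
    then show "madj n r \<psi> \<chi> \<longleftrightarrow> p \<psi> \<noteq> p \<chi>"
      using madj_tee_iff [OF \<phi> c, of g h] p_eq [of g h] unfolding U_def by blast
  next
    fix \<psi> assume "\<psi> \<in> tee n r \<phi> c"
    then obtain g where g: "g \<in> space2 r" "\<psi> = \<phi> + outer c g" "\<psi> \<in> full_rank n r"
      by (auto simp: tee_def)
    have "{\<chi> \<in> tee n r \<phi> c. p \<chi> = p \<psi>} = (\<lambda>u. \<phi> + outer c (g + u)) ` U"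
    proof (intro equalityI subsetI)
      fix \<chi> assume "\<chi> \<in> {\<chi> \<in> tee n r \<phi> c. p \<chi> = p \<psi>}"
      then obtain h where h: "\<chi> = \<phi> + outer c h" "p \<chi> = p \<psi>" by (auto simp: tee_def)
      then have "g + h \<in> U" using p_eq g(2) by metis
      then show "\<chi> \<in> (\<lambda>u. \<phi> + outer c (g + u)) ` U"
        by (rule rev_image_eqI) (simp add: h(1))
    next
      fix \<chi> assume "\<chi> \<in> (\<lambda>u. \<phi> + outer c (g + u)) ` U"
      then obtain u where u: "u \<in> U" "\<chi> = \<phi> + outer c (g + u)" by auto
      then have "\<chi> \<in> tee n r \<phi> c"
        using tee_part [OF \<phi> c(1) g(1), of u] g(2,3) unfolding tee_def U_def by blast
      moreover have "p \<chi> = p \<psi>" unfolding u(2) g(2) p_eq using u(1) by (simp add: add.commute)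
      ultimately show "\<chi> \<in> {\<chi> \<in> tee n r \<phi> c. p \<chi> = p \<psi>}" by simp
    qed
    moreover have "inj_on (\<lambda>u. \<phi> + outer c (g + u)) U"
    proof (rule inj_onI)
      fix u v assume "\<phi> + outer c (g + u) = \<phi> + outer c (g + v)"
      then show "u = v" using injD [OF inj_outer_right [OF c(2), of \<phi>], of "g + u" "g + v"] by simp
    qed
    moreover have "card U = 2 ^ (n - 1)"
      unfolding U_def using inj_on_comb [OF \<phi>] card_dot_eq [OF c]
      by (subst card_image) (auto intro: inj_on_subset)
    ultimately show "card {\<chi> \<in> tee n r \<phi> c. p \<chi> = p \<psi>} = 2 ^ (n - 1)"
      by (simp add: card_image)
  qed
qed

section \<open>Cliques and complete multipartite subgraphs\<close>

text \<open>Seen from \<open>\<phi>\<close>, the other members of a clique are matrices of rank one,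
  any two of which share a factor. A member off the line of \<open>\<psi>\<close> shares only
  \<open>c\<close> with \<open>\<psi>\<close>, a member off the tee shares only \<open>f\<close>,
  and these two would share nothing with each other.\<close>

lemma clique_cases:
  assumes Y: "Y \<subseteq> full_rank n r" "\<And>\<psi> \<chi>. \<psi> \<in> Y \<Longrightarrow> \<chi> \<in> Y \<Longrightarrow> \<psi> \<noteq> \<chi> \<Longrightarrow> madj n r \<psi> \<chi>"
    and \<phi>: "\<phi> \<in> Y" and \<psi>: "\<psi> \<in> Y" "\<psi> \<noteq> \<phi>"
  shows "(\<exists>f\<in>space2 r - row_space n \<phi>. Y \<subseteq> line n \<phi> f) \<or> (\<exists>c\<in>space2 n - {0}. Y \<subseteq> tee n r \<phi> c)"
proof (rule ccontr)
  assume neg: "\<not> ?thesis"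
  have lab: "\<exists>c f. c \<in> space2 n \<and> c \<noteq> 0 \<and> f \<in> space2 r \<and> f \<notin> row_space n \<phi> \<and> f \<noteq> 0 \<and> \<chi> = \<phi> + outer c f"
    if "\<chi> \<in> Y" "\<chi> \<noteq> \<phi>" for \<chi>
    using Y(2) [OF \<phi> that(1)] that(2) by (metis madjE)
  obtain c f where cf: "c \<in> space2 n" "c \<noteq> 0" "f \<in> space2 r" "f \<notin> row_space n \<phi>" "f \<noteq> 0" "\<psi> = \<phi> + outer c f"
    using lab [OF \<psi>] by blast
  obtain \<chi>1 where \<chi>1: "\<chi>1 \<in> Y" "\<chi>1 \<notin> line n \<phi> f" using neg cf by blast
  obtain \<chi>2 where \<chi>2: "\<chi>2 \<in> Y" "\<chi>2 \<notin> tee n r \<phi> c" using neg cf by blast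
  have "\<chi>1 \<noteq> \<phi>" using \<chi>1(2) line_self by blast
  then obtain c1 f1 where 1: "c1 \<in> space2 n" "c1 \<noteq> 0" "f1 \<noteq> 0" "\<chi>1 = \<phi> + outer c1 f1"
    using lab [OF \<chi>1(1)] by blast
  have "\<chi>2 \<noteq> \<phi>" using \<chi>2(2) tee_self Y(1) \<phi> by blast
  then obtain c2 f2 where 2: "c2 \<in> space2 n" "c2 \<noteq> 0" "f2 \<in> space2 r" "f2 \<noteq> 0" "\<chi>2 = \<phi> + outer c2 f2"
    using lab [OF \<chi>2(1)] by blast
  have f1: "f1 \<noteq> f" using \<chi>1(2) 1 by (auto simp: line_def)
  have c2: "c2 \<noteq> c" using \<chi>2 2 Y(1) by (auto simp: tee_def)
  have "\<psi> \<noteq> \<chi>1" using cf \<chi>1(2) by (auto simp: line_def)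
  then have "c = c1 \<or> f = f1"
    using Y(2) [OF \<psi>(1) \<chi>1(1)] madj_imp_rank_one cf 1 by blast
  then have c1: "c1 = c" using f1 by blast
  have "\<psi> \<noteq> \<chi>2" using cf \<chi>2 Y(1) by (auto simp: tee_def)
  then have "c = c2 \<or> f = f2"
    using Y(2) [OF \<psi>(1) \<chi>2(1)] madj_imp_rank_one cf 2 by blast
  then have f2: "f2 = f" using c2 by blast
  have "\<chi>1 \<noteq> \<chi>2" using \<chi>1(2) 2 f2 by (auto simp: line_def)
  then have "c1 = c2 \<or> f1 = f2"
    using Y(2) [OF \<chi>1(1) \<chi>2(1)] madj_imp_rank_one 1 2 by blast
  then show False using c1 c2 f1 f2 by blast
qed

text \<open>An octahedron contains no triangle of vertices on a common line.\<close>

lemma octahedron_triangle: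
  assumes FR: "a \<in> full_rank n r" "b \<in> full_rank n r" "d \<in> full_rank n r"
      "a' \<in> full_rank n r" "b' \<in> full_rank n r" "d' \<in> full_rank n r"
    and adj: "madj n r b a" "madj n r b d" "madj n r a d" "madj n r b a'" "madj n r d a'"
      "madj n r b d'" "madj n r a d'" "madj n r a' d'" "madj n r d b'" "madj n r a b'"
      "madj n r a' b'" "madj n r d' b'"
    and neq: "a \<noteq> a'" "b \<noteq> b'" "d \<noteq> d'"
    and nadj: "\<not> madj n r a a'" "\<not> madj n r b b'" "\<not> madj n r d d'"
    and c: "c \<noteq> 0" "a \<in> tee n r b c"
  shows "d \<in> tee n r b c"
proof (rule ccontr)
  \<comment> \<open>Otherwise \<open>a\<close>, \<open>b\<close> and \<open>d\<close> lie on one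
    line with direction \<open>f\<close>. The factors shared by adjacent vertices then determine the
    three antipodes one after the other.\<close>
  assume neg: "d \<notin> tee n r b c"
  obtain c1 f where af: "c1 \<in> space2 n" "c1 \<noteq> 0" "f \<in> space2 r" "f \<notin> row_space n b" "f \<noteq> 0" "a = b + outer c1 f"
    using adj(1) by (rule madjE)
  obtain c0 f0 where d0: "c0 \<in> space2 n" "c0 \<noteq> 0" "f0 \<in> space2 r" "f0 \<notin> row_space n b" "f0 \<noteq> 0" "d = b + outer c0 f0"
    using adj(2) by (rule madjE)
  have "c1 = c"
  proof -
    obtain g where "a = b + outer c g" using c(2) by (auto simp: tee_def)
    then have "outer c1 f = outer c g" using af(6) by simp
    then show ?thesis using outer_eq_outer(1) af by blast
  qed
  have c01: "c0 \<noteq> c1" using neg d0 FR(3) \<open>c1 = c\<close> by (auto simp: tee_def)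
  have "c1 = c0 \<or> f = f0" using madj_imp_rank_one adj(3) af d0 by blast
  with c01 have f0: "f0 = f" by blast
  note dd = d0 [unfolded f0]
  obtain c2 f2 where a': "c2 \<in> space2 n" "c2 \<noteq> 0" "f2 \<noteq> 0" "a' = b + outer c2 f2"
    using adj(4) by (rule madjE)
  \<comment> \<open>On the line, \<open>a'\<close> would be adjacent to its antipode
    \<open>a\<close>. The antipodes \<open>d'\<close> and \<open>b'\<close> leave the line for the
    same reason.\<close>
  have "f2 \<noteq> f"
  proof
    assume "f2 = f"
    then have "a' \<in> line n b f" "a \<in> line n b f" using a' af by (auto simp: line_def)
    then show False using madj_line FR(2) af(3,4) neq(1) nadj(1) by blast
  qed
  moreover have "c0 = c2 \<or> f = f2" using madj_imp_rank_one adj(5) a' dd by blast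
  ultimately have c2: "c2 = c0" by blast
  obtain c3 g where d': "c3 \<in> space2 n" "c3 \<noteq> 0" "g \<noteq> 0" "d' = b + outer c3 g"
    using adj(6) by (rule madjE)
  have gf: "g \<noteq> f"
  proof
    assume "g = f"
    then have "d' \<in> line n b f" "d \<in> line n b f" using d' dd by (auto simp: line_def)
    then show False using madj_line FR(2) af(3,4) neq(3) nadj(3) by blast
  qed
  moreover have "c1 = c3 \<or> f = g" using madj_imp_rank_one adj(7) d' af by blast
  ultimately have c3: "c3 = c1" by blast
  have "c2 = c3 \<or> f2 = g" using madj_imp_rank_one adj(8) a' d' by blast
  then have f2: "f2 = g" using c01 c2 c3 by simp
  \<comment> \<open>The vertex \<open>b'\<close> is not adjacent to \<open>b\<close>, so its factors
    are taken relative to \<open>d\<close>.\<close>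
  obtain e k where b': "e \<in> space2 n" "e \<noteq> 0" "k \<noteq> 0" "b' = d + outer e k"
    using adj(9) by (rule madjE)
  have ad: "a = d + outer (c0 + c1) f" and bd: "b = d + outer c0 f"
    using af(6) dd(6) by (simp_all add: outer_add_left add.assoc)
  have c01': "c0 + c1 \<noteq> 0" using c01 by simp
  have "k \<noteq> f"
  proof
    assume "k = f"
    then have "b' \<in> line n d f" "b \<in> line n d f" using b' bd dd(1) by (auto simp: line_def)
    moreover have "f \<notin> row_space n d" using line_not_row_space [OF FR(2) af(4)] dd by (auto simp: line_def)
    ultimately show False using madj_line FR(3) af(3) neq(2) nadj(2) by blast
  qed
  moreover have "c0 + c1 = e \<or> f = k"
    using adj(10) b' ad madj_imp_rank_one [of n r d "c0 + c1" f e k] c01' af(5) by simp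
  ultimately have e: "e = c0 + c1" by blast
  have a'd: "a' = d + outer c0 (f + g)"
    using a'(4) c2 f2 bd by (simp add: outer_add_right add.assoc)
  have fg: "f + g \<noteq> 0" using gf by simp
  have "c0 = e \<or> f + g = k"
    using madj_imp_rank_one adj(11) a'd b' fg dd(2) by blast
  moreover have "c0 \<noteq> e" using e af(2) by simp
  ultimately have k: "k = f + g" by blast
  have bb: "b' = b + outer c1 f + outer (c0 + c1) g"
    using b'(4) dd(6) by (simp add: e k outer_add_right outer_add_left add.assoc add.commute add.left_commute)
  \<comment> \<open>The last two antipodes are adjacent, but the factors found so far make their
    difference a matrix of rank two.\<close>
  have "outer c1 f + outer c0 g = d' + b'"
    by (simp add: bb d'(4) c3 outer_add_left add.assoc add.commute add.left_commute)
  moreover obtain e' h where "b' = d' + outer e' h" using adj(12) by (rule madjE)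
  ultimately have "outer c1 f + outer c0 g = outer e' h" by (simp add: add.assoc)
  then show False using rank_one_sum [of c1 f c0 g e' h] af(2,5) d'(3) dd(2) c01 gf by metis
qed

text \<open>Three vertices in distinct parts extend to an octahedron by second members of their
  parts, so \<open>octahedron_triangle\<close> carries the column vector \<open>c\<close> of one
  edge to the whole triangle. Chains of such triangles reach every vertex.\<close>

lemma multipartite_subset_tee:
  fixes p :: "(nat \<Rightarrow> vec2) \<Rightarrow> 'b"
  assumes Y: "Y \<subseteq> full_rank n r"
    and p: "\<And>\<psi> \<chi>. \<psi> \<in> Y \<Longrightarrow> \<chi> \<in> Y \<Longrightarrow> madj n r \<psi> \<chi> \<longleftrightarrow> p \<psi> \<noteq> p \<chi>"
    and three: "\<And>i j. \<exists>\<psi>\<in>Y. p \<psi> \<noteq> i \<and> p \<psi> \<noteq> j"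
    and two: "\<And>\<psi>. \<psi> \<in> Y \<Longrightarrow> \<exists>\<chi>\<in>Y. p \<chi> = p \<psi> \<and> \<chi> \<noteq> \<psi>"
  shows "\<exists>\<phi>\<in>Y. \<exists>c\<in>space2 n - {0}. Y \<subseteq> tee n r \<phi> c"
proof -
  have tri: "d \<in> tee n r b c"
    if abd: "a \<in> Y" "b \<in> Y" "d \<in> Y" "p a \<noteq> p b" "p b \<noteq> p d" "p a \<noteq> p d" and c: "c \<noteq> 0" "a \<in> tee n r b c"
    for a b c d
  proof -
    obtain a' b' d' where *: "a' \<in> Y" "p a' = p a" "a' \<noteq> a" "b' \<in> Y" "p b' = p b" "b' \<noteq> b"
      "d' \<in> Y" "p d' = p d" "d' \<noteq> d" using two abd(1-3) by meson
    show ?thesis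
      by (rule octahedron_triangle [of a n r b d a' b' d']) (use abd * c Y p in auto)
  qed
  obtain b where b: "b \<in> Y" using three by blast
  obtain a where a: "a \<in> Y" "p a \<noteq> p b" using three by blast
  obtain d where d: "d \<in> Y" "p d \<noteq> p a" "p d \<noteq> p b" using three by blast
  obtain c f where cf: "c \<in> space2 n" "c \<noteq> 0" "f \<in> space2 r" "a = b + outer c f"
    using p b a by (metis madjE)
  have ab: "a \<in> tee n r b c" using cf a Y by (auto simp: tee_def)
  have bFR: "b \<in> full_rank n r" using b Y by blast
  have "x \<in> tee n r b c" if x: "x \<in> Y" for x
  proof -
    consider "p x = p b" | "p x = p a" | "p x \<noteq> p a" "p x \<noteq> p b" by blast
    then show ?thesis
    proof cases
      case 1
      \<comment> \<open>Here \<open>x\<close> is not adjacent to the base point \<open>b\<close>, so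
        the base point is moved to \<open>a\<close> first.\<close>
      have te: "tee n r a c = tee n r b c" using tee_eq [OF ab] .
      have "b \<in> tee n r a c" using te tee_self [OF bFR] by simp
      then have "d \<in> tee n r a c" using tri [of b a d c] a b d cf by metis
      then have "x \<in> tee n r a c" using tri [of d a x c] a d x cf 1 by metis
      then show ?thesis using te by simp
    next
      case 2
      have "d \<in> tee n r b c" using tri [of a b d c] a b d cf ab by metis
      then show ?thesis using tri [of d b x c] b d x cf 2 a by metis
    next
      case 3
      then show ?thesis using tri [of a b x c] a b x cf ab by metis
    qed
  qed
  then show ?thesis using b cf by blast
qed

section \<open>Isomorphisms of graphs\<close>

lemma verts_induced [simp]: "verts (induced G Y) = verts G \<inter> Y"
  by (simp add: induced_def)

lemma edges_induced [simp]: "edges (induced G Y) = {e \<in> edges G. e \<subseteq> Y}"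
  by (simp add: induced_def)

lemma graph_isoD:
  assumes "graph_iso f G H"
  shows "bij_betw f (verts G) (verts H)" "inj_on f (verts G)" "f ` verts G = verts H"
    "u \<in> verts G \<Longrightarrow> f u \<in> verts H"
    "u \<in> verts G \<Longrightarrow> v \<in> verts G \<Longrightarrow> {f u, f v} \<in> edges H \<longleftrightarrow> {u, v} \<in> edges G"
  using assms by (auto simp: graph_iso_def bij_betw_def)

lemma graph_iso_comp: "graph_iso f G H \<Longrightarrow> graph_iso g H K \<Longrightarrow> graph_iso (g \<circ> f) G K"
  unfolding graph_iso_def by (auto intro: bij_betw_trans dest: bij_betwE)

lemma graph_iso_inv:
  assumes "graph_iso f G H" shows "graph_iso (inv_into (verts G) f) H G"
proof -
  note f = graph_isoD [OF assms]
  have g: "f (inv_into (verts G) f x) = x" "inv_into (verts G) f x \<in> verts G" if "x \<in> verts H" for x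
    using that f(3) by (auto simp: f_inv_into_f inv_into_into)
  show ?thesis
    unfolding graph_iso_def using bij_betw_inv_into [OF f(1)] g f(5) by (metis (no_types, lifting))
qed

lemma isomorphicI: "graph_iso f G H \<Longrightarrow> isomorphic G H"
  unfolding isomorphic_def by blast

lemma isomorphic_sym: "isomorphic G H \<Longrightarrow> isomorphic H G"
  unfolding isomorphic_def using graph_iso_inv by blast

lemma isomorphic_trans: "isomorphic G H \<Longrightarrow> isomorphic H K \<Longrightarrow> isomorphic G K"
  unfolding isomorphic_def using graph_iso_comp by blast

lemma graph_iso_induced:
  assumes "graph_iso f G H" "Y \<subseteq> verts G"
  shows "graph_iso f (induced G Y) (induced H (f ` Y))"
proof -
  note f = graph_isoD [OF assms(1)]
  have "f ` Y \<subseteq> verts H" using f(3) assms(2) by blast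
  then have "verts H \<inter> f ` Y = f ` Y" "verts G \<inter> Y = Y" using assms(2) by blast+
  then have "bij_betw f (verts G \<inter> Y) (verts H \<inter> f ` Y)"
    using inj_on_subset [OF f(2) assms(2)] by (simp add: bij_betw_def)
  then show ?thesis using f(5) assms(2) by (auto simp: graph_iso_def)
qed

lemma isomorphic_card_verts: "isomorphic G H \<Longrightarrow> card (verts G) = card (verts H)"
  unfolding isomorphic_def graph_iso_def using bij_betw_same_card by blast

section \<open>Transport of copies and of homogeneity along an isomorphism\<close>

lemma copiesI: "Y \<subseteq> verts G \<Longrightarrow> isomorphic (induced G Y) X \<Longrightarrow> Y \<in> copies G X"
  by (simp add: copies_def)

lemma card_copies: "Y \<in> copies G X \<Longrightarrow> card Y = card (verts X)"
  by (auto simp: copies_def Int_absorb1 dest: isomorphic_card_verts)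

lemma image_copies_subset:
  assumes p: "graph_iso p M G" and Y: "Y \<in> copies M X"
  shows "p ` Y \<in> copies G X"
proof -
  have Y': "Y \<subseteq> verts M" "isomorphic (induced M Y) X" using Y by (auto simp: copies_def)
  have "isomorphic (induced G (p ` Y)) (induced M Y)"
    by (rule isomorphic_sym [OF isomorphicI [OF graph_iso_induced [OF p Y'(1)]]])
  then show ?thesis
    using Y' graph_isoD(3) [OF p] by (intro copiesI isomorphic_trans [OF _ Y'(2)]) auto
qed

lemma image_inv_image:
  assumes "graph_iso p M G" "Y \<subseteq> verts G"
  shows "p ` inv_into (verts M) p ` Y = Y"
  using assms(2) graph_isoD(3) [OF assms(1)] image_inv_into_cancel by metis

lemma inv_image_image:
  assumes "graph_iso p M G" "Y \<subseteq> verts M"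
  shows "inv_into (verts M) p ` p ` Y = Y"
  using inv_into_image_cancel [OF graph_isoD(2) [OF assms(1)] assms(2)] .

lemma copies_iso_eq:
  assumes p: "graph_iso p M G"
  shows "copies G X = (`) p ` copies M X"
proof (intro equalityI subsetI)
  fix Y assume Y: "Y \<in> copies G X"
  then have "inv_into (verts M) p ` Y \<in> copies M X"
    using image_copies_subset [OF graph_iso_inv [OF p]] by blast
  moreover have "Y = p ` inv_into (verts M) p ` Y"
    using image_inv_image [OF p] Y by (simp add: copies_def)
  ultimately show "Y \<in> (`) p ` copies M X" by blast
qed (use image_copies_subset [OF p] in auto)

lemma inj_on_image_subset_iff:
  "inj_on f C \<Longrightarrow> A \<subseteq> C \<Longrightarrow> B \<subseteq> C \<Longrightarrow> f ` A \<subseteq> f ` B \<longleftrightarrow> A \<subseteq> B"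
  unfolding inj_on_def by blast

lemma free_copies_iso_eq:
  assumes p: "graph_iso p M G"
  shows "free_copies G X0 X1 = (`) p ` free_copies M X0 X1"
proof -
  have sub: "p ` Y \<subseteq> p ` Z \<longleftrightarrow> Y \<subseteq> Z" if "Y \<in> copies M X0" "Z \<in> copies M X1" for Y Z
    using that inj_on_image_subset_iff [OF graph_isoD(2) [OF p]] by (auto simp: copies_def)
  then have "(\<exists>Z\<in>(`) p ` copies M X1. p ` Y \<subseteq> Z) \<longleftrightarrow> (\<exists>Z\<in>copies M X1. Y \<subseteq> Z)" if "Y \<in> copies M X0" for Y
    using that by simp
  then show ?thesis
    unfolding free_copies_def copies_iso_eq [OF p] by (auto simp del: bex_simps)
qed

lemma free_copies_subset: "free_copies G X0 X1 \<subseteq> copies G X0"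
  by (auto simp: free_copies_def)

lemma copies_subset_Pow: "copies G X \<subseteq> Pow (verts G)"
  by (auto simp: copies_def)

text \<open>An isomorphism between members is conjugated into \<open>M\<close>, extended there and
  conjugated back.\<close>

lemma ultrahomogeneous_iso:
  assumes p: "graph_iso p M G" and F: "F \<subseteq> Pow (verts M)" and u: "ultrahomogeneous_wrt M F"
  shows "ultrahomogeneous_wrt G ((`) p ` F)"
  unfolding ultrahomogeneous_wrt_def
proof (intro ballI allI impI)
  let ?q = "inv_into (verts M) p"
  fix Y1 Y2 f assume "Y1 \<in> (`) p ` F" "Y2 \<in> (`) p ` F" and f: "graph_iso f (induced G Y1) (induced G Y2)"
  then obtain Z1 Z2 where Z: "Z1 \<in> F" "Z2 \<in> F" "Y1 = p ` Z1" "Y2 = p ` Z2" by blast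
  have V: "Z1 \<subseteq> verts M" "Z2 \<subseteq> verts M" using Z F by blast+
  have V': "Y1 \<subseteq> verts G" "Y2 \<subseteq> verts G" using V Z graph_isoD(3) [OF p] by blast+
  have q: "graph_iso ?q (induced G Y2) (induced M Z2)"
    using graph_iso_induced [OF graph_iso_inv [OF p] V'(2)] inv_image_image [OF p V(2)] Z by simp
  have pz: "graph_iso p (induced M Z1) (induced G Y1)"
    using graph_iso_induced [OF p V(1)] Z by simp
  obtain g where g: "automorphism M g" "\<forall>z\<in>Z1. g z = (?q \<circ> (f \<circ> p)) z"
    using u graph_iso_comp [OF graph_iso_comp [OF pz f] q] Z(1,2) unfolding ultrahomogeneous_wrt_def by blast
  have "(p \<circ> (g \<circ> ?q)) y = f y" if y: "y \<in> Y1" for y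
  proof -
    obtain z where z: "z \<in> Z1" "y = p z" using y Z(3) by blast
    have "f y \<in> Y2" using graph_isoD(4) [OF f, of y] y V' by auto
    then have "f y \<in> verts G" using V' by blast
    then have "p (?q (f y)) = f y" using graph_isoD(3) [OF p] by (simp add: f_inv_into_f)
    moreover have "?q y = z" using z V graph_isoD(2) [OF p] by (auto simp: inv_into_f_f)
    ultimately show ?thesis using g(2) z by simp
  qed
  moreover have "automorphism G (p \<circ> (g \<circ> ?q))"
    using graph_iso_comp [OF graph_iso_comp [OF graph_iso_inv [OF p] g(1)] p] .
  ultimately show "\<exists>g. automorphism G g \<and> (\<forall>y\<in>Y1. g y = f y)" by blast
qed

text \<open>Both directions matter: ultrahomogeneity is refuted on the matrix side, and the
  refutation has to be carried to the pencils.\<close>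

lemma ultrahomogeneous_iso_iff:
  assumes p: "graph_iso p M G" and F: "F \<subseteq> Pow (verts M)"
  shows "ultrahomogeneous_wrt G ((`) p ` F) \<longleftrightarrow> ultrahomogeneous_wrt M F"
proof
  let ?q = "inv_into (verts M) p"
  assume "ultrahomogeneous_wrt G ((`) p ` F)"
  moreover have "(`) p ` F \<subseteq> Pow (verts G)" using F graph_isoD(3) [OF p] by blast
  ultimately have "ultrahomogeneous_wrt M ((`) ?q ` (`) p ` F)"
    using ultrahomogeneous_iso [OF graph_iso_inv [OF p]] by blast
  moreover have "(`) ?q ` (`) p ` F = F"
  proof -
    have "?q ` p ` Y = Y" if "Y \<in> F" for Y
      using inv_image_image [OF p] F that by blast
    then show ?thesis unfolding image_image [of "(`) ?q" "(`) p" F] by simp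
  qed
  ultimately show "ultrahomogeneous_wrt M F" by simp
qed (rule ultrahomogeneous_iso [OF p F])

lemma homogeneous_iso:
  assumes p: "graph_iso p M G" and F: "F \<subseteq> Pow (verts M)" and h: "homogeneous_wrt M F"
  shows "homogeneous_wrt G ((`) p ` F)"
  unfolding homogeneous_wrt_def
proof (intro ballI impI, clarify)
  let ?q = "inv_into (verts M) p"
  fix Z1 Z2 v1 w1 v2 w2
  assume Z: "Z1 \<in> F" "Z2 \<in> F" and iso: "isomorphic (induced G (p ` Z1)) (induced G (p ` Z2))"
    and arcs: "(v1, w1) \<in> arcs (induced G (p ` Z1))" "(v2, w2) \<in> arcs (induced G (p ` Z2))"
  have V: "Z1 \<subseteq> verts M" "Z2 \<subseteq> verts M" using Z F by blast+
  have ind: "isomorphic (induced M Z) (induced G (p ` Z))" if "Z \<subseteq> verts M" for Z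
    by (rule isomorphicI [OF graph_iso_induced [OF p that]])
  have iso': "isomorphic (induced M Z1) (induced M Z2)"
    by (rule isomorphic_trans [OF ind [OF V(1)] isomorphic_trans [OF iso isomorphic_sym [OF ind [OF V(2)]]]])
  have arcs_M: "\<exists>a b. v = p a \<and> w = p b \<and> a \<in> verts M \<and> b \<in> verts M \<and> (a, b) \<in> arcs (induced M Z)"
    if "(v, w) \<in> arcs (induced G (p ` Z))" "Z \<subseteq> verts M" for v w Z
  proof -
    have "v \<in> p ` Z" "w \<in> p ` Z" "{v, w} \<in> edges G" using that(1) by (auto simp: arcs_def)
    then obtain a b where ab: "v = p a" "w = p b" "a \<in> Z" "b \<in> Z" by blast
    moreover from ab have "{a, b} \<in> edges M"
      using \<open>{v, w} \<in> edges G\<close> graph_isoD(5) [OF p, of a b] that(2) by auto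
    ultimately show ?thesis using that(2) by (auto simp: arcs_def)
  qed
  obtain a1 b1 where 1: "v1 = p a1" "w1 = p b1" "a1 \<in> verts M" "b1 \<in> verts M" "(a1, b1) \<in> arcs (induced M Z1)"
    using arcs_M [OF arcs(1) V(1)] by blast
  obtain a2 b2 where 2: "v2 = p a2" "w2 = p b2" "a2 \<in> verts M" "b2 \<in> verts M" "(a2, b2) \<in> arcs (induced M Z2)"
    using arcs_M [OF arcs(2) V(2)] by blast
  have "\<forall>(v1, w1)\<in>arcs (induced M Z1). \<forall>(v2, w2)\<in>arcs (induced M Z2).
      \<exists>f. automorphism M f \<and> f ` Z1 = Z2 \<and> f v1 = v2 \<and> f w1 = w2"
    using h Z iso' unfolding homogeneous_wrt_def by simp
  from bspec [OF bspec [OF this 1(5), unfolded case_prod_conv] 2(5), unfolded case_prod_conv]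
  obtain f where f: "automorphism M f" "f ` Z1 = Z2" "f a1 = a2" "f b1 = b2" by (elim exE conjE)
  have q: "?q (p a) = a" if "a \<in> verts M" for a
    using graph_isoD(2) [OF p] that by (simp add: inv_into_f_f)
  have "automorphism G (p \<circ> (f \<circ> ?q))"
    using graph_iso_comp [OF graph_iso_comp [OF graph_iso_inv [OF p] f(1)] p] .
  moreover have "(p \<circ> (f \<circ> ?q)) ` (p ` Z1) = p ` Z2"
    by (simp only: image_comp [symmetric] inv_image_image [OF p V(1)] f(2))
  moreover have "(p \<circ> (f \<circ> ?q)) v1 = v2" "(p \<circ> (f \<circ> ?q)) w1 = w2"
    using 1 2 f q by simp_all
  ultimately show "\<exists>f. automorphism G f \<and> f ` p ` Z1 = p ` Z2 \<and> f v1 = v2 \<and> f w1 = w2" by blast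
qed

lemma regular_iso:
  assumes p: "graph_iso p M G" and reg: "\<And>v. v \<in> verts M \<Longrightarrow> card {w \<in> verts M. {v, w} \<in> edges M} = d"
  shows "regular G d"
  unfolding regular_def
proof
  fix v assume "v \<in> verts G"
  then obtain a where a: "a \<in> verts M" "v = p a" using graph_isoD(3) [OF p] by blast
  have "{w \<in> verts G. {v, w} \<in> edges G} = p ` {w \<in> verts M. {a, w} \<in> edges M}"
  proof (intro equalityI subsetI)
    fix w assume w: "w \<in> {w \<in> verts G. {v, w} \<in> edges G}"
    then obtain b where b: "b \<in> verts M" "w = p b" using graph_isoD(3) [OF p] by blast
    then have "{a, b} \<in> edges M" using w a graph_isoD(5) [OF p a(1) b(1)] by simp
    then show "w \<in> p ` {w \<in> verts M. {a, w} \<in> edges M}" using b by blast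
  next
    fix w assume "w \<in> p ` {w \<in> verts M. {a, w} \<in> edges M}"
    then obtain b where b: "b \<in> verts M" "{a, b} \<in> edges M" "w = p b" by blast
    then show "w \<in> {w \<in> verts G. {v, w} \<in> edges G}"
      using a graph_isoD(5) [OF p a(1) b(1)] graph_isoD(4) [OF p b(1)] by simp
  qed
  moreover have "inj_on p {w \<in> verts M. {a, w} \<in> edges M}"
    using graph_isoD(2) [OF p] by (rule inj_on_subset) auto
  ultimately show "card {w \<in> verts G. {v, w} \<in> edges G} = d"
    using reg a by (simp add: card_image)
qed

section \<open>Complete and complete multipartite graphs\<close>

lemma verts_complete_graph [simp]: "verts (complete_graph n) = {..<n}"
  by (simp add: complete_graph_def)

lemma edge_complete_graph: "{i, j} \<in> edges (complete_graph n) \<longleftrightarrow> i < n \<and> j < n \<and> i \<noteq> j"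
  by (auto simp: complete_graph_def doubleton_eq_iff)

lemma isomorphic_complete_graph_iff:
  "isomorphic H (complete_graph n) \<longleftrightarrow>
     finite (verts H) \<and> card (verts H) = n \<and> (\<forall>u\<in>verts H. \<forall>v\<in>verts H. {u, v} \<in> edges H \<longleftrightarrow> u \<noteq> v)"
proof
  assume "isomorphic H (complete_graph n)"
  then obtain f where f: "graph_iso f H (complete_graph n)" unfolding isomorphic_def by blast
  note F = graph_isoD [OF f]
  have "finite (verts H)" using bij_betw_finite [OF F(1)] by simp
  moreover have "card (verts H) = n" using bij_betw_same_card [OF F(1)] by simp
  moreover have "{u, v} \<in> edges H \<longleftrightarrow> u \<noteq> v" if "u \<in> verts H" "v \<in> verts H" for u v
    using F(5) [OF that] F(4) that inj_on_eq_iff [OF F(2) that] by (simp add: edge_complete_graph)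
  ultimately show "finite (verts H) \<and> card (verts H) = n \<and>
    (\<forall>u\<in>verts H. \<forall>v\<in>verts H. {u, v} \<in> edges H \<longleftrightarrow> u \<noteq> v)" by blast
next
  assume R: "finite (verts H) \<and> card (verts H) = n \<and>
    (\<forall>u\<in>verts H. \<forall>v\<in>verts H. {u, v} \<in> edges H \<longleftrightarrow> u \<noteq> v)"
  then obtain f where f: "bij_betw f (verts H) {..<n}"
    using ex_bij_betw_finite_nat [of "verts H"] by (auto simp: atLeast0LessThan)
  have "graph_iso f H (complete_graph n)"
    unfolding graph_iso_def verts_complete_graph
  proof (intro conjI f ballI)
    fix u v assume uv: "u \<in> verts H" "v \<in> verts H"
    then have "f u < n" "f v < n" using bij_betwE [OF f] by auto
    then show "{u, v} \<in> edges H \<longleftrightarrow> {f u, f v} \<in> edges (complete_graph n)"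
      using R uv inj_on_eq_iff [OF bij_betw_imp_inj_on [OF f] uv] by (simp add: edge_complete_graph)
  qed
  then show "isomorphic H (complete_graph n)" by (rule isomorphicI)
qed

lemma two_point_bijection:
  fixes i j i' j' :: nat
  assumes "i < n" "j < n" "i' < n" "j' < n" "i \<noteq> j" "i' \<noteq> j'"
  obtains \<pi> where "bij_betw \<pi> {..<n} {..<n}" "\<pi> i = i'" "\<pi> j = j'"
proof -
  define \<tau> where "\<tau> = transpose i i'"
  have bij: "bij_betw (transpose a b) {..<n} {..<n}" if "a < n" "b < n" for a b :: nat
  proof (rule bij_betw_imageI)
    show "inj_on (transpose a b) {..<n}" by simp
    show "transpose a b ` {..<n} = {..<n}"
      using that by (simp add: transpose_image_eq)
  qed
  \<comment> \<open>The second transposition leaves \<open>i'\<close> in place, because neither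
    \<open>\<tau> j\<close> nor \<open>j'\<close> equals it.\<close>
  have "\<tau> j < n" using assms by (auto simp: \<tau>_def transpose_def)
  then have "bij_betw (transpose (\<tau> j) j' \<circ> \<tau>) {..<n} {..<n}"
    unfolding \<tau>_def using bij assms by (intro bij_betw_trans [OF bij bij]) auto
  moreover have "(transpose (\<tau> j) j' \<circ> \<tau>) i = i'" "(transpose (\<tau> j) j' \<circ> \<tau>) j = j'"
    using assms by (auto simp: \<tau>_def transpose_def)
  ultimately show ?thesis using that by blast
qed

lemma arc_transitive_complete_graph: "arc_transitive (complete_graph n)"
proof -
  have "\<exists>f. automorphism (complete_graph n) f \<and> f i = i' \<and> f j = j'"
    if ij: "i < n" "j < n" "i \<noteq> j" "i' < n" "j' < n" "i' \<noteq> j'" for i j i' j'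
  proof -
    obtain \<pi> where \<pi>: "bij_betw \<pi> {..<n} {..<n}" "\<pi> i = i'" "\<pi> j = j'"
      using two_point_bijection [of i n j i' j'] ij by metis
    have "automorphism (complete_graph n) \<pi>"
      using \<pi>(1) bij_betwE [OF \<pi>(1)] inj_on_eq_iff [OF bij_betw_imp_inj_on [OF \<pi>(1)]]
      by (auto simp: graph_iso_def edge_complete_graph)
    then show ?thesis using \<pi> by blast
  qed
  then show ?thesis
    by (auto simp: arc_transitive_def arcs_def edge_complete_graph)
qed

lemma verts_complete_multipartite [simp]: "verts (complete_multipartite t s) = {..<t * s}"
  by (simp add: complete_multipartite_def)

lemma edge_complete_multipartite:
  "{i, j} \<in> edges (complete_multipartite t s) \<longleftrightarrow> i < t * s \<and> j < t * s \<and> i div s \<noteq> j div s"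
  by (auto simp: complete_multipartite_def doubleton_eq_iff)

text \<open>The number of parts is not a hypothesis; it follows from the order and the common size
  of the parts.\<close>

lemma isomorphic_complete_multipartiteI:
  assumes fin: "finite (verts H)" and card: "card (verts H) = t * s" and s: "s > 0"
    and edge: "\<And>u v. u \<in> verts H \<Longrightarrow> v \<in> verts H \<Longrightarrow> {u, v} \<in> edges H \<longleftrightarrow> p u \<noteq> p v"
    and part: "\<And>v. v \<in> verts H \<Longrightarrow> card {u \<in> verts H. p u = p v} = s"
  shows "isomorphic H (complete_multipartite t s)"
proof -
  let ?P = "\<lambda>i. {u \<in> verts H. p u = i}"
  have "card (verts H) = card (\<Union>i\<in>p ` verts H. ?P i)"
    by (rule arg_cong [of _ _ card]) auto
  also have "\<dots> = (\<Sum>i\<in>p ` verts H. card (?P i))"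
    by (rule card_UN_disjoint) (use fin in auto)
  also have "\<dots> = (\<Sum>i\<in>p ` verts H. s)" by (rule sum.cong) (auto simp: part)
  also have "\<dots> = card (p ` verts H) * s" by simp
  finally have "card (p ` verts H) = t" using card s by simp
  then obtain e where e: "bij_betw e (p ` verts H) {..<t}"
    using ex_bij_betw_finite_nat [of "p ` verts H"] fin by (auto simp: atLeast0LessThan)
  have "\<exists>b. bij_betw b (?P i) {..<s}" if "i \<in> p ` verts H" for i
    using ex_bij_betw_finite_nat [of "?P i"] fin part that by (auto simp: atLeast0LessThan)
  then obtain b where b: "\<And>i. i \<in> p ` verts H \<Longrightarrow> bij_betw (b i) (?P i) {..<s}" by metis
  \<comment> \<open>The quotient by \<open>s\<close> numbers the part and the remainder the position
    in it, as in \<open>complete_multipartite\<close>.\<close>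
  define f where "f = (\<lambda>u. e (p u) * s + b (p u) u)"
  have bs: "b (p u) u < s" if "u \<in> verts H" for u
    using bij_betwE [OF b [of "p u"]] that by auto
  have fdiv: "f u div s = e (p u)" and fmod: "f u mod s = b (p u) u" if "u \<in> verts H" for u
    using bs [OF that] by (simp_all add: f_def)
  have et: "e (p u) < t" if "u \<in> verts H" for u
    using bij_betwE [OF e] that by auto
  have e_eq: "e (p u) = e (p v) \<longleftrightarrow> p u = p v" if "u \<in> verts H" "v \<in> verts H" for u v
    using inj_on_eq_iff [OF bij_betw_imp_inj_on [OF e]] that by blast
  have fts: "f u < t * s" if "u \<in> verts H" for u
    using fdiv [OF that] et [OF that] s by (metis less_mult_imp_div_less div_less_iff_less_mult)
  have inj: "inj_on f (verts H)"
  proof (rule inj_onI)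
    fix u v assume *: "u \<in> verts H" "v \<in> verts H" "f u = f v"
    then have "p u = p v" using fdiv e_eq by metis
    moreover from this have "b (p u) u = b (p u) v" using * fmod by metis
    ultimately show "u = v"
      using inj_onD [OF bij_betw_imp_inj_on [OF b [of "p u"]], of u v] * by auto
  qed
  have "f ` verts H = {..<t * s}"
    using fts card_image [OF inj] card by (intro card_subset_eq) auto
  then have "bij_betw f (verts H) {..<t * s}" using inj by (simp add: bij_betw_def)
  then have "graph_iso f H (complete_multipartite t s)"
    unfolding graph_iso_def using edge fdiv e_eq fts by (simp add: edge_complete_multipartite)
  then show ?thesis by (rule isomorphicI)
qed

text \<open>This extracts what the octahedron argument consumes: at least three parts, each with a
  second vertex for every vertex.\<close>

lemma isomorphic_complete_multipartiteD:
  assumes "isomorphic H (complete_multipartite t s)" "t \<ge> 3" "s \<ge> 2"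
  obtains p :: "'a \<Rightarrow> nat" where
    "\<And>u v. u \<in> verts H \<Longrightarrow> v \<in> verts H \<Longrightarrow> {u, v} \<in> edges H \<longleftrightarrow> p u \<noteq> p v"
    "\<And>i j. \<exists>u\<in>verts H. p u \<noteq> i \<and> p u \<noteq> j"
    "\<And>u. u \<in> verts H \<Longrightarrow> \<exists>v\<in>verts H. p v = p u \<and> v \<noteq> u"
proof -
  obtain f where f: "graph_iso f H (complete_multipartite t s)"
    using assms(1) unfolding isomorphic_def by blast
  note F = graph_isoD [OF f, simplified]
  have ex: "\<exists>u\<in>verts H. f u = i * s + k" if "i < t" "k < s" for i k
  proof -
    have "i * s + k < Suc i * s" using that by simp
    also have "\<dots> \<le> t * s" using that by (intro mult_le_mono1) simp
    finally have "i * s + k \<in> f ` verts H" using F(3) by simp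
    then show ?thesis by (metis imageE)
  qed
  show ?thesis
  proof (rule that [of "\<lambda>u. f u div s"])
    show "{u, v} \<in> edges H \<longleftrightarrow> f u div s \<noteq> f v div s" if "u \<in> verts H" "v \<in> verts H" for u v
      using F(5) [OF that] F(4) that by (simp add: edge_complete_multipartite)
    show "\<exists>u\<in>verts H. f u div s \<noteq> i \<and> f u div s \<noteq> j" for i j
    proof -
      have "\<exists>m<3::nat. m \<noteq> i \<and> m \<noteq> j" by presburger
      then obtain m where "m < 3" and m: "m \<noteq> i" "m \<noteq> j" by blast
      then have mt: "m < t" using assms(2) by simp
      obtain u where "u \<in> verts H" "f u = m * s + 0" using ex [OF mt, of 0] assms(3) by auto
      then have "f u div s = m" using assms(3) by simp
      then show ?thesis using m \<open>u \<in> verts H\<close> by blast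
    qed
    show "\<exists>v\<in>verts H. f v div s = f u div s \<and> v \<noteq> u" if u: "u \<in> verts H" for u
    proof -
      define k where "k = (if f u mod s = 0 then 1 else 0 :: nat)"
      have k: "k < s" "k \<noteq> f u mod s" using assms(3) by (auto simp: k_def)
      have "f u div s < t" using F(4) [OF u] by (simp add: less_mult_imp_div_less)
      then obtain v where v: "v \<in> verts H" "f v = f u div s * s + k" using ex k by blast
      then have "f v div s = f u div s" "f v mod s = k" using k(1) by simp_all
      then show ?thesis using v(1) k(2) by metis
    qed
  qed
qed

lemma arc_transitive_complete_multipartite: "arc_transitive (complete_multipartite t s)"
proof -
  have "\<exists>f. automorphism (complete_multipartite t s) f \<and> f v = v' \<and> f w = w'"
    if vw: "v < t * s" "w < t * s" "v div s \<noteq> w div s" "v' < t * s" "w' < t * s" "v' div s \<noteq> w' div s"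
    for v w v' w'
  proof -
    have s: "s > 0" using vw(1) by (cases s) auto
    have d: "x div s < t" if "x < t * s" for x using that by (simp add: less_mult_imp_div_less)
    obtain \<pi> where \<pi>: "bij_betw \<pi> {..<t} {..<t}" "\<pi> (v div s) = v' div s" "\<pi> (w div s) = w' div s"
      using two_point_bijection [of "v div s" t "w div s" "v' div s" "w' div s"] vw d by metis
    \<comment> \<open>The ends of the arc lie in different parts, so their positions inside the
      parts can be corrected independently.\<close>
    define \<theta> where "\<theta> = (\<lambda>i. if i = v div s then transpose (v mod s) (v' mod s) else transpose (w mod s) (w' mod s))"
    have \<theta>: "\<theta> i k < s" if "k < s" for i k
      using that s by (auto simp: \<theta>_def transpose_def)
    have "inj (\<theta> i)" for i
      by (cases "i = v div s") (simp_all add: \<theta>_def)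
    then have \<theta>inj: "\<theta> i k = \<theta> i l \<longleftrightarrow> k = l" for i k l
      by (rule inj_eq)
    define f where "f = (\<lambda>x. \<pi> (x div s) * s + \<theta> (x div s) (x mod s))"
    have fdiv: "f x div s = \<pi> (x div s)" and fmod: "f x mod s = \<theta> (x div s) (x mod s)" for x
      using \<theta> [of "x mod s" "x div s"] s by (simp_all add: f_def)
    have \<pi>inj: "\<pi> (x div s) = \<pi> (y div s) \<longleftrightarrow> x div s = y div s" if "x < t * s" "y < t * s" for x y
      using inj_on_eq_iff [OF bij_betw_imp_inj_on [OF \<pi>(1)]] d [OF that(1)] d [OF that(2)] by simp
    have f: "f x < t * s" if "x < t * s" for x
    proof -
      have "\<pi> (x div s) < t" using bij_betwE [OF \<pi>(1)] d [OF that] by blast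
      then show ?thesis using fdiv s by (metis div_less_iff_less_mult)
    qed
    have inj: "inj_on f {..<t * s}"
    proof (rule inj_onI)
      fix x y assume *: "x \<in> {..<t * s}" "y \<in> {..<t * s}" "f x = f y"
      then have "x div s = y div s" using fdiv \<pi>inj by (metis lessThan_iff)
      moreover from this have "x mod s = y mod s" using fmod \<theta>inj *(3) by metis
      ultimately show "x = y" by (metis div_mult_mod_eq)
    qed
    have "f ` {..<t * s} = {..<t * s}" using f by (intro endo_inj_surj inj) auto
    then have "automorphism (complete_multipartite t s) f"
      using inj f \<pi>inj fdiv by (simp add: graph_iso_def bij_betw_def edge_complete_multipartite)
    moreover have "f v = v'" "f w = w'"
      using vw \<pi> by (simp_all add: f_def \<theta>_def)
    ultimately show ?thesis by blast
  qed
  then show ?thesis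
    by (auto simp: arc_transitive_def arcs_def edge_complete_multipartite)
qed

section \<open>Decompositions\<close>

text \<open>The part of \<open>double_decomposition\<close> that makes sense for two arbitrary
  families, so that it can be proved for lines and tees and transported. The clause that each member
  contains an edge is what yields the uniqueness of the decompositions.\<close>

definition decomposition_pair :: "'a graph \<Rightarrow> 'a set set \<Rightarrow> 'a set set \<Rightarrow> nat \<Rightarrow> nat \<Rightarrow> bool" where
  "decomposition_pair G F0 F1 m0 m1 \<longleftrightarrow>
     (\<forall>v\<in>verts G. card {H \<in> F0. v \<in> H} = m0 \<and> card {H \<in> F1. v \<in> H} = m1) \<and>
     (\<forall>e\<in>edges G. (\<exists>!H. H \<in> F0 \<and> e \<subseteq> H) \<and> (\<exists>!H. H \<in> F1 \<and> e \<subseteq> H) \<and>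
        (\<forall>H0\<in>F0. \<forall>H1\<in>F1. e \<subseteq> H0 \<and> e \<subseteq> H1 \<longrightarrow> e = H0 \<inter> H1)) \<and>
     (\<forall>F\<in>{F0, F1}. \<forall>H\<in>F. (\<exists>e\<in>edges G. e \<subseteq> H) \<and> (\<forall>H'\<in>F. H \<noteq> H' \<longrightarrow> card (H \<inter> H') \<le> 1))"

lemma decomposition_pairD:
  assumes "decomposition_pair G F0 F1 m0 m1"
  shows "v \<in> verts G \<Longrightarrow> card {H \<in> F0. v \<in> H} = m0"
    and "v \<in> verts G \<Longrightarrow> card {H \<in> F1. v \<in> H} = m1"
    and "e \<in> edges G \<Longrightarrow> F \<in> {F0, F1} \<Longrightarrow> \<exists>!H. H \<in> F \<and> e \<subseteq> H"
    and "e \<in> edges G \<Longrightarrow> H0 \<in> F0 \<Longrightarrow> H1 \<in> F1 \<Longrightarrow> e \<subseteq> H0 \<Longrightarrow> e \<subseteq> H1 \<Longrightarrow> e = H0 \<inter> H1"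
    and "F \<in> {F0, F1} \<Longrightarrow> H \<in> F \<Longrightarrow> \<exists>e\<in>edges G. e \<subseteq> H"
    and "F \<in> {F0, F1} \<Longrightarrow> H \<in> F \<Longrightarrow> H' \<in> F \<Longrightarrow> H \<noteq> H' \<Longrightarrow> card (H \<inter> H') \<le> 1"
proof -
  note b = assms [unfolded decomposition_pair_def]
  note v = bspec [OF conjunct1 [OF b]]
  note e = bspec [OF conjunct1 [OF conjunct2 [OF b]]]
  note F = bspec [OF bspec [OF conjunct2 [OF conjunct2 [OF b]]]]
  show "v \<in> verts G \<Longrightarrow> card {H \<in> F0. v \<in> H} = m0" by (rule conjunct1 [OF v])
  show "v \<in> verts G \<Longrightarrow> card {H \<in> F1. v \<in> H} = m1" by (rule conjunct2 [OF v])
  show "e \<in> edges G \<Longrightarrow> F \<in> {F0, F1} \<Longrightarrow> \<exists>!H. H \<in> F \<and> e \<subseteq> H"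
    using conjunct1 [OF e] conjunct1 [OF conjunct2 [OF e]] by (elim insertE emptyE) simp_all
  show "e = H0 \<inter> H1" if "e \<in> edges G" "H0 \<in> F0" "H1 \<in> F1" "e \<subseteq> H0" "e \<subseteq> H1"
    by (rule mp [OF bspec [OF bspec [OF conjunct2 [OF conjunct2 [OF e]]]]]) (use that in simp_all)
  show "F \<in> {F0, F1} \<Longrightarrow> H \<in> F \<Longrightarrow> \<exists>e\<in>edges G. e \<subseteq> H" by (rule conjunct1 [OF F])
  show "card (H \<inter> H') \<le> 1" if "F \<in> {F0, F1}" "H \<in> F" "H' \<in> F" "H \<noteq> H'"
    by (rule mp [OF bspec [OF conjunct2 [OF F [OF that(1,2)]] that(3)] that(4)])
qed

text \<open>Each member contains an edge that lies in no other member, so no member can be left out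
  of a decomposition.\<close>

lemma unique_decomposition_self:
  assumes G: "finite_simple_graph G"
    and cover: "\<And>v. v \<in> verts G \<Longrightarrow> \<exists>H\<in>F. v \<in> H"
    and unique: "\<And>e. e \<in> edges G \<Longrightarrow> \<exists>!H. H \<in> F \<and> e \<subseteq> H"
    and edge: "\<And>H. H \<in> F \<Longrightarrow> \<exists>e\<in>edges G. e \<subseteq> H"
  shows "unique_decomposition G F F"
proof -
  have "edge_disjoint_union G F"
    unfolding edge_disjoint_union_def
    using cover unique by auto (metis)+
  moreover have "J = F" if J: "J \<subseteq> F" "edge_disjoint_union G J" for J
  proof (rule equalityI [OF J(1)], rule subsetI)
    fix H assume H: "H \<in> F"
    then obtain e where e: "e \<in> edges G" "e \<subseteq> H" using edge by blast
    then have "e \<in> (\<Union>H\<in>J. edges (induced G H))" using J(2) by (simp add: edge_disjoint_union_def)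
    then obtain H' where H': "H' \<in> J" "e \<subseteq> H'" by auto
    then have "H' \<in> F" using J(1) by blast
    then have "H' = H" using unique [OF e(1)] H' H e(2) by (elim ex1E) auto
    then show "H \<in> J" using H'(1) by simp
  qed
  ultimately show ?thesis
    unfolding unique_decomposition_def by (intro conjI allI impI subset_refl) auto
qed

lemma double_decompositionI:
  assumes G: "finite_simple_graph G" and b: "decomposition_pair G (free_copies G X0 X1) (copies G X1) m0 m1"
    and pos: "m0 > 0" "m1 > 0"
  shows "double_decomposition G X0 X1 (card (free_copies G X0 X1)) (card (copies G X1)) m0 m1
           (free_copies G X0 X1) (copies G X1)"
proof -
  let ?F0 = "free_copies G X0 X1" and ?F1 = "copies G X1"
  \<comment> \<open>A positive number of members through each vertex makes both families cover the
    vertices.\<close>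
  have cover: "\<exists>H\<in>F. v \<in> H" if "v \<in> verts G" "F \<in> {?F0, ?F1}" for v F
  proof -
    have "card {H \<in> F. v \<in> H} > 0" using decomposition_pairD(1,2) [OF b that(1)] that(2) pos by auto
    then have "{H \<in> F. v \<in> H} \<noteq> {}" by (metis card.empty less_irrefl)
    then show ?thesis by blast
  qed
  have dec: "unique_decomposition G F F" if F: "F \<in> {?F0, ?F1}" for F
  proof (rule unique_decomposition_self [OF G cover [OF _ F]])
    show "\<exists>!H. H \<in> F \<and> e \<subseteq> H" if "e \<in> edges G" for e
      by (rule decomposition_pairD(3) [OF b that F])
    show "\<exists>e\<in>edges G. e \<subseteq> H" if "H \<in> F" for H
      by (rule decomposition_pairD(5) [OF b F that])
  qed
  have free: "(\<exists>H1\<in>?F1. H \<subseteq> H1) \<or> H \<in> ?F0" if "H \<in> copies G X0" for H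
    using that by (auto simp: free_copies_def)
  have sep: "\<forall>H\<in>F. \<forall>H'\<in>F. H \<noteq> H' \<longrightarrow> card (H \<inter> H') \<le> 1" if "F \<in> {?F0, ?F1}" for F
    using decomposition_pairD(6) [OF b that] by blast
  show ?thesis
    unfolding double_decomposition_def
    using free decomposition_pairD(1-4) [OF b] dec [of ?F0] dec [of ?F1] sep [of ?F0] sep [of ?F1] by simp
qed

lemma decomposition_pair_iso:
  assumes p: "graph_iso p M G" and sub: "F0 \<subseteq> Pow (verts M)" "F1 \<subseteq> Pow (verts M)"
    and simple: "finite_simple_graph M" "finite_simple_graph G" and b: "decomposition_pair M F0 F1 m0 m1"
  shows "decomposition_pair G ((`) p ` F0) ((`) p ` F1) m0 m1"
proof -
  note P = graph_isoD [OF p]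
  have inj: "inj_on ((`) p) (Pow (verts M))"
    by (rule inj_on_image_Pow [OF P(2)])
  have edges: "\<exists>d\<in>edges M. e = p ` d \<and> d \<subseteq> verts M" if e: "e \<in> edges G" for e
  proof -
    obtain u v where uv: "e = {u, v}" "u \<in> p ` verts M" "v \<in> p ` verts M"
      using e simple(2) unfolding finite_simple_graph_def P(3) by auto
    then obtain a b where ab: "a \<in> verts M" "b \<in> verts M" "u = p a" "v = p b"
      by (elim imageE)
    then have "{a, b} \<in> edges M" using e uv(1) P(5) [of a b] by simp
    then show ?thesis using ab uv(1) by (intro bexI [of _ "{a, b}"]) auto
  qed
  have edges': "p ` d \<in> edges G" if d: "d \<in> edges M" for d
  proof -
    obtain u v where "d = {u, v}" "u \<in> verts M" "v \<in> verts M"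
      using d simple(1) by (auto simp: finite_simple_graph_def)
    then show ?thesis using d P(5) [of u v] by simp
  qed
  have subs: "p ` d \<subseteq> p ` H \<longleftrightarrow> d \<subseteq> H" if "d \<subseteq> verts M" "H \<subseteq> verts M" for d H
    using inj_on_image_subset_iff [OF P(2)] that by blast
  have Int: "p ` H \<inter> p ` H' = p ` (H \<inter> H')" if "H \<subseteq> verts M" "H' \<subseteq> verts M" for H H'
    using inj_on_image_Int [OF P(2) that] by simp
  have through: "card {H \<in> (`) p ` F. p a \<in> H} = card {H \<in> F. a \<in> H}"
    if "F \<subseteq> Pow (verts M)" "a \<in> verts M" for F a
  proof -
    have "p a \<in> p ` H \<longleftrightarrow> a \<in> H" if "H \<in> F" for H
      using inj_on_image_mem_iff [OF P(2) \<open>a \<in> verts M\<close>] that \<open>F \<subseteq> Pow (verts M)\<close> by blast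
    then have "{H \<in> (`) p ` F. p a \<in> H} = (`) p ` {H \<in> F. a \<in> H}" by auto
    moreover have "inj_on ((`) p) {H \<in> F. a \<in> H}"
      by (rule inj_on_subset [OF inj]) (use that(1) in auto)
    ultimately show ?thesis by (simp add: card_image)
  qed
  have ex1: "\<exists>!H. H \<in> (`) p ` F \<and> p ` d \<subseteq> H" if "\<exists>!H. H \<in> F \<and> d \<subseteq> H" "d \<subseteq> verts M" "F \<subseteq> Pow (verts M)" for F d
    using that(1)
  proof (elim ex1E conjE)
    fix H assume H: "H \<in> F" "d \<subseteq> H" and uniq: "\<forall>H'. H' \<in> F \<and> d \<subseteq> H' \<longrightarrow> H' = H"
    show ?thesis
    proof (rule ex1I [of _ "p ` H"])
      fix K assume K: "K \<in> (`) p ` F \<and> p ` d \<subseteq> K"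
      then obtain L where L: "L \<in> F" "K = p ` L" by blast
      then have "d \<subseteq> L" using K subs [of d L] that(2,3) by auto
      then show "K = p ` H" using uniq L by simp
    qed (use H in auto)
  qed
  show ?thesis
    unfolding decomposition_pair_def
  proof (intro conjI ballI impI)
    fix v assume "v \<in> verts G"
    then obtain a where a: "a \<in> verts M" "v = p a" using P(3) by blast
    show "card {H \<in> (`) p ` F0. v \<in> H} = m0" "card {H \<in> (`) p ` F1. v \<in> H} = m1"
      using through sub a decomposition_pairD(1,2) [OF b] by simp_all
  next
    fix e assume "e \<in> edges G"
    then obtain d where d: "d \<in> edges M" "e = p ` d" "d \<subseteq> verts M" using edges by blast
    show "\<exists>!H. H \<in> (`) p ` F0 \<and> e \<subseteq> H" "\<exists>!H. H \<in> (`) p ` F1 \<and> e \<subseteq> H"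
      using ex1 [OF decomposition_pairD(3) [OF b d(1)] d(3)] sub d(2) by simp_all
    fix H0 H1 assume "H0 \<in> (`) p ` F0" "H1 \<in> (`) p ` F1" and eH: "e \<subseteq> H0 \<and> e \<subseteq> H1"
    then obtain L0 L1 where L: "L0 \<in> F0" "L1 \<in> F1" "H0 = p ` L0" "H1 = p ` L1" by blast
    have V: "L0 \<subseteq> verts M" "L1 \<subseteq> verts M" using L sub by blast+
    have "d \<subseteq> L0" "d \<subseteq> L1" using eH subs d V L by auto
    then have "d = L0 \<inter> L1" using decomposition_pairD(4) [OF b d(1)] L by simp
    then show "e = H0 \<inter> H1" using Int V L d by simp
  next
    fix F H assume F: "F \<in> {(`) p ` F0, (`) p ` F1}" and H: "H \<in> F"
    obtain E where E: "E \<in> {F0, F1}" "F = (`) p ` E" using F by blast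
    have EV: "E \<subseteq> Pow (verts M)" using E sub by blast
    obtain L where L: "L \<in> E" "H = p ` L" using H E by blast
    obtain d where "d \<in> edges M" "d \<subseteq> L" using decomposition_pairD(5) [OF b E(1) L(1)] by blast
    then show "\<exists>e\<in>edges G. e \<subseteq> H" using edges' L by blast
    fix H' assume H': "H' \<in> F" "H \<noteq> H'"
    then obtain L' where L': "L' \<in> E" "H' = p ` L'" "L \<noteq> L'" using E L by blast
    have V: "L \<subseteq> verts M" "L' \<subseteq> verts M" using EV L L' by blast+
    have "card (L \<inter> L') \<le> 1" by (rule decomposition_pairD(6) [OF b E(1) L(1) L'(1,3)])
    moreover have "card (p ` (L \<inter> L')) = card (L \<inter> L')"
      by (rule card_image [OF inj_on_subset [OF P(2)]]) (use V in blast)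
    ultimately show "card (H \<inter> H') \<le> 1" using Int [OF V] L L' by simp
  qed
qed

section \<open>Menger graphs and polarities\<close>

text \<open>Collinear points are adjacent because lines are cliques, and adjacent points are
  collinear because every edge lies in a line.\<close>

lemma eq_menger_graph:
  assumes G: "finite_simple_graph G" and F: "F \<subseteq> copies G (complete_graph n)"
    and e: "\<And>e. e \<in> edges G \<Longrightarrow> \<exists>H\<in>F. e \<subseteq> H"
  shows "G = menger_graph \<lparr>points = verts G, lines = F, incident = (\<in>)\<rparr>"
proof -
  have "edges G = {{p, q} | p q. p \<in> verts G \<and> q \<in> verts G \<and> p \<noteq> q \<and> (\<exists>l\<in>F. p \<in> l \<and> q \<in> l)}" (is "_ = ?R")
  proof (intro equalityI subsetI)
    fix d assume d: "d \<in> edges G"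
    then obtain u v where "d = {u, v}" "u \<in> verts G" "v \<in> verts G" "u \<noteq> v"
      using G by (auto simp: finite_simple_graph_def)
    then show "d \<in> ?R" using e [OF d] by auto
  next
    fix d assume "d \<in> ?R"
    then obtain u v l where "d = {u, v}" "u \<in> verts G" "v \<in> verts G" "u \<noteq> v" "l \<in> F" "u \<in> l" "v \<in> l"
      by blast
    moreover from this have "isomorphic (induced G l) (complete_graph n)" using F by (auto simp: copies_def)
    ultimately show "d \<in> edges G" by (auto simp: isomorphic_complete_graph_iff)
  qed
  then show ?thesis by (simp add: menger_graph_def)
qed

lemma configuration_copies:
  assumes G: "finite_simple_graph G" and F: "F \<subseteq> copies G (complete_graph d)"
    and m: "\<And>v. v \<in> verts G \<Longrightarrow> card {H \<in> F. v \<in> H} = m"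
  shows "configuration \<lparr>points = verts G, lines = F, incident = (\<in>)\<rparr> (card (verts G)) m (card F) d"
proof -
  have fin: "finite (verts G)" using G by (simp add: finite_simple_graph_def)
  have FP: "F \<subseteq> Pow (verts G)" using F copies_subset_Pow by blast
  have "finite F" by (rule finite_subset [OF FP]) (simp add: fin)
  moreover have "card {v \<in> verts G. v \<in> l} = d" if "l \<in> F" for l
  proof -
    have "{v \<in> verts G. v \<in> l} = l" using FP that by blast
    then show ?thesis using card_copies [of l G "complete_graph d"] F that by auto
  qed
  ultimately show ?thesis using fin m by (simp add: configuration_def)
qed

text \<open>Points go to lines by \<open>D\<close> and lines to points by its inverse; the symmetry
  of \<open>D\<close> is the preservation of incidence.\<close>

lemma self_dual_polarity:
  assumes D: "bij_betw D V F" and sym: "\<And>p q. p \<in> V \<Longrightarrow> q \<in> V \<Longrightarrow> p \<in> D q \<longleftrightarrow> q \<in> D p"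
  shows "self_dual \<lparr>points = V, lines = F, incident = (\<in>)\<rparr>"
proof -
  have "p \<in> l \<longleftrightarrow> inv_into V D l \<in> D p" if "p \<in> V" "l \<in> F" for p l
  proof -
    have "D (inv_into V D l) = l" "inv_into V D l \<in> V"
      using D that by (auto simp: bij_betw_def f_inv_into_f inv_into_into)
    then show ?thesis using sym that(1) by metis
  qed
  then show ?thesis
    using D bij_betw_inv_into [OF D]
    unfolding self_dual_def incidence_isomorphic_def dual_def
    by (intro exI [of _ D] exI [of _ "inv_into V D"]) auto
qed

text \<open>Points \<open>u\<close> and \<open>v\<close> lie on the line \<open>D q\<close> exactly
  when the lines \<open>D u\<close> and \<open>D v\<close> share the point \<open>q\<close>, so
  \<open>D\<close> itself is the isomorphism.\<close>

lemma menger_dual_polarity: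
  fixes V :: "'a set"
  assumes D: "bij_betw D V F" and sym: "\<And>p q. p \<in> V \<Longrightarrow> q \<in> V \<Longrightarrow> p \<in> D q \<longleftrightarrow> q \<in> D p"
    and S: "S = \<lparr>points = V, lines = F, incident = (\<in>)\<rparr>"
  shows "isomorphic (menger_graph S) (menger_graph (dual S))"
proof -
  have "{u, v} \<in> edges (menger_graph S) \<longleftrightarrow> {D u, D v} \<in> edges (menger_graph (dual S))"
    if uv: "u \<in> V" "v \<in> V" for u v
  proof -
    have "{u, v} \<in> edges (menger_graph S) \<longleftrightarrow> u \<noteq> v \<and> (\<exists>l\<in>F. u \<in> l \<and> v \<in> l)"
      using uv by (auto simp: menger_graph_def S doubleton_eq_iff)
    also have "(\<exists>l\<in>F. u \<in> l \<and> v \<in> l) \<longleftrightarrow> (\<exists>q\<in>V. u \<in> D q \<and> v \<in> D q)"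
      using bij_betw_imp_surj_on [OF D] by blast
    also have "\<dots> \<longleftrightarrow> (\<exists>q\<in>V. q \<in> D u \<and> q \<in> D v)" using sym uv by blast
    also have "u \<noteq> v \<longleftrightarrow> D u \<noteq> D v"
      using inj_on_eq_iff [OF bij_betw_imp_inj_on [OF D] uv] by simp
    also have "D u \<noteq> D v \<and> (\<exists>q\<in>V. q \<in> D u \<and> q \<in> D v) \<longleftrightarrow> {D u, D v} \<in> edges (menger_graph (dual S))"
      using uv bij_betwE [OF D] by (auto simp: menger_graph_def S dual_def doubleton_eq_iff)
    finally show ?thesis .
  qed
  then have "graph_iso D (menger_graph S) (menger_graph (dual S))"
    using D by (simp add: graph_iso_def menger_graph_def S dual_def)
  then show ?thesis by (rule isomorphicI)
qed

lemma polarity_iso: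
  assumes p: "graph_iso p M G" and F: "F \<subseteq> Pow (verts M)" and D: "bij_betw D (verts M) F"
    and sym: "\<And>u v. u \<in> verts M \<Longrightarrow> v \<in> verts M \<Longrightarrow> u \<in> D v \<longleftrightarrow> v \<in> D u"
  shows "\<exists>E. bij_betw E (verts G) ((`) p ` F) \<and> (\<forall>u\<in>verts G. \<forall>v\<in>verts G. u \<in> E v \<longleftrightarrow> v \<in> E u)"
proof -
  let ?q = "inv_into (verts M) p"
  note P = graph_isoD [OF p]
  have "bij_betw ((`) p) F ((`) p ` F)"
    by (rule bij_betw_imageI [OF inj_on_subset [OF inj_on_image_Pow [OF P(2)] F] refl])
  then have "bij_betw ((`) p \<circ> (D \<circ> ?q)) (verts G) ((`) p ` F)"
    by (rule bij_betw_trans [OF bij_betw_trans [OF bij_betw_inv_into [OF P(1)] D]])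
  moreover have "u \<in> ((`) p \<circ> (D \<circ> ?q)) v \<longleftrightarrow> v \<in> ((`) p \<circ> (D \<circ> ?q)) u"
    if uv: "u \<in> verts G" "v \<in> verts G" for u v
  proof -
    obtain a b where ab: "a \<in> verts M" "b \<in> verts M" "u = p a" "v = p b" using uv P(3) by blast
    have "D a \<subseteq> verts M" "D b \<subseteq> verts M" using bij_betwE [OF D] F ab by blast+
    then show ?thesis
      using ab sym [of a b] inj_on_image_mem_iff [OF P(2)] inv_into_f_f [OF P(2)] by simp
  qed
  ultimately show ?thesis by (intro exI [of _ "(`) p \<circ> (D \<circ> ?q)"] conjI ballI)
qed

section \<open>Lines and tees as copies\<close>

lemma madj_irrefl [simp]: "\<not> madj n r \<phi> \<phi>"
  using madj_neq by blast

lemma induced_mat_edge_iff: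
  assumes "Y \<subseteq> full_rank n r" "u \<in> Y" "v \<in> Y"
  shows "{u, v} \<in> edges (induced (mat_graph n r) Y) \<longleftrightarrow> madj n r u v"
  using assms edge_mat_graph_iff [of u n r v] by auto

lemma copies_mat_complete_iff:
  "Y \<in> copies (mat_graph n r) (complete_graph N) \<longleftrightarrow>
     Y \<subseteq> full_rank n r \<and> card Y = N \<and> (\<forall>u\<in>Y. \<forall>v\<in>Y. u \<noteq> v \<longrightarrow> madj n r u v)"
proof (cases "Y \<subseteq> full_rank n r")
  case True
  then have "verts (induced (mat_graph n r) Y) = Y" by auto
  moreover have "finite Y" using True finite_full_rank finite_subset by blast
  ultimately show ?thesis
    using True induced_mat_edge_iff [OF True]
    unfolding copies_def isomorphic_complete_graph_iff by auto
qed (simp add: copies_def)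

text \<open>This matches the order \<open>t * s\<close> of the multipartite graph with the size
  found in \<open>card_tee\<close>.\<close>

lemma pow_diff_eq: "0 < n \<Longrightarrow> n < r \<Longrightarrow> (2 ^ (r - n + 1) - 1) * 2 ^ (n - 1) = (2::nat) ^ r - 2 ^ (n - 1)"
proof -
  assume "0 < n" "n < r"
  then have "(2::nat) ^ (r - n + 1) * 2 ^ (n - 1) = 2 ^ r" unfolding power_add [symmetric] by simp
  then show ?thesis unfolding diff_mult_distrib by simp
qed

lemma mat_tees_subset: "X \<in> mat_tees n r \<Longrightarrow> X \<subseteq> full_rank n r"
  unfolding mat_tees_def by (elim CollectE exE conjE) (simp add: tee_subset)

lemma mat_lines_subset: "L \<in> mat_lines n r \<Longrightarrow> L \<subseteq> full_rank n r"
  unfolding mat_lines_def by (elim CollectE exE conjE) (simp add: line_subset)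

lemma tee_copy:
  assumes "X \<in> mat_tees n r" "0 < n" "n < r"
  shows "X \<in> copies (mat_graph n r) (complete_multipartite (2 ^ (r - n + 1) - 1) (2 ^ (n - 1)))"
proof -
  obtain \<phi> c where X: "X = tee n r \<phi> c" and \<phi>: "\<phi> \<in> full_rank n r" and c: "c \<in> space2 n" "c \<noteq> 0"
    using assms(1) by (auto simp: mat_tees_def)
  obtain p :: "(nat \<Rightarrow> vec2) \<Rightarrow> vec2 set" where
    p1: "\<And>\<psi> \<chi>. \<psi> \<in> X \<Longrightarrow> \<chi> \<in> X \<Longrightarrow> madj n r \<psi> \<chi> \<longleftrightarrow> p \<psi> \<noteq> p \<chi>" and
    p2: "\<And>\<psi>. \<psi> \<in> X \<Longrightarrow> card {\<chi> \<in> X. p \<chi> = p \<psi>} = 2 ^ (n - 1)"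
    unfolding X by (rule tee_parts [OF \<phi> c]) blast
  have sub: "X \<subseteq> full_rank n r" by (rule mat_tees_subset [OF assms(1)])
  have V: "verts (induced (mat_graph n r) X) = X" using sub by auto
  have card: "card X = (2 ^ (r - n + 1) - 1) * 2 ^ (n - 1)"
    unfolding X card_tee [OF \<phi> c] pow_diff_eq [OF assms(2,3)] ..
  have "isomorphic (induced (mat_graph n r) X) (complete_multipartite (2 ^ (r - n + 1) - 1) (2 ^ (n - 1)))"
  proof (rule isomorphic_complete_multipartiteI [where p = p], unfold V)
    show "finite X" using sub finite_full_rank finite_subset by blast
    show "{u, v} \<in> edges (induced (mat_graph n r) X) \<longleftrightarrow> p u \<noteq> p v" if "u \<in> X" "v \<in> X" for u v
      unfolding induced_mat_edge_iff [OF sub that] by (rule p1 [OF that])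
  qed (use card p2 in simp_all)
  then show ?thesis using sub by (intro copiesI) simp_all
qed

text \<open>A copy lies in a tee by the octahedron argument and fills it because the sizes agree.
  That argument needs three parts, which \<open>n < r\<close> gives, and two vertices in each, which
  \<open>2 \<le> n\<close> gives.\<close>

lemma copies_mat_multipartite:
  assumes n: "2 \<le> n" "n < r"
  shows "copies (mat_graph n r) (complete_multipartite (2 ^ (r - n + 1) - 1) (2 ^ (n - 1))) = mat_tees n r"
    (is "copies ?M ?T = _")
proof (intro equalityI subsetI)
  fix Y assume Y: "Y \<in> copies ?M ?T"
  then have sub: "Y \<subseteq> full_rank n r" and iso: "isomorphic (induced ?M Y) ?T" by (auto simp: copies_def)
  have V: "verts (induced ?M Y) = Y" using sub by auto
  have "(2::nat) ^ 2 \<le> 2 ^ (r - n + 1)" using n by (intro power_increasing) auto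
  then have t: "3 \<le> 2 ^ (r - n + 1) - (1::nat)" by simp
  have "(2::nat) ^ 1 \<le> 2 ^ (n - 1)" using n by (intro power_increasing) auto
  then have s: "2 \<le> (2::nat) ^ (n - 1)" by simp
  obtain p :: "(nat \<Rightarrow> vec2) \<Rightarrow> nat" where
    p: "\<And>u v. u \<in> Y \<Longrightarrow> v \<in> Y \<Longrightarrow> {u, v} \<in> edges (induced ?M Y) \<longleftrightarrow> p u \<noteq> p v"
      "\<And>i j. \<exists>u\<in>Y. p u \<noteq> i \<and> p u \<noteq> j"
      "\<And>u. u \<in> Y \<Longrightarrow> \<exists>v\<in>Y. p v = p u \<and> v \<noteq> u"
    by (rule isomorphic_complete_multipartiteD [OF iso t s, unfolded V]) blast
  have "\<exists>\<phi>\<in>Y. \<exists>c\<in>space2 n - {0}. Y \<subseteq> tee n r \<phi> c"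
  proof (rule multipartite_subset_tee [OF sub])
    show "madj n r u v \<longleftrightarrow> p u \<noteq> p v" if "u \<in> Y" "v \<in> Y" for u v
      using p(1) [OF that] induced_mat_edge_iff [OF sub that] by simp
  qed (use p(2,3) in auto)
  then obtain \<phi> c where \<phi>: "\<phi> \<in> Y" "c \<in> space2 n" "c \<noteq> 0" "Y \<subseteq> tee n r \<phi> c" by blast
  then have \<phi>FR: "\<phi> \<in> full_rank n r" using sub by blast
  have "card Y = card (tee n r \<phi> c)"
    using card_copies [OF Y] card_tee [OF \<phi>FR \<phi>(2,3)] pow_diff_eq [of n r] n by simp
  then have "Y = tee n r \<phi> c"
    using \<phi>(4) finite_subset [OF tee_subset finite_full_rank] by (simp add: card_subset_eq)
  then show "Y \<in> mat_tees n r" using \<phi> \<phi>FR by (auto simp: mat_tees_def)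
qed (use n tee_copy in simp)

text \<open>A line realises every column vector, a tee only one, and for \<open>2 \<le> n\<close>
  there are at least two nonzero ones.\<close>

lemma line_not_subset_tee:
  assumes L: "L \<in> mat_lines n r" and X: "X \<in> mat_tees n r" and n: "2 \<le> n"
  shows "\<not> L \<subseteq> X"
proof
  assume sub: "L \<subseteq> X"
  obtain \<phi> f where \<phi>: "L = line n \<phi> f" "f \<noteq> 0"
    using L not_row_spaceD by (auto simp: mat_lines_def)
  have "\<phi> \<in> X" using sub \<phi> line_self by blast
  then obtain c where c: "X = tee n r \<phi> c" by (rule mat_teesE [OF X])
  have *: "d = c" if d: "d \<in> space2 n" "d \<noteq> 0" for d
  proof -
    have "\<phi> + outer d f \<in> tee n r \<phi> c" using sub \<phi> c d by (auto simp: line_def)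
    then obtain g where "\<phi> + outer d f = \<phi> + outer c g" by (auto simp: tee_def)
    then have "outer d f = outer c g" by simp
    then show ?thesis using outer_eq_outer(1) d \<phi>(2) by blast
  qed
  have "unit2 0 = c" "unit2 1 = c" using n by (simp_all add: *)
  then have "unit2 0 0 = unit2 1 0" by simp
  then show False by (simp add: unit2_apply)
qed

text \<open>By \<open>clique_cases\<close> a clique lies in a line or in a tee. The latter are the
  ones that \<open>free_copies\<close> excludes; the former fill their line by size.\<close>

lemma free_copies_mat_complete:
  assumes n: "2 \<le> n" "n < r"
  shows "free_copies (mat_graph n r) (complete_graph (2 ^ n))
           (complete_multipartite (2 ^ (r - n + 1) - 1) (2 ^ (n - 1))) = mat_lines n r"
    (is "free_copies ?M ?K ?T = _")
proof (intro equalityI subsetI)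
  fix Y assume "Y \<in> free_copies ?M ?K ?T"
  then have Y: "Y \<subseteq> full_rank n r" "card Y = 2 ^ n" "\<And>u v. u \<in> Y \<Longrightarrow> v \<in> Y \<Longrightarrow> u \<noteq> v \<Longrightarrow> madj n r u v"
    and free: "\<And>X. X \<in> mat_tees n r \<Longrightarrow> \<not> Y \<subseteq> X"
    unfolding free_copies_def copies_mat_complete_iff copies_mat_multipartite [OF n] by auto
  have "(2::nat) ^ 1 \<le> 2 ^ n" using n by (intro power_increasing) auto
  then have "\<not> card Y \<le> Suc 0" using Y(2) by simp
  moreover have fin: "finite Y" using Y(1) finite_full_rank finite_subset by blast
  ultimately obtain \<phi> \<psi> where \<phi>: "\<phi> \<in> Y" "\<psi> \<in> Y" "\<psi> \<noteq> \<phi>" by (auto simp: card_le_Suc0_iff_eq)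
  have \<phi>FR: "\<phi> \<in> full_rank n r" using Y \<phi> by blast
  have "\<not> (\<exists>c\<in>space2 n - {0}. Y \<subseteq> tee n r \<phi> c)"
  proof
    assume "\<exists>c\<in>space2 n - {0}. Y \<subseteq> tee n r \<phi> c"
    then obtain c where "c \<in> space2 n" "c \<noteq> 0" "Y \<subseteq> tee n r \<phi> c" by blast
    moreover from this have "tee n r \<phi> c \<in> mat_tees n r" using \<phi>FR by (auto simp: mat_tees_def)
    ultimately show False using free by blast
  qed
  with clique_cases [OF Y(1,3) \<phi>] obtain f where f: "f \<in> space2 r" "f \<notin> row_space n \<phi>" "Y \<subseteq> line n \<phi> f"
    by auto
  have "card Y = card (line n \<phi> f)" using card_line [OF not_row_spaceD [OF f(2)]] Y(2) by simp
  then have "Y = line n \<phi> f"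
    using f(3) finite_subset [OF line_subset [OF \<phi>FR f(1,2)] finite_full_rank] by (simp add: card_subset_eq)
  then show "Y \<in> mat_lines n r" using f \<phi>FR by (auto simp: mat_lines_def)
next
  fix L assume L: "L \<in> mat_lines n r"
  then obtain \<phi> f where \<phi>: "L = line n \<phi> f" "\<phi> \<in> full_rank n r" "f \<in> space2 r" "f \<notin> row_space n \<phi>"
    by (auto simp: mat_lines_def)
  have "L \<in> copies ?M ?K"
    unfolding copies_mat_complete_iff \<phi>(1)
    using line_subset [OF \<phi>(2-4)] card_line [OF not_row_spaceD [OF \<phi>(4)]] madj_line [OF \<phi>(2-4)] by simp
  then show "L \<in> free_copies ?M ?K ?T"
    using line_not_subset_tee [OF L _ n(1)] unfolding free_copies_def copies_mat_multipartite [OF n] by simp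
qed

lemma decomposition_pair_mat_graph:
  assumes n: "0 < n" "n < r"
  shows "decomposition_pair (mat_graph n r) (mat_lines n r) (mat_tees n r) (2 ^ r - 2 ^ n) (2 ^ n - 1)"
proof -
  let ?L = "mat_lines n r" and ?X = "mat_tees n r"
  \<comment> \<open>Two members with two common points coincide. For an infinite intersection
    \<open>card\<close> is \<open>0\<close> by convention.\<close>
  have sep: "card (H \<inter> H') \<le> 1" if HH: "H \<noteq> H'"
    and un: "\<And>x y. x \<in> H \<Longrightarrow> y \<in> H \<Longrightarrow> x \<in> H' \<Longrightarrow> y \<in> H' \<Longrightarrow> x \<noteq> y \<Longrightarrow> H' = H"
    for H H' :: "(nat \<Rightarrow> vec2) set"
  proof (cases "finite (H \<inter> H')")
    case True
    then show ?thesis using HH un by (auto simp: card_le_Suc0_iff_eq)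
  qed simp
  have edge: "(\<exists>!H. H \<in> ?L \<and> e \<subseteq> H) \<and> (\<exists>!H. H \<in> ?X \<and> e \<subseteq> H) \<and>
        (\<forall>H0\<in>?L. \<forall>H1\<in>?X. e \<subseteq> H0 \<and> e \<subseteq> H1 \<longrightarrow> e = H0 \<inter> H1)" if e: "e \<in> edges (mat_graph n r)" for e
  proof -
    obtain \<phi> \<psi> where \<phi>: "e = {\<phi>, \<psi>}" "\<phi> \<in> full_rank n r" "madj n r \<phi> \<psi>" using e by (rule edge_mat_graphE)
    obtain c f where cf: "c \<in> space2 n" "c \<noteq> 0" "f \<in> space2 r" "f \<notin> row_space n \<phi>" "f \<noteq> 0" "\<psi> = \<phi> + outer c f"
      using \<phi>(3) by (rule madjE)
    have Int: "line n \<phi> f \<inter> tee n r \<phi> c = e"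
      using line_Int_tee [OF \<phi>(2) cf(1-4)] \<phi>(1) cf(6) by simp
    have L: "H = line n \<phi> f" if "H \<in> ?L" "e \<subseteq> H" for H
      using mat_lines_unique [OF that(1), of \<phi> c f] that(2) \<phi>(1) cf by simp
    have X: "H = tee n r \<phi> c" if "H \<in> ?X" "e \<subseteq> H" for H
      using mat_tees_unique [OF that(1), of \<phi> c f] that(2) \<phi>(1) cf by simp
    have mem: "line n \<phi> f \<in> ?L" "tee n r \<phi> c \<in> ?X"
      using \<phi> cf by (auto simp: mat_lines_def mat_tees_def)
    have sub: "e \<subseteq> line n \<phi> f" "e \<subseteq> tee n r \<phi> c" using Int by auto
    show ?thesis
    proof (intro conjI ballI impI)
      show "\<exists>!H. H \<in> ?L \<and> e \<subseteq> H" by (rule ex1I [of _ "line n \<phi> f"]) (simp_all add: mem sub L)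
      show "\<exists>!H. H \<in> ?X \<and> e \<subseteq> H" by (rule ex1I [of _ "tee n r \<phi> c"]) (simp_all add: mem sub X)
      fix H0 H1 assume "H0 \<in> ?L" "H1 \<in> ?X" "e \<subseteq> H0 \<and> e \<subseteq> H1"
      then show "e = H0 \<inter> H1" using L X Int by simp
    qed
  qed
  have Lsep: "card (H \<inter> H') \<le> 1" if H: "H \<in> ?L" "H' \<in> ?L" "H \<noteq> H'" for H H'
  proof (rule sep [OF H(3)])
    fix x y assume xy: "x \<in> H" "y \<in> H" "x \<in> H'" "y \<in> H'" "x \<noteq> y"
    obtain f where f: "f \<notin> row_space n x" "H = line n x f" using H(1) xy(1) by (rule mat_linesE)
    obtain c where c: "y = x + outer c f" using xy(2) f(2) by (auto simp: line_def)
    then have "c \<noteq> 0" using xy(5) by auto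
    then show "H' = H" using mat_lines_unique [OF H(2) xy(3)] xy(4) c not_row_spaceD [OF f(1)] f(2) by simp
  qed
  have Xsep: "card (H \<inter> H') \<le> 1" if H: "H \<in> ?X" "H' \<in> ?X" "H \<noteq> H'" for H H'
  proof (rule sep [OF H(3)])
    fix x y assume xy: "x \<in> H" "y \<in> H" "x \<in> H'" "y \<in> H'" "x \<noteq> y"
    obtain c where c: "c \<noteq> 0" "H = tee n r x c" using H(1) xy(1) by (rule mat_teesE)
    obtain f where f: "y = x + outer c f" using xy(2) c(2) by (auto simp: tee_def)
    then have "f \<noteq> 0" using xy(5) by auto
    then show "H' = H" using mat_tees_unique [OF H(2) xy(3)] xy(4) f c by simp
  qed
  have Ledge: "\<exists>e\<in>edges (mat_graph n r). e \<subseteq> H" if H: "H \<in> ?L" for H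
  proof -
    obtain \<phi> f where \<phi>: "H = line n \<phi> f" "\<phi> \<in> full_rank n r" "f \<in> space2 r" "f \<notin> row_space n \<phi>"
      using H by (auto simp: mat_lines_def)
    let ?\<psi> = "\<phi> + outer (unit2 0) f"
    have u: "unit2 0 \<in> space2 n" using n by simp
    have "?\<psi> \<in> full_rank n r" by (rule full_rank_add_outer [OF \<phi>(2) u \<phi>(3,4)])
    moreover have "madj n r \<phi> ?\<psi>" using u \<phi> unfolding madj_def by (metis unit2_neq_0)
    moreover have "{\<phi>, ?\<psi>} \<subseteq> H" using u \<phi>(1) line_self by (auto simp: line_def)
    ultimately show ?thesis using edge_mat_graph_iff [OF \<phi>(2)] by blast
  qed
  have Xedge: "\<exists>e\<in>edges (mat_graph n r). e \<subseteq> H" if H: "H \<in> ?X" for H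
  proof -
    obtain \<phi> c where \<phi>: "H = tee n r \<phi> c" "\<phi> \<in> full_rank n r" "c \<in> space2 n" "c \<noteq> 0"
      using H by (auto simp: mat_tees_def)
    obtain f where f: "f \<in> space2 r" "f \<notin> row_space n \<phi>"
      using exists_not_in_row_space [OF \<phi>(2) n(2)] by blast
    let ?\<psi> = "\<phi> + outer c f"
    have FR: "?\<psi> \<in> full_rank n r" by (rule full_rank_add_outer [OF \<phi>(2,3) f])
    moreover have "madj n r \<phi> ?\<psi>" using \<phi> f unfolding madj_def by blast
    moreover have "{\<phi>, ?\<psi>} \<subseteq> H" using line_Int_tee [OF \<phi>(2-4) f] \<phi>(1) by auto
    ultimately show ?thesis using edge_mat_graph_iff [OF \<phi>(2)] by blast
  qed
  show ?thesis
    unfolding decomposition_pair_def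
  proof (intro conjI)
    show "\<forall>v\<in>verts (mat_graph n r). card {H \<in> ?L. v \<in> H} = 2 ^ r - 2 ^ n \<and> card {H \<in> ?X. v \<in> H} = 2 ^ n - 1"
      using card_mat_lines_through card_mat_tees_through n by simp
  qed (use edge Ledge Xedge Lsep Xsep in simp_all)
qed

section \<open>Automorphisms\<close>

text \<open>Multiplication from the right: a linear change of coordinates in the ambient space. The
  map is kept as a function because \<open>frame_transport\<close> produces one.\<close>

definition row_act :: "(vec2 \<Rightarrow> vec2) \<Rightarrow> (nat \<Rightarrow> vec2) \<Rightarrow> nat \<Rightarrow> vec2" where
  "row_act A \<phi> = (\<lambda>i. A (\<phi> i))"

text \<open>Multiplication from the left: a linear relabelling of the classes.\<close>

definition col_act :: "(vec2 \<Rightarrow> vec2) \<Rightarrow> (nat \<Rightarrow> vec2) \<Rightarrow> nat \<Rightarrow> vec2" where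
  "col_act B \<phi> = (\<lambda>i j. B (\<lambda>k. \<phi> k j) i)"

definition lin_bij :: "nat \<Rightarrow> (vec2 \<Rightarrow> vec2) \<Rightarrow> bool" where
  "lin_bij n A \<longleftrightarrow> additive_on (space2 n) A \<and> bij_betw A (space2 n) (space2 n)"

lemma lin_bijD:
  assumes "lin_bij n A"
  shows "x \<in> space2 n \<Longrightarrow> y \<in> space2 n \<Longrightarrow> A (x + y) = A x + A y" "A 0 = 0"
    "x \<in> space2 n \<Longrightarrow> A x \<in> space2 n" "x \<in> space2 n \<Longrightarrow> y \<in> space2 n \<Longrightarrow> A x = A y \<longleftrightarrow> x = y"
    "x \<in> space2 n \<Longrightarrow> A (scale2 b x) = scale2 b (A x)" "A ` space2 n = space2 n"
proof -
  have A: "additive_on (space2 n) A" "bij_betw A (space2 n) (space2 n)"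
    using assms by (simp_all add: lin_bij_def)
  show A0: "A 0 = 0" by (rule additive_on_0 [OF A(1) space2_0])
  show "x \<in> space2 n \<Longrightarrow> y \<in> space2 n \<Longrightarrow> A (x + y) = A x + A y" using A(1) by (simp add: additive_on_def)
  show "x \<in> space2 n \<Longrightarrow> A x \<in> space2 n" using bij_betwE [OF A(2)] by blast
  show "x \<in> space2 n \<Longrightarrow> y \<in> space2 n \<Longrightarrow> A x = A y \<longleftrightarrow> x = y"
    by (rule inj_on_eq_iff [OF bij_betw_imp_inj_on [OF A(2)]])
  show "A (scale2 b x) = scale2 b (A x)" by (cases b) (simp_all add: A0)
  show "A ` space2 n = space2 n" by (rule bij_betw_imp_surj_on [OF A(2)])
qed

lemma lin_bij_inverse:
  assumes A: "lin_bij n A"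
  obtains A' where "lin_bij n A'" "\<And>x. x \<in> space2 n \<Longrightarrow> A' (A x) = x" "\<And>x. x \<in> space2 n \<Longrightarrow> A (A' x) = x"
proof -
  let ?A' = "inv_into (space2 n) A"
  have bij: "bij_betw A (space2 n) (space2 n)" using A by (simp add: lin_bij_def)
  have bij': "bij_betw ?A' (space2 n) (space2 n)" by (rule bij_betw_inv_into [OF bij])
  have inv: "?A' (A x) = x" "A (?A' x) = x" if "x \<in> space2 n" for x
    using that bij_betw_inv_into_left [OF bij that] bij_betw_inv_into_right [OF bij that] by simp_all
  have "?A' (x + y) = ?A' x + ?A' y" if xy: "x \<in> space2 n" "y \<in> space2 n" for x y
  proof -
    have *: "?A' x \<in> space2 n" "?A' y \<in> space2 n" using bij_betwE [OF bij'] xy by simp_all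
    have "?A' (x + y) = ?A' (A (?A' x + ?A' y))" using lin_bijD(1) [OF A *] inv xy by simp
    also have "\<dots> = ?A' x + ?A' y" by (rule inv(1)) (simp add: *)
    finally show ?thesis .
  qed
  then have "lin_bij n ?A'" using bij' by (simp add: lin_bij_def additive_on_def)
  then show ?thesis using inv by (intro that)
qed

lemma automorphism_matI:
  assumes h: "\<And>\<phi>. \<phi> \<in> full_rank n r \<Longrightarrow> h \<phi> \<in> full_rank n r \<and> g (h \<phi>) = \<phi>"
    and g: "\<And>\<phi>. \<phi> \<in> full_rank n r \<Longrightarrow> g \<phi> \<in> full_rank n r \<and> h (g \<phi>) = \<phi>"
    and adj: "\<And>\<phi> \<psi>. \<phi> \<in> full_rank n r \<Longrightarrow> madj n r \<phi> \<psi> \<Longrightarrow> madj n r (h \<phi>) (h \<psi>) \<and> madj n r (g \<phi>) (g \<psi>)"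
  shows "automorphism (mat_graph n r) h"
proof -
  have "bij_betw h (full_rank n r) (full_rank n r)"
    by (rule bij_betw_byWitness [where f' = g]) (use h g in auto)
  moreover have "madj n r (h \<phi>) (h \<psi>) \<longleftrightarrow> madj n r \<phi> \<psi>"
    if "\<phi> \<in> full_rank n r" "\<psi> \<in> full_rank n r" for \<phi> \<psi>
  proof
    assume "madj n r (h \<phi>) (h \<psi>)"
    then have "madj n r (g (h \<phi>)) (g (h \<psi>))" using adj h that(1) by blast
    then show "madj n r \<phi> \<psi>" using h that by simp
  qed (use adj that in blast)
  ultimately show ?thesis
    using h by (simp add: graph_iso_def edge_mat_graph_iff)
qed

lemma lin_bij_comb:
  assumes "lin_bij r A" "\<And>i. \<phi> i \<in> space2 r"
  shows "A (comb n a \<phi>) = comb n a (row_act A \<phi>)"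
proof (induction n)
  case 0
  then show ?case by (simp only: comb_def lessThan_0 sum.empty lin_bijD(2) [OF assms(1)])
next
  case (Suc n)
  have "comb n a \<phi> \<in> space2 r" using assms(2) by (simp add: comb_space2)
  then have "A (comb (Suc n) a \<phi>) = A (comb n a \<phi>) + A (scale2 (a n) (\<phi> n))"
    unfolding comb_Suc by (rule lin_bijD(1) [OF assms(1) _ space2_scale [OF assms(2)]])
  also have "\<dots> = comb (Suc n) a (row_act A \<phi>)"
    unfolding comb_Suc Suc lin_bijD(5) [OF assms(1) assms(2)] by (simp add: row_act_def)
  finally show ?case .
qed

lemma row_act_add_outer:
  assumes A: "lin_bij r A" and \<phi>: "\<phi> \<in> full_rank n r" and f: "f \<in> space2 r"
  shows "row_act A (\<phi> + outer c f) = row_act A \<phi> + outer c (A f)"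
proof
  fix i
  show "row_act A (\<phi> + outer c f) i = (row_act A \<phi> + outer c (A f)) i"
    using lin_bijD(1) [OF A full_rankD(1) [OF \<phi>, of i] space2_scale [OF f]] lin_bijD(5) [OF A f]
    by (simp add: row_act_def)
qed

lemma row_act_full_rank:
  assumes A: "lin_bij r A" and \<phi>: "\<phi> \<in> full_rank n r"
  shows "row_act A \<phi> \<in> full_rank n r"
proof (rule full_rankI)
  note comb = lin_bij_comb [OF A full_rankD(1) [OF \<phi>]]
  show "row_act A \<phi> i \<in> space2 r" for i
    using lin_bijD(3) [OF A full_rankD(1) [OF \<phi>]] by (simp add: row_act_def)
  show "row_act A \<phi> i = 0" if "i \<ge> n" for i
    using full_rankD(2) [OF \<phi> that] lin_bijD(2) [OF A] by (simp add: row_act_def)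
  fix a assume a: "a \<in> space2 n" "comb n a (row_act A \<phi>) = 0"
  then have "A (comb n a \<phi>) = A 0" using comb [of n a] lin_bijD(2) [OF A] by simp
  then have "comb n a \<phi> = 0" using lin_bijD(4) [OF A comb_full_rank [OF \<phi>] space2_0] by simp
  then show "a = 0" by (rule full_rankD(3) [OF \<phi> a(1)])
qed

lemma row_act_madj:
  assumes A: "lin_bij r A" and \<phi>: "\<phi> \<in> full_rank n r" and adj: "madj n r \<phi> \<psi>"
  shows "madj n r (row_act A \<phi>) (row_act A \<psi>)"
  using adj
proof (rule madjE)
  fix c f assume cf: "c \<in> space2 n" "c \<noteq> 0" "f \<in> space2 r" "f \<notin> row_space n \<phi>" "\<psi> = \<phi> + outer c f"
  have "A f \<notin> row_space n (row_act A \<phi>)"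
  proof
    assume "A f \<in> row_space n (row_act A \<phi>)"
    then obtain a where a: "a \<in> space2 n" "A f = comb n a (row_act A \<phi>)" by (auto simp: row_space_def)
    then have "A f = A (comb n a \<phi>)" using lin_bij_comb [OF A full_rankD(1) [OF \<phi>]] by simp
    then have "f = comb n a \<phi>" using lin_bijD(4) [OF A cf(3) comb_full_rank [OF \<phi>]] by simp
    then show False using a(1) cf(4) by (auto simp: row_space_def)
  qed
  then show ?thesis
    using row_act_add_outer [OF A \<phi> cf(3), of c] cf lin_bijD(3) [OF A cf(3)] unfolding madj_def by blast
qed

lemma row_act_automorphism:
  assumes A: "lin_bij r A"
  shows "automorphism (mat_graph n r) (row_act A)"
proof -
  obtain A' where A': "lin_bij r A'" "\<And>x. x \<in> space2 r \<Longrightarrow> A' (A x) = x" "\<And>x. x \<in> space2 r \<Longrightarrow> A (A' x) = x"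
    by (rule lin_bij_inverse [OF A]) blast
  show ?thesis
  proof (rule automorphism_matI [where g = "row_act A'"])
    fix \<phi> assume \<phi>: "\<phi> \<in> full_rank n r"
    show "row_act A \<phi> \<in> full_rank n r \<and> row_act A' (row_act A \<phi>) = \<phi>"
      using row_act_full_rank [OF A \<phi>] A'(2) full_rankD(1) [OF \<phi>] by (simp add: row_act_def)
    show "row_act A' \<phi> \<in> full_rank n r \<and> row_act A (row_act A' \<phi>) = \<phi>"
      using row_act_full_rank [OF A'(1) \<phi>] A'(3) full_rankD(1) [OF \<phi>] by (simp add: row_act_def)
    show "madj n r (row_act A \<phi>) (row_act A \<psi>) \<and> madj n r (row_act A' \<phi>) (row_act A' \<psi>)"
      if "madj n r \<phi> \<psi>" for \<psi>
      using row_act_madj [OF A \<phi> that] row_act_madj [OF A'(1) \<phi> that] by blast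
  qed
qed

lemma column_space2: "\<phi> \<in> full_rank n r \<Longrightarrow> (\<lambda>k. \<phi> k j) \<in> space2 n"
  using full_rankD(2) by (auto simp: space2_def)

lemma col_act_add_outer:
  assumes B: "lin_bij n B" and \<phi>: "\<phi> \<in> full_rank n r" and c: "c \<in> space2 n"
  shows "col_act B (\<phi> + outer c f) = col_act B \<phi> + outer (B c) f"
proof (intro ext)
  fix i j
  have "(\<lambda>k. (\<phi> + outer c f) k j) = (\<lambda>k. \<phi> k j) + scale2 (f j) c"
    by (rule ext) (simp add: mult.commute [of "f j"])
  then have "B (\<lambda>k. (\<phi> + outer c f) k j) = B (\<lambda>k. \<phi> k j) + scale2 (f j) (B c)"
    using lin_bijD(1) [OF B column_space2 [OF \<phi>] space2_scale [OF c]] lin_bijD(5) [OF B c] by simp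
  then show "col_act B (\<phi> + outer c f) i j = (col_act B \<phi> + outer (B c) f) i j"
    by (simp add: col_act_def mult.commute)
qed

text \<open>Here \<open>b\<close> is the transpose of \<open>B\<close> applied to \<open>a\<close>,
  obtained as the vector that represents the functional.\<close>

lemma comb_col_act:
  assumes B: "lin_bij n B" and \<phi>: "\<phi> \<in> full_rank n r"
  obtains b where "b \<in> space2 n" "comb n a (col_act B \<phi>) = comb n b \<phi>"
    "\<And>c. c \<in> space2 n \<Longrightarrow> dot n a (B c) = dot n b c"
proof -
  have "additive_on (space2 n) (\<lambda>c. dot n a (B c))"
    using lin_bijD(1) [OF B] by (simp add: additive_on_def)
  then obtain b where b: "b \<in> space2 n" "\<And>c. c \<in> space2 n \<Longrightarrow> dot n a (B c) = dot n b c"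
    by (rule additive_functional) blast
  have "comb n a (col_act B \<phi>) j = comb n b \<phi> j" for j
    using b(2) [OF column_space2 [OF \<phi>, of j]] by (simp add: comb_apply dot_def col_act_def)
  then show ?thesis using b by (intro that) auto
qed

text \<open>Relabelling does not enlarge the row space, so a direction \<open>f\<close> outside it
  remains available.\<close>

lemma col_act_row_space:
  assumes B: "lin_bij n B" and \<phi>: "\<phi> \<in> full_rank n r"
  shows "row_space n (col_act B \<phi>) \<subseteq> row_space n \<phi>"
proof
  fix x assume "x \<in> row_space n (col_act B \<phi>)"
  then obtain a where "x = comb n a (col_act B \<phi>)" by (auto simp: row_space_def)
  moreover obtain b where "b \<in> space2 n" "comb n a (col_act B \<phi>) = comb n b \<phi>" by (rule comb_col_act [OF B \<phi>])
  ultimately show "x \<in> row_space n \<phi>" by (simp add: row_space_def)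
qed

lemma col_act_full_rank:
  assumes B: "lin_bij n B" and \<phi>: "\<phi> \<in> full_rank n r"
  shows "col_act B \<phi> \<in> full_rank n r"
proof (rule full_rankI)
  show "col_act B \<phi> i \<in> space2 r" for i
    unfolding space2_def
  proof (intro CollectI allI impI)
    fix j assume "j \<ge> r"
    then have "(\<lambda>k. \<phi> k j) = 0" using full_rankD(1) [OF \<phi>] by (simp add: space2_def fun_eq_iff)
    then show "col_act B \<phi> i j = 0" using lin_bijD(2) [OF B] by (simp add: col_act_def)
  qed
  show "col_act B \<phi> i = 0" if "i \<ge> n" for i
  proof
    fix j
    show "col_act B \<phi> i j = 0 j"
      using lin_bijD(3) [OF B column_space2 [OF \<phi>, of j]] that by (simp add: col_act_def space2_def)
  qed
  fix a assume a: "a \<in> space2 n" "comb n a (col_act B \<phi>) = 0"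
  obtain b where b: "b \<in> space2 n" "comb n a (col_act B \<phi>) = comb n b \<phi>"
    "\<And>c. c \<in> space2 n \<Longrightarrow> dot n a (B c) = dot n b c" by (rule comb_col_act [OF B \<phi>]) blast
  have b0: "b = 0" using full_rankD(3) [OF \<phi> b(1)] b(2) a(2) by simp
  show "a = 0"
  proof (rule dot_nondegenerate [OF a(1)])
    fix y assume "y \<in> space2 n"
    then obtain c where "c \<in> space2 n" "y = B c" using lin_bijD(6) [OF B] by blast
    then show "dot n y a = 0" using b(3) b0 by (simp add: dot_commute [of n _ a])
  qed
qed

lemma col_act_madj:
  assumes B: "lin_bij n B" and \<phi>: "\<phi> \<in> full_rank n r" and adj: "madj n r \<phi> \<psi>"
  shows "madj n r (col_act B \<phi>) (col_act B \<psi>)"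
  using adj
proof (rule madjE)
  fix c f assume cf: "c \<in> space2 n" "c \<noteq> 0" "f \<in> space2 r" "f \<notin> row_space n \<phi>" "\<psi> = \<phi> + outer c f"
  have "B c \<noteq> 0" using lin_bijD(4) [OF B cf(1) space2_0] lin_bijD(2) [OF B] cf(2) by simp
  moreover have "f \<notin> row_space n (col_act B \<phi>)" using col_act_row_space [OF B \<phi>] cf(4) by blast
  ultimately show ?thesis
    using col_act_add_outer [OF B \<phi> cf(1), of f] cf lin_bijD(3) [OF B cf(1)] unfolding madj_def by blast
qed

lemma col_act_automorphism:
  assumes B: "lin_bij n B"
  shows "automorphism (mat_graph n r) (col_act B)"
proof -
  obtain B' where B': "lin_bij n B'" "\<And>x. x \<in> space2 n \<Longrightarrow> B' (B x) = x" "\<And>x. x \<in> space2 n \<Longrightarrow> B (B' x) = x"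
    by (rule lin_bij_inverse [OF B]) blast
  show ?thesis
  proof (rule automorphism_matI [where g = "col_act B'"])
    fix \<phi> assume \<phi>: "\<phi> \<in> full_rank n r"
    show "col_act B \<phi> \<in> full_rank n r \<and> col_act B' (col_act B \<phi>) = \<phi>"
      using col_act_full_rank [OF B \<phi>] B'(2) [OF column_space2 [OF \<phi>]] by (simp add: col_act_def)
    show "col_act B' \<phi> \<in> full_rank n r \<and> col_act B (col_act B' \<phi>) = \<phi>"
      using col_act_full_rank [OF B'(1) \<phi>] B'(3) [OF column_space2 [OF \<phi>]] by (simp add: col_act_def)
    show "madj n r (col_act B \<phi>) (col_act B \<psi>) \<and> madj n r (col_act B' \<phi>) (col_act B' \<psi>)"
      if "madj n r \<phi> \<psi>" for \<psi>
      using col_act_madj [OF B \<phi> that] col_act_madj [OF B'(1) \<phi> that] by blast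
  qed
qed

text \<open>The column operation \<open>B\<close> sets the column factors. The rows of the resulting
  matrix together with \<open>f\<close> form a frame of \<open>Suc n\<close> vectors, and a row
  operation moves it to the frame formed by \<open>\<psi>\<close> and \<open>g\<close>.\<close>

lemma line_transport:
  assumes \<phi>: "\<phi> \<in> full_rank n r" "f \<in> space2 r" "f \<notin> row_space n \<phi>"
    and \<psi>: "\<psi> \<in> full_rank n r" "g \<in> space2 r" "g \<notin> row_space n \<psi>"
    and B: "lin_bij n B"
  obtains h where "automorphism (mat_graph n r) h"
    "\<And>c. c \<in> space2 n \<Longrightarrow> h (\<phi> + outer c f) = \<psi> + outer (B c) g"
proof -
  define \<chi> where "\<chi> = col_act B \<phi>"
  have \<chi>: "\<chi> \<in> full_rank n r" unfolding \<chi>_def by (rule col_act_full_rank [OF B \<phi>(1)])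
  have f: "f \<notin> row_space n \<chi>" unfolding \<chi>_def using col_act_row_space [OF B \<phi>(1)] \<phi>(3) by blast
  obtain A where A0: "additive_on (space2 r) A" "bij_betw A (space2 r) (space2 r)"
    and A1: "\<forall>i<Suc n. A ((\<chi>(n := f)) i) = (\<psi>(n := g)) i"
    using frame_transport [OF full_rank_stack [OF \<chi> \<phi>(2) f] full_rank_stack [OF \<psi>]] by blast
  have A: "lin_bij r A" using A0 by (simp add: lin_bij_def)
  have Af: "A f = g" using A1 [rule_format, of n] by simp
  have "row_act A \<chi> i = \<psi> i" for i
    using A1 [rule_format, of i] full_rankD(2) [OF \<chi>, of i] full_rankD(2) [OF \<psi>(1), of i] lin_bijD(2) [OF A]
    by (cases "i < n") (simp_all add: row_act_def)
  then have A\<chi>: "row_act A \<chi> = \<psi>" by (rule ext)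
  show ?thesis
  proof (rule that [of "row_act A \<circ> col_act B"])
    show "automorphism (mat_graph n r) (row_act A \<circ> col_act B)"
      by (rule graph_iso_comp [OF col_act_automorphism [OF B] row_act_automorphism [OF A]])
    fix c assume c: "c \<in> space2 n"
    show "(row_act A \<circ> col_act B) (\<phi> + outer c f) = \<psi> + outer (B c) g"
      using col_act_add_outer [OF B \<phi>(1) c, of f] row_act_add_outer [OF A \<chi> \<phi>(2), of "B c"] Af A\<chi>
      by (simp add: \<chi>_def)
  qed
qed

text \<open>A single nonzero vector is a frame with one row, stacked on the empty matrix.\<close>

lemma lin_bij_vector:
  assumes "c \<in> space2 n" "c \<noteq> 0" "d \<in> space2 n" "d \<noteq> 0"
  obtains B where "lin_bij n B" "B c = d"
proof -
  have 0: "(0 :: nat \<Rightarrow> vec2) \<in> full_rank 0 n"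
    by (rule full_rankI) (auto simp: space2_def)
  have "x = 0" if "x \<in> row_space 0 (0 :: nat \<Rightarrow> vec2)" for x
    using that unfolding row_space_def comb_def lessThan_0 sum.empty by (elim imageE)
  then have rs: "row_space 0 (0 :: nat \<Rightarrow> vec2) = {0}" using row_space_0 by blast
  have "0(0 := x) \<in> full_rank (Suc 0) n" if "x \<in> space2 n" "x \<noteq> 0" for x
    by (rule full_rank_stack [OF 0 that(1)]) (simp add: rs that(2))
  then obtain B where B: "additive_on (space2 n) B" "bij_betw B (space2 n) (space2 n)"
    "\<forall>i<Suc 0. B ((0(0 := c)) i) = (0(0 := d)) i"
    using frame_transport [of "0(0 := c)" "Suc 0" n "0(0 := d)"] assms by blast
  show ?thesis by (rule that [of B]) (use B in \<open>simp_all add: lin_bij_def\<close>)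
qed

section \<open>Homogeneity, and ultrahomogeneity for lines of four points\<close>

lemma automorphism_image_free_copies:
  "automorphism M h \<Longrightarrow> Y \<in> free_copies M X0 X1 \<Longrightarrow> h ` Y \<in> free_copies M X0 X1"
  using free_copies_iso_eq [of h M M X0 X1] by blast

lemma automorphism_image_mat_lines:
  assumes "2 \<le> n" "n < r" "automorphism (mat_graph n r) h" "L \<in> mat_lines n r"
  shows "h ` L \<in> mat_lines n r"
  using automorphism_image_free_copies [OF assms(3)] assms(4)
  unfolding free_copies_mat_complete [OF assms(1,2), symmetric] by blast

lemma automorphism_image_mat_tees:
  assumes "2 \<le> n" "n < r" "automorphism (mat_graph n r) h" "X \<in> mat_tees n r"
  shows "h ` X \<in> mat_tees n r"
  using image_copies_subset [OF assms(3)] assms(4)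
  unfolding copies_mat_multipartite [OF assms(1,2), symmetric] by blast

lemma homogeneous_mat_graph:
  assumes n: "2 \<le> n" "n < r"
  shows "homogeneous_wrt (mat_graph n r) (mat_lines n r \<union> mat_tees n r)"
  unfolding homogeneous_wrt_def
proof (intro ballI impI, clarify)
  let ?M = "mat_graph n r"
  fix Y1 Y2 v1 w1 v2 w2
  assume Y: "Y1 \<in> mat_lines n r \<union> mat_tees n r" "Y2 \<in> mat_lines n r \<union> mat_tees n r"
    and iso: "isomorphic (induced ?M Y1) (induced ?M Y2)"
    and a1: "(v1, w1) \<in> arcs (induced ?M Y1)" and a2: "(v2, w2) \<in> arcs (induced ?M Y2)"
  have sub: "Y \<subseteq> full_rank n r" if "Y \<in> mat_lines n r \<union> mat_tees n r" for Y
    using that mat_lines_subset mat_tees_subset by blast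
  have card_eq: "card Y1 = card Y2"
    using isomorphic_card_verts [OF iso] sub [OF Y(1)] sub [OF Y(2)] by (simp add: Int_absorb1)
  have cL: "card Y = 2 ^ n" if "Y \<in> mat_lines n r" for Y
    using that card_line not_row_spaceD by (auto simp: mat_lines_def)
  have cT: "card Y = 2 ^ r - 2 ^ (n - 1)" if "Y \<in> mat_tees n r" for Y
    using that card_tee by (auto simp: mat_tees_def)
  \<comment> \<open>Lines and tees have different sizes, so isomorphic members belong to the same
    family.\<close>
  have "(2::nat) ^ n + 2 ^ (n - 1) < 2 ^ n + 2 ^ n" using n by simp
  also have "\<dots> = 2 ^ Suc n" by simp
  also have "\<dots> \<le> 2 ^ r" using n by (intro power_increasing) auto
  finally have ne: "(2::nat) ^ n \<noteq> 2 ^ r - 2 ^ (n - 1)" by simp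
  define F where "F = (if Y1 \<in> mat_lines n r then mat_lines n r else mat_tees n r)"
  have F: "Y1 \<in> F" "Y2 \<in> F"
    using Y card_eq cL [of Y1] cT [of Y1] cL [of Y2] cT [of Y2] ne by (auto simp: F_def)
  have arcsD: "v \<in> full_rank n r \<and> w \<in> full_rank n r \<and> v \<in> Y \<and> w \<in> Y \<and> madj n r v w"
    if "(v, w) \<in> arcs (induced ?M Y)" for v w Y
    using that edge_mat_graph_iff [of v n r w] by (auto simp: arcs_def)
  note a1 = arcsD [OF a1] and a2 = arcsD [OF a2]
  obtain c f where cf: "c \<in> space2 n" "c \<noteq> 0" "f \<in> space2 r" "f \<notin> row_space n v1" "w1 = v1 + outer c f"
    using a1 by (auto elim: madjE)
  obtain d g where dg: "d \<in> space2 n" "d \<noteq> 0" "g \<in> space2 r" "g \<notin> row_space n v2" "w2 = v2 + outer d g"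
    using a2 by (auto elim: madjE)
  obtain B where B: "lin_bij n B" "B c = d" by (rule lin_bij_vector [OF cf(1,2) dg(1,2)])
  obtain h where h: "automorphism ?M h" "\<And>c. c \<in> space2 n \<Longrightarrow> h (v1 + outer c f) = v2 + outer (B c) g"
    using line_transport [OF _ cf(3,4) _ dg(3,4) B(1)] a1 a2 by blast
  have hv: "h v1 = v2" using h(2) [OF space2_0] lin_bijD(2) [OF B(1)] by simp
  have hw: "h w1 = w2" using h(2) [OF cf(1)] B(2) cf(5) dg(5) by simp
  \<comment> \<open>An edge lies in exactly one member of \<open>F\<close>, so an automorphism that
    moves the arc correctly also moves the member correctly.\<close>
  have "{v2, w2} \<in> edges ?M" using a2 edge_mat_graph_iff by blast
  moreover have "F \<in> {mat_lines n r, mat_tees n r}" by (simp add: F_def)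
  ultimately have "\<exists>!H. H \<in> F \<and> {v2, w2} \<subseteq> H"
    using n by (intro decomposition_pairD(3) [OF decomposition_pair_mat_graph]) simp_all
  moreover have "h ` Y1 \<in> F"
    using F(1) automorphism_image_mat_lines [OF n h(1)] automorphism_image_mat_tees [OF n h(1)]
    by (auto simp: F_def split: if_splits)
  moreover have "{v2, w2} \<subseteq> h ` Y1" using a1 hv hw by auto
  moreover have "{v2, w2} \<subseteq> Y2" using a2 by simp
  ultimately have "h ` Y1 = Y2" using F(2) by (elim ex1E) auto
  then show "\<exists>f. automorphism ?M f \<and> f ` Y1 = Y2 \<and> f v1 = v2 \<and> f w1 = w2"
    using h(1) hv hw by (intro exI [of _ h]) simp
qed

lemma space2_2_klein:
  assumes "a \<in> space2 2" "b \<in> space2 2" "d \<in> space2 2" "a \<noteq> 0" "b \<noteq> 0" "a \<noteq> b" "d \<notin> {0, a, b}"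
  shows "d = a + b"
proof -
  have "a + b \<noteq> a" "a + b \<noteq> b" "a + b \<noteq> 0" using assms by simp_all
  then have "card {0, a, b, a + b} = 4" using assms by auto
  moreover have "{0, a, b, a + b} \<subseteq> space2 2" using assms by simp
  ultimately have "{0, a, b, a + b} = space2 2"
    by (intro card_subset_eq) simp_all
  then show ?thesis using assms by auto
qed

text \<open>In the Klein four-group any two distinct nonzero elements add up to the third, so a
  bijection that fixes zero preserves sums.\<close>

lemma lin_bij_2I:
  assumes B: "bij_betw B (space2 2) (space2 2)" and B0: "B 0 = 0"
  shows "lin_bij 2 B"
proof -
  have eq: "B x = B y \<longleftrightarrow> x = y" if "x \<in> space2 2" "y \<in> space2 2" for x y
    by (rule inj_on_eq_iff [OF bij_betw_imp_inj_on [OF B] that])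
  have "B (x + y) = B x + B y" if xy: "x \<in> space2 2" "y \<in> space2 2" for x y
  proof (cases "x = 0 \<or> y = 0 \<or> x = y")
    case True
    then show ?thesis using B0 by auto
  next
    case False
    have xy': "x + y \<in> space2 2" using xy by simp
    show ?thesis
    proof (rule space2_2_klein)
      show "B x \<in> space2 2" "B y \<in> space2 2" "B (x + y) \<in> space2 2" using bij_betwE [OF B] xy xy' by blast+
      show "B x \<noteq> 0" "B y \<noteq> 0" "B x \<noteq> B y"
        using eq [OF xy(1) space2_0] eq [OF xy(2) space2_0] eq [OF xy] B0 False by simp_all
      show "B (x + y) \<notin> {0, B x, B y}"
        using eq [OF xy' space2_0] eq [OF xy' xy(1)] eq [OF xy' xy(2)] B0 False by simp
    qed
  qed
  then show ?thesis using B by (simp add: lin_bij_def additive_on_def)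
qed

text \<open>With \<open>\<phi>\<close> and its image as base points, an isomorphism of lines becomes
  a bijection of column vectors fixing zero. For two rows it is linear by \<open>lin_bij_2I\<close>,
  and \<open>line_transport\<close> realises it.\<close>

lemma ultrahomogeneous_lines_2:
  assumes r: "2 < r"
  shows "ultrahomogeneous_wrt (mat_graph 2 r) (mat_lines 2 r)"
  unfolding ultrahomogeneous_wrt_def
proof (intro ballI allI impI)
  let ?M = "mat_graph 2 r"
  fix Y1 Y2 k assume Y: "Y1 \<in> mat_lines 2 r" "Y2 \<in> mat_lines 2 r"
    and k: "graph_iso k (induced ?M Y1) (induced ?M Y2)"
  obtain \<phi> f where \<phi>: "Y1 = line 2 \<phi> f" "\<phi> \<in> full_rank 2 r" "f \<in> space2 r" "f \<notin> row_space 2 \<phi>"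
    using Y(1) by (auto simp: mat_lines_def)
  have "verts (induced ?M Y1) = Y1" "verts (induced ?M Y2) = Y2"
    using mat_lines_subset Y by auto
  then have kb: "bij_betw k Y1 Y2" using k by (simp add: graph_iso_def)
  have "k \<phi> \<in> Y2" using bij_betwE [OF kb] \<phi>(1) line_self by blast
  then obtain g where g: "g \<in> space2 r" "g \<notin> row_space 2 (k \<phi>)" "k \<phi> \<in> full_rank 2 r" "Y2 = line 2 (k \<phi>) g"
    by (rule mat_linesE [OF Y(2)])
  have bij: "bij_betw (\<lambda>c. \<psi> + outer c h) (space2 2) (line 2 \<psi> h)" if "h \<notin> row_space 2 \<psi>" for \<psi> h
    unfolding line_def
    by (rule inj_on_imp_bij_betw, rule eq_card_imp_inj_on)
      (use card_line [OF not_row_spaceD [OF that], of 2 \<psi>] in \<open>simp_all add: line_def\<close>)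
  let ?e1 = "\<lambda>c. \<phi> + outer c f" and ?e2 = "\<lambda>c. k \<phi> + outer c g"
  define B where "B = inv_into (space2 2) ?e2 \<circ> (k \<circ> ?e1)"
  have e2: "bij_betw ?e2 (space2 2) Y2" using bij [OF g(2)] g(4) by simp
  have e1: "bij_betw ?e1 (space2 2) Y1" using bij [OF \<phi>(4)] \<phi>(1) by simp
  have Bb: "bij_betw B (space2 2) (space2 2)"
    unfolding B_def by (rule bij_betw_trans [OF bij_betw_trans [OF e1 kb] bij_betw_inv_into [OF e2]])
  have Beq: "?e2 (B c) = k (?e1 c)" if c: "c \<in> space2 2" for c
  proof -
    have "k (?e1 c) \<in> Y2" using bij_betwE [OF kb] bij_betwE [OF e1] c by blast
    then show ?thesis using bij_betw_inv_into_right [OF e2] by (simp add: B_def)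
  qed
  have "?e2 (B 0) = ?e2 0" using Beq [OF space2_0] by simp
  moreover have "B 0 \<in> space2 2" using bij_betwE [OF Bb] by simp
  ultimately have "B 0 = 0" using inj_onD [OF bij_betw_imp_inj_on [OF e2]] space2_0 by blast
  then have B: "lin_bij 2 B" by (rule lin_bij_2I [OF Bb])
  obtain h where h: "automorphism ?M h" "\<And>c. c \<in> space2 2 \<Longrightarrow> h (?e1 c) = ?e2 (B c)"
    by (rule line_transport [OF \<phi>(2-4) g(3,1,2) B]) blast
  have "h y = k y" if y: "y \<in> Y1" for y
  proof -
    obtain c where "c \<in> space2 2" "y = ?e1 c" using y unfolding \<phi>(1) line_def by (elim imageE)
    then show ?thesis using h(2) Beq by simp
  qed
  then show "\<exists>g. automorphism ?M g \<and> (\<forall>y\<in>Y1. g y = k y)" using h(1) by (intro exI [of _ h]) simp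
qed

section \<open>The polarity in the case of one more column than rows\<close>

definition right_inverses :: "nat \<Rightarrow> nat \<Rightarrow> (nat \<Rightarrow> vec2) \<Rightarrow> (nat \<Rightarrow> vec2) set" where
  "right_inverses n r q = {p \<in> full_rank n r. \<forall>i<n. \<forall>j<n. dot r (p i) (q j) = of_bool (i = j)}"

lemma right_inverses_sym:
  assumes "p \<in> full_rank n r" "q \<in> full_rank n r"
  shows "p \<in> right_inverses n r q \<longleftrightarrow> q \<in> right_inverses n r p"
proof -
  have "dot r (p i) (q j) = of_bool (i = j) \<longleftrightarrow> dot r (q j) (p i) = of_bool (j = i)" for i j
    by (simp only: dot_commute [of r "q j" "p i"] eq_commute [of j i])
  then have "(\<forall>i<n. \<forall>j<n. dot r (p i) (q j) = of_bool (i = j)) \<longleftrightarrow>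
        (\<forall>i<n. \<forall>j<n. dot r (q i) (p j) = of_bool (i = j))"
    by blast
  then show ?thesis using assms by (simp add: right_inverses_def)
qed

lemma right_inverses_iff:
  assumes "p \<in> full_rank n r"
  shows "p \<in> right_inverses n r q \<longleftrightarrow> (\<forall>j<n. mv r p (q j) = unit2 j)"
proof -
  have "mv r p (q j) = unit2 j \<longleftrightarrow> (\<forall>i<n. dot r (p i) (q j) = of_bool (i = j))" if "j < n" for j
  proof
    assume eq: "mv r p (q j) = unit2 j"
    show "\<forall>i<n. dot r (p i) (q j) = of_bool (i = j)"
      using fun_cong [OF eq] by (simp add: mv_apply unit2_apply)
  next
    assume eq: "\<forall>i<n. dot r (p i) (q j) = of_bool (i = j)"
    show "mv r p (q j) = unit2 j"
    proof
      fix i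
      show "mv r p (q j) i = unit2 j i"
        using eq full_rankD(2) [OF assms, of i] that by (cases "i < n") (simp_all add: mv_apply unit2_apply)
    qed
  qed
  then show ?thesis using assms by (auto simp: right_inverses_def)
qed

text \<open>Pairing a vanishing combination with \<open>q j\<close> isolates its coefficient
  \<open>a j\<close>.\<close>

lemma full_rank_of_preimages:
  assumes \<Psi>: "\<And>i. i < n \<Longrightarrow> \<Psi> i \<in> space2 r" "\<And>i. i \<ge> n \<Longrightarrow> \<Psi> i = 0"
    and dot: "\<And>i j. i < n \<Longrightarrow> j < n \<Longrightarrow> dot r (\<Psi> i) (q j) = of_bool (i = j)"
  shows "\<Psi> \<in> full_rank n r"
proof (rule full_rankI [OF \<Psi>])
  fix a assume a: "a \<in> space2 n" "comb n a \<Psi> = 0"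
  show "a = 0"
  proof
    fix j
    show "a j = 0 j"
    proof (cases "j < n")
      case True
      have "dot r (comb n a \<Psi>) (q j) = dot n a (mv r \<Psi> (q j))" by (simp add: dot_mv)
      also have "\<dots> = dot n a (unit2 j)"
        using dot True by (simp add: dot_def [of n] mv_apply unit2_apply)
      finally show ?thesis using True a(2) by simp
    qed (use a(1) in \<open>simp add: space2_def\<close>)
  qed
qed

text \<open>With one more column than rows the kernel of \<open>q\<close> has a single nonzero
  vector \<open>f\<close>. Two right inverses differ in each row by \<open>0\<close> or
  \<open>f\<close>, that is by some \<open>outer c f\<close>.\<close>

lemma right_inverses_eq_line:
  assumes q: "q \<in> full_rank n (Suc n)"
  obtains \<phi> f where "\<phi> \<in> full_rank n (Suc n)" "f \<in> space2 (Suc n)" "f \<notin> row_space n \<phi>"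
    "right_inverses n (Suc n) q = line n \<phi> f"
proof -
  let ?r = "Suc n" and ?K = "{x \<in> space2 (Suc n). mv (Suc n) q x = 0}"
  have "card ?K = 2" using card_mv_fibre [OF q space2_0] by simp
  then obtain f0 f1 where K: "?K = {f0, f1}" "f0 \<noteq> f1" by (auto simp: card_2_iff)
  have "0 \<in> ?K" by simp
  then have "f0 = 0 \<or> f1 = 0" unfolding K(1) by auto
  then have "\<exists>f. ?K = {0, f} \<and> f \<noteq> 0"
  proof
    assume "f0 = 0"
    then show ?thesis using K by (intro exI [of _ f1]) simp
  next
    assume "f1 = 0"
    then show ?thesis using K by (intro exI [of _ f0]) (simp add: insert_commute)
  qed
  then obtain f where f: "?K = {0, f}" "f \<noteq> 0" by blast
  then have fK: "f \<in> space2 ?r" "mv ?r q f = 0" by blast+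
  have "\<exists>x\<in>space2 ?r. mv ?r q x = unit2 i" if "i < n" for i
    using mv_surj [OF q] unit2_space2 [OF that] by (metis (no_types, lifting) imageE)
  then obtain x where x: "\<And>i. i < n \<Longrightarrow> x i \<in> space2 ?r" "\<And>i. i < n \<Longrightarrow> mv ?r q (x i) = unit2 i" by metis
  define \<phi> where "\<phi> = (\<lambda>i. if i < n then x i else 0)"
  have dot\<phi>: "dot ?r (\<phi> i) (q j) = of_bool (i = j)" if "i < n" "j < n" for i j
    using fun_cong [OF x(2) [OF that(1)], of j] that
    by (simp add: \<phi>_def mv_apply unit2_apply dot_commute [of ?r "x i"] eq_commute)
  have \<phi>: "\<phi> \<in> full_rank n ?r"
    by (rule full_rank_of_preimages [where q = q]) (use x dot\<phi> in \<open>simp_all add: \<phi>_def\<close>)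
  have "\<phi> \<in> right_inverses n ?r q" using \<phi> dot\<phi> by (simp add: right_inverses_def)
  then have \<phi>q: "\<And>j. j < n \<Longrightarrow> mv ?r \<phi> (q j) = unit2 j" using right_inverses_iff [OF \<phi>] by blast
  have fq: "dot ?r f (q j) = 0" for j
    using fun_cong [OF fK(2), of j] by (simp add: mv_apply dot_commute)
  have fn: "f \<notin> row_space n \<phi>"
  proof
    assume "f \<in> row_space n \<phi>"
    then obtain a where a: "a \<in> space2 n" "f = comb n a \<phi>" by (auto simp: row_space_def)
    have "a = 0"
    proof
      fix j
      show "a j = 0 j"
      proof (cases "j < n")
        case True
        have "dot n a (mv ?r \<phi> (q j)) = 0" using fq [of j] dot_mv [of n a ?r \<phi> "q j"] a(2) by simp
        then show ?thesis using \<phi>q True by simp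
      qed (use a(1) in \<open>simp add: space2_def\<close>)
    qed
    then show False using a(2) f(2) by simp
  qed
  have "right_inverses n ?r q = line n \<phi> f"
  proof (intro equalityI subsetI)
    fix \<psi> assume \<psi>: "\<psi> \<in> right_inverses n ?r q"
    then have \<psi>FR: "\<psi> \<in> full_rank n ?r" by (simp add: right_inverses_def)
    have row: "\<phi> i + \<psi> i \<in> {0, f}" if i: "i < n" for i
    proof -
      have "dot ?r (q j) (\<phi> i + \<psi> i) = 0" if "j < n" for j
        using \<psi> dot\<phi> i that by (simp add: right_inverses_def dot_commute [of ?r "q j"])
      then have "mv ?r q (\<phi> i + \<psi> i) = 0"
        using full_rankD(2) [OF q] by (intro ext) (metis mv_apply dot_0(1) not_le zero_fun_apply)
      moreover have "\<phi> i + \<psi> i \<in> space2 ?r"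
        using full_rankD(1) [OF \<phi>] full_rankD(1) [OF \<psi>FR] by simp
      ultimately show ?thesis unfolding f(1) [symmetric] by simp
    qed
    \<comment> \<open>The entries of \<open>c\<close> record the rows in which \<open>\<psi>\<close>
      and \<open>\<phi>\<close> differ.\<close>
    define c where "c = (\<lambda>i. if i < n \<and> \<phi> i + \<psi> i = f then 1 else 0 :: bit)"
    have "c \<in> space2 n" by (simp add: c_def space2_def)
    moreover have "\<psi> = \<phi> + outer c f"
    proof
      fix i
      show "\<psi> i = (\<phi> + outer c f) i"
      proof (cases "i < n")
        case True
        show ?thesis
        proof (cases "\<phi> i + \<psi> i = f")
          case True
          then have "\<psi> i = \<phi> i + f" by (metis add_self_left)
          then show ?thesis using True \<open>i < n\<close> by (simp add: c_def)
        next
          case False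
          then have "\<phi> i = \<psi> i" using row [OF \<open>i < n\<close>] by simp
          then show ?thesis using False by (simp add: c_def)
        qed
      qed (use full_rankD(2) [OF \<phi>] full_rankD(2) [OF \<psi>FR] in \<open>simp add: c_def\<close>)
    qed
    ultimately show "\<psi> \<in> line n \<phi> f" by (simp add: line_def)
  next
    fix \<psi> assume \<psi>: "\<psi> \<in> line n \<phi> f"
    then obtain c where c: "\<psi> = \<phi> + outer c f" by (auto simp: line_def)
    have "\<psi> \<in> full_rank n ?r" using line_subset [OF \<phi> fK(1) fn] \<psi> by blast
    then show "\<psi> \<in> right_inverses n ?r q"
      using \<phi>q fq by (simp add: right_inverses_iff c)
  qed
  then show ?thesis using that \<phi> fK(1) fn by blast
qed

text \<open>Stacking \<open>f\<close> on \<open>\<phi>\<close> gives an invertible square matrix.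
  The preimages of the first \<open>n\<close> unit vectors are dual to the rows of
  \<open>\<phi>\<close> and orthogonal to \<open>f\<close>.\<close>

lemma right_inverses_line_surj:
  assumes L: "L \<in> mat_lines n (Suc n)" and n: "0 < n"
  shows "\<exists>q\<in>full_rank n (Suc n). right_inverses n (Suc n) q = L"
proof -
  let ?r = "Suc n"
  obtain \<phi> f where \<phi>: "L = line n \<phi> f" "\<phi> \<in> full_rank n ?r" "f \<in> space2 ?r" "f \<notin> row_space n \<phi>"
    using L by (auto simp: mat_lines_def)
  have \<Psi>: "\<phi>(n := f) \<in> full_rank ?r ?r" by (rule full_rank_stack [OF \<phi>(2-4)])
  have "\<exists>x\<in>space2 ?r. mv ?r (\<phi>(n := f)) x = unit2 i" if "i < n" for i
    using mv_surj [OF \<Psi>] unit2_space2 [of i ?r] that by (metis (no_types, lifting) imageE less_SucI)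
  then obtain x where x: "\<And>i. i < n \<Longrightarrow> x i \<in> space2 ?r" "\<And>i. i < n \<Longrightarrow> mv ?r (\<phi>(n := f)) (x i) = unit2 i"
    by metis
  define q where "q = (\<lambda>i. if i < n then x i else 0)"
  have row: "dot ?r ((\<phi>(n := f)) i) (q j) = of_bool (i = j)" if "j < n" for i j
    using fun_cong [OF x(2) [OF that], of i] that by (simp add: q_def mv_apply unit2_apply)
  have d\<phi>: "dot ?r (\<phi> i) (q j) = of_bool (i = j)" if "i < n" "j < n" for i j
    using row [of j i] that by simp
  have df: "dot ?r f (q j) = 0" if "j < n" for j
    using row [of j n] that by simp
  have q: "q \<in> full_rank n ?r"
  proof (rule full_rank_of_preimages [where q = \<phi>])
    show "dot ?r (q i) (\<phi> j) = of_bool (i = j)" if "i < n" "j < n" for i j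
      using d\<phi> [OF that(2,1)] by (simp add: dot_commute [of ?r "q i"] eq_commute)
  qed (use x in \<open>simp_all add: q_def\<close>)
  obtain \<psi> g where \<psi>: "\<psi> \<in> full_rank n ?r" "g \<in> space2 ?r" "g \<notin> row_space n \<psi>"
    "right_inverses n ?r q = line n \<psi> g" by (rule right_inverses_eq_line [OF q])
  then have RL: "right_inverses n ?r q \<in> mat_lines n ?r" by (auto simp: mat_lines_def)
  have u: "unit2 0 \<in> space2 n" using n by simp
  have "\<phi> + outer (unit2 0) f \<in> full_rank n ?r" by (rule full_rank_add_outer [OF \<phi>(2) u \<phi>(3,4)])
  then have "\<phi> \<in> right_inverses n ?r q" "\<phi> + outer (unit2 0) f \<in> right_inverses n ?r q"
    using d\<phi> df \<phi>(2) by (simp_all add: right_inverses_def)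
  then have "right_inverses n ?r q = L"
    using mat_lines_unique [OF RL, of \<phi> "unit2 0" f] not_row_spaceD [OF \<phi>(4)] \<phi>(1) by simp
  then show ?thesis using q by blast
qed

text \<open>The line determines the images of the rows of \<open>q\<close> under the square matrix
  stacked from \<open>\<phi>\<close> and \<open>f\<close>, and that matrix is invertible.\<close>

lemma right_inverses_inj:
  assumes q: "q \<in> full_rank n (Suc n)" "q' \<in> full_rank n (Suc n)" and n: "0 < n"
    and eq: "right_inverses n (Suc n) q = right_inverses n (Suc n) q'"
  shows "q = q'"
proof -
  let ?r = "Suc n"
  obtain \<phi> f where \<phi>: "\<phi> \<in> full_rank n ?r" "f \<in> space2 ?r" "f \<notin> row_space n \<phi>"
    "right_inverses n ?r q = line n \<phi> f" by (rule right_inverses_eq_line [OF q(1)])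
  have \<Psi>: "\<phi>(n := f) \<in> full_rank ?r ?r" by (rule full_rank_stack [OF \<phi>(1-3)])
  have u: "unit2 0 \<in> space2 n" using n by simp
  have key: "mv ?r (\<phi>(n := f)) (p j) = unit2 j" if p: "right_inverses n ?r p = line n \<phi> f" and j: "j < n" for p j
  proof -
    have "\<phi> \<in> right_inverses n ?r p" using line_self p by simp
    then have 1: "mv ?r \<phi> (p j) = unit2 j" using right_inverses_iff [OF \<phi>(1)] j by blast
    \<comment> \<open>Comparing this point of the line with \<open>\<phi>\<close> shows that
      \<open>f\<close> annihilates \<open>p j\<close>.\<close>
    have *: "\<phi> + outer (unit2 0) f \<in> full_rank n ?r" by (rule full_rank_add_outer [OF \<phi>(1) u \<phi>(2,3)])
    have "\<phi> + outer (unit2 0) f \<in> right_inverses n ?r p" using p u by (simp add: line_def)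
    then have "mv ?r (\<phi> + outer (unit2 0) f) (p j) = unit2 j" using right_inverses_iff [OF *] j by blast
    then have "scale2 (dot ?r f (p j)) (unit2 0) = 0" using 1 by simp
    then have 2: "dot ?r f (p j) = 0" by (cases "dot ?r f (p j)") auto
    show ?thesis
    proof
      fix i
      show "mv ?r (\<phi>(n := f)) (p j) i = unit2 j i"
        using fun_cong [OF 1, of i] 2 j by (cases "i = n") (simp_all add: mv_apply unit2_apply)
    qed
  qed
  show ?thesis
  proof
    fix j
    show "q j = q' j"
    proof (cases "j < n")
      case True
      have "mv ?r (\<phi>(n := f)) (q j) = mv ?r (\<phi>(n := f)) (q' j)"
        using key [OF \<phi>(4) True] key [OF _ True, of q'] eq \<phi>(4) by simp
      then show ?thesis
        using inj_onD [OF bij_betw_imp_inj_on [OF mv_square_bij [OF \<Psi>]]] full_rankD(1) [OF q(1)] full_rankD(1) [OF q(2)]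
        by blast
    qed (use full_rankD(2) [OF q(1)] full_rankD(2) [OF q(2)] in simp)
  qed
qed

lemma bij_right_inverses:
  assumes n: "0 < n"
  shows "bij_betw (right_inverses n (Suc n)) (full_rank n (Suc n)) (mat_lines n (Suc n))"
proof (rule bij_betw_imageI)
  show "inj_on (right_inverses n (Suc n)) (full_rank n (Suc n))"
    using right_inverses_inj n by (intro inj_onI) blast
  show "right_inverses n (Suc n) ` full_rank n (Suc n) = mat_lines n (Suc n)"
  proof (intro equalityI subsetI)
    fix L assume "L \<in> right_inverses n (Suc n) ` full_rank n (Suc n)"
    then obtain q where q: "q \<in> full_rank n (Suc n)" "L = right_inverses n (Suc n) q" by blast
    obtain \<psi> g where "\<psi> \<in> full_rank n (Suc n)" "g \<in> space2 (Suc n)" "g \<notin> row_space n \<psi>"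
      "right_inverses n (Suc n) q = line n \<psi> g" by (rule right_inverses_eq_line [OF q(1)])
    then show "L \<in> mat_lines n (Suc n)" using q(2) by (auto simp: mat_lines_def)
  next
    fix L assume "L \<in> mat_lines n (Suc n)"
    then show "L \<in> right_inverses n (Suc n) ` full_rank n (Suc n)"
      using right_inverses_line_surj [OF _ n] by blast
  qed
qed

section \<open>Connectedness\<close>

lemma row_space_stack_iff:
  "z \<in> row_space (Suc n) (\<phi>(n := y)) \<longleftrightarrow> z \<in> row_space n \<phi> \<or> z + y \<in> row_space n \<phi>"
proof
  assume "z \<in> row_space (Suc n) (\<phi>(n := y))"
  then obtain a where a: "a \<in> space2 (Suc n)" "z = comb (Suc n) a (\<phi>(n := y))" by (auto simp: row_space_def)
  have "comb n a (\<phi>(n := y)) = comb n (a(n := 0)) \<phi>" by (rule comb_cong) auto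
  then have z: "z = comb n (a(n := 0)) \<phi> + scale2 (a n) y" using a(2) by (simp add: comb_Suc)
  have "a(n := 0) \<in> space2 n" using a(1) by (auto simp: space2_def)
  then have *: "comb n (a(n := 0)) \<phi> \<in> row_space n \<phi>" by (simp add: row_space_def)
  show "z \<in> row_space n \<phi> \<or> z + y \<in> row_space n \<phi>"
  proof (cases "a n")
    case zero
    then show ?thesis using z * by simp
  next
    case one
    then have "z + y = comb n (a(n := 0)) \<phi>" using z by (simp add: add.assoc)
    then show ?thesis using * by simp
  qed
next
  have *: "x + scale2 b y \<in> row_space (Suc n) (\<phi>(n := y))" if "x \<in> row_space n \<phi>" for x b
  proof -
    obtain a where a: "a \<in> space2 n" "x = comb n a \<phi>" using \<open>x \<in> row_space n \<phi>\<close> by (auto simp: row_space_def)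
    have "comb n (a(n := b)) (\<phi>(n := y)) = comb n a \<phi>" by (rule comb_cong) auto
    then have "x + scale2 b y = comb (Suc n) (a(n := b)) (\<phi>(n := y))" using a(2) by (simp add: comb_Suc)
    moreover have "a(n := b) \<in> space2 (Suc n)" using a(1) by (auto simp: space2_def)
    ultimately show ?thesis by (simp add: row_space_def)
  qed
  assume "z \<in> row_space n \<phi> \<or> z + y \<in> row_space n \<phi>"
  then show "z \<in> row_space (Suc n) (\<phi>(n := y))"
  proof
    assume "z \<in> row_space n \<phi>"
    from * [OF this, of 0] show ?thesis by simp
  next
    assume "z + y \<in> row_space n \<phi>"
    from * [OF this, of 1] show ?thesis by (simp add: add.assoc)
  qed
qed

lemma arcs_mat_graph:
  "(\<phi>, \<psi>) \<in> arcs (mat_graph n r) \<longleftrightarrow> \<phi> \<in> full_rank n r \<and> madj n r \<phi> \<psi>"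
  using edge_mat_graph_iff madj_full_rank by (auto simp: arcs_def)

text \<open>A lift in the same part as \<open>\<phi>\<close> is reached through a lift in another
  part, which \<open>n < r\<close> supplies.\<close>

lemma tee_connected:
  assumes n: "n < r" and \<phi>: "\<phi> \<in> full_rank n r" and c: "c \<in> space2 n" "c \<noteq> 0"
    and h: "h \<in> space2 r" "\<phi> + outer c h \<in> full_rank n r"
  shows "(\<phi>, \<phi> + outer c h) \<in> (arcs (mat_graph n r))\<^sup>*"
proof (cases "h \<in> row_space n \<phi>")
  case False
  then have "madj n r \<phi> (\<phi> + outer c h)" unfolding madj_def using c h by blast
  then show ?thesis using \<phi> arcs_mat_graph by (intro r_into_rtrancl) blast
next
  case True
  obtain k where k: "k \<in> space2 r" "k \<notin> row_space n \<phi>"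
    using exists_not_in_row_space [OF \<phi> n] by blast
  have kFR: "\<phi> + outer c k \<in> full_rank n r" by (rule full_rank_add_outer [OF \<phi> c(1) k])
  have "madj n r \<phi> (\<phi> + outer c k)" unfolding madj_def using c k by blast
  then have 1: "(\<phi>, \<phi> + outer c k) \<in> arcs (mat_graph n r)" using \<phi> arcs_mat_graph by blast
  have "h + k \<notin> row_space n \<phi>" using True k(2) row_space_add_iff by blast
  then have "k + h \<notin> row_space n \<phi>" by (simp add: add.commute)
  then have "k + h \<notin> (\<lambda>a. comb n a \<phi>) ` {a \<in> space2 n. dot n a c = 0}" unfolding row_space_def by blast
  then have "madj n r (\<phi> + outer c k) (\<phi> + outer c h)"
    using madj_tee_iff [OF \<phi> c k(1) kFR h] by blast
  then have "(\<phi> + outer c k, \<phi> + outer c h) \<in> arcs (mat_graph n r)" using kFR arcs_mat_graph by blast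
  with 1 show ?thesis by (meson converse_rtrancl_into_rtrancl r_into_rtrancl)
qed

text \<open>Matrices that differ in the last row only lie in a common tee, the one with column
  vector \<open>unit2 n\<close>.\<close>

lemma last_row_connected:
  assumes n: "Suc n < r" and \<phi>: "\<phi> \<in> full_rank n r"
    and x: "x \<in> space2 r" "x \<notin> row_space n \<phi>" and y: "y \<in> space2 r" "y \<notin> row_space n \<phi>"
  shows "(\<phi>(n := x), \<phi>(n := y)) \<in> (arcs (mat_graph (Suc n) r))\<^sup>*"
proof -
  have eq: "\<phi>(n := x) + outer (unit2 n) (x + y) = \<phi>(n := y)"
    by (rule ext) (simp add: unit2_apply)
  have "(\<phi>(n := x), \<phi>(n := x) + outer (unit2 n) (x + y)) \<in> (arcs (mat_graph (Suc n) r))\<^sup>*"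
  proof (rule tee_connected [OF n full_rank_stack [OF \<phi> x]])
    show "\<phi>(n := x) + outer (unit2 n) (x + y) \<in> full_rank (Suc n) r"
      unfolding eq by (rule full_rank_stack [OF \<phi> y])
  qed (use x y in simp_all)
  then show ?thesis unfolding eq .
qed

text \<open>To lift a step from \<open>\<beta>\<close> to \<open>\<gamma>\<close> in the direction
  \<open>g\<close>, the last row is first moved to some \<open>z\<close> outside the span of
  \<open>\<beta>\<close> and \<open>g\<close>. Then \<open>g\<close> stays outside the enlarged row
  space and \<open>z\<close> is a legal last row at both ends.\<close>

lemma lift_connected:
  assumes n: "Suc n < r" and \<phi>: "\<phi> \<in> full_rank n r" and path: "(\<phi>, \<psi>) \<in> (arcs (mat_graph n r))\<^sup>*"
    and x: "x \<in> space2 r" "x \<notin> row_space n \<phi>" and y: "y \<in> space2 r" "y \<notin> row_space n \<psi>"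
  shows "(\<phi>(n := x), \<psi>(n := y)) \<in> (arcs (mat_graph (Suc n) r))\<^sup>*"
  using path y
proof (induction arbitrary: y rule: rtrancl_induct)
  case base
  then show ?case using last_row_connected [OF n \<phi> x] by blast
next
  case (step \<beta> \<gamma>)
  have \<beta>: "\<beta> \<in> full_rank n r" and adj: "madj n r \<beta> \<gamma>" using step.hyps(2) arcs_mat_graph by blast+
  have \<gamma>: "\<gamma> \<in> full_rank n r" by (rule madj_full_rank [OF adj \<beta>])
  obtain c g where c: "c \<in> space2 n" "c \<noteq> 0" "g \<in> space2 r" "g \<notin> row_space n \<beta>" "\<gamma> = \<beta> + outer c g"
    using adj by (rule madjE)
  obtain z where z: "z \<in> space2 r" "z \<notin> row_space (Suc n) (\<beta>(n := g))"
    using exists_not_in_row_space [OF full_rank_stack [OF \<beta> c(3,4)] n] by blast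
  have z\<beta>: "z \<notin> row_space n \<beta>" "z + g \<notin> row_space n \<beta>" using z(2) row_space_stack_iff by blast+
  have gz: "g \<notin> row_space (Suc n) (\<beta>(n := z))"
    using c(4) z\<beta>(2) row_space_stack_iff [where z = g and y = z and \<phi> = \<beta>] by (simp add: add.commute)
  have zFR: "\<beta>(n := z) \<in> full_rank (Suc n) r" by (rule full_rank_stack [OF \<beta> z(1) z\<beta>(1)])
  \<comment> \<open>The vector \<open>c\<close> is zero at position \<open>n\<close>, so the step
    leaves the last row \<open>z\<close> alone.\<close>
  have eq: "\<gamma>(n := z) = \<beta>(n := z) + outer c g"
    using c(1) unfolding c(5) by (intro ext) (simp add: space2_def)
  have "c \<in> space2 (Suc n)" using c(1) space2_mono [of n "Suc n"] by auto
  then have adj': "madj (Suc n) r (\<beta>(n := z)) (\<gamma>(n := z))"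
    using c(2,3) gz eq unfolding madj_def by blast
  have "\<gamma>(n := z) \<in> full_rank (Suc n) r" by (rule madj_full_rank [OF adj' zFR])
  from full_rank_unstack(2) [OF this] have z\<gamma>: "z \<notin> row_space n \<gamma>"
    using row_space_cong [of n "\<gamma>(n := 0)" \<gamma>] by simp
  have "(\<phi>(n := x), \<beta>(n := z)) \<in> (arcs (mat_graph (Suc n) r))\<^sup>*" by (rule step.IH [OF z(1) z\<beta>(1)])
  moreover have "(\<beta>(n := z), \<gamma>(n := z)) \<in> arcs (mat_graph (Suc n) r)" using adj' zFR arcs_mat_graph by blast
  moreover have "(\<gamma>(n := z), \<gamma>(n := y)) \<in> (arcs (mat_graph (Suc n) r))\<^sup>*"
    by (rule last_row_connected [OF n \<gamma> z(1) z\<gamma> step.prems])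
  ultimately show ?case by (meson rtrancl.rtrancl_into_rtrancl rtrancl_trans)
qed

lemma mat_graph_connected:
  assumes "n < r" "\<phi> \<in> full_rank n r" "\<psi> \<in> full_rank n r"
  shows "(\<phi>, \<psi>) \<in> (arcs (mat_graph n r))\<^sup>*"
  using assms
proof (induction n arbitrary: \<phi> \<psi>)
  case 0
  have "\<phi> = \<psi>"
    by (rule ext) (use full_rankD(2) [OF 0(2)] full_rankD(2) [OF 0(3)] in simp)
  then show ?case by simp
next
  case (Suc n)
  have un: "\<chi>(n := 0) \<in> full_rank n r" "\<chi> n \<in> space2 r" "\<chi> n \<notin> row_space n (\<chi>(n := 0))"
    if "\<chi> \<in> full_rank (Suc n) r" for \<chi>
    using full_rank_unstack [OF that] full_rankD(1) [OF that] by auto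
  have "(\<phi>(n := 0), \<psi>(n := 0)) \<in> (arcs (mat_graph n r))\<^sup>*"
    by (rule Suc.IH [OF Suc_lessD [OF Suc.prems(1)] un(1) [OF Suc.prems(2)] un(1) [OF Suc.prems(3)]])
  then have "((\<phi>(n := 0))(n := \<phi> n), (\<psi>(n := 0))(n := \<psi> n)) \<in> (arcs (mat_graph (Suc n) r))\<^sup>*"
    by (rule lift_connected [OF Suc.prems(1) un(1) [OF Suc.prems(2)] _
          un(2,3) [OF Suc.prems(2)] un(2,3) [OF Suc.prems(3)]])
  then show ?case by simp
qed

section \<open>Isomorphisms that do not extend\<close>

text \<open>At this vertex a combination of rows equals its coefficient vector and the row space is
  \<open>space2 n\<close>, so independence can be read off coordinates.\<close>

definition unit_mat :: "nat \<Rightarrow> nat \<Rightarrow> vec2" where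
  "unit_mat n = (\<lambda>i. if i < n then unit2 i else 0)"

lemma comb_unit_mat: "a \<in> space2 n \<Longrightarrow> comb n a (unit_mat n) = a"
proof
  fix j assume a: "a \<in> space2 n"
  have "comb n a (unit_mat n) j = (\<Sum>i<n. if j = i then a i else 0)"
    unfolding comb_apply unit_mat_def by (rule sum.cong) (auto simp: unit2_apply)
  also have "\<dots> = a j" using a by (simp add: space2_def)
  finally show "comb n a (unit_mat n) j = a j" .
qed

lemma unit_mat_full_rank: "n \<le> r \<Longrightarrow> unit_mat n \<in> full_rank n r"
proof (rule full_rankI)
  show "a = 0" if "a \<in> space2 n" "comb n a (unit_mat n) = 0" for a
    using that by (simp add: comb_unit_mat)
qed (simp_all add: unit_mat_def)

lemma row_space_unit_mat: "row_space n (unit_mat n) = space2 n"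
  by (auto simp: row_space_def comb_unit_mat image_iff)

lemma unit2_notin_space2: "n \<le> k \<Longrightarrow> unit2 k \<notin> space2 n"
  by (auto simp: space2_def unit2_apply)

lemma unit2_eq_iff [simp]: "unit2 i = unit2 j \<longleftrightarrow> i = j"
proof
  assume "unit2 i = unit2 j"
  from fun_cong [OF this, of i] show "i = j" by (simp add: unit2_apply split: if_splits)
qed simp

lemma automorphism_madj:
  assumes h: "automorphism (mat_graph n r) h" and FR: "\<phi> \<in> full_rank n r" and adj: "madj n r \<phi> \<psi>"
  shows "madj n r (h \<phi>) (h \<psi>)"
  using graph_isoD(5) [OF h, of \<phi> \<psi>] graph_isoD(4) [OF h, of \<phi>] graph_isoD(4) [OF h, of \<psi>] FR madj_full_rank [OF adj FR] adj
  by (simp add: edge_mat_graph_iff)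

lemma automorphism_notin_image:
  assumes h: "automorphism (mat_graph n r) h" and "Y \<subseteq> full_rank n r" "x \<in> full_rank n r" "x \<notin> Y"
  shows "h x \<notin> h ` Y"
  using inj_on_image_mem_iff [OF graph_isoD(2) [OF h], of x Y] assms by simp

text \<open>
  On a line through \<open>\<phi>\<close>, the edges \<open>{\<phi>, \<phi> + outer c f}\<close> and \<open>{\<phi> + outer d f, \<phi> + outer (c + d) f}\<close>
  span tees that have further edges between them outside the line. An automorphism preserves this
  parallelism, an arbitrary permutation of a line with at least \<open>8\<close> points does not.
\<close>

lemma not_ultrahomogeneous_lines:
  assumes n: "3 \<le> n" "n < r"
  shows "\<not> ultrahomogeneous_wrt (mat_graph n r) (mat_lines n r \<union> mat_tees n r)"
proof
  let ?M = "mat_graph n r"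
  assume ultra: "ultrahomogeneous_wrt ?M (mat_lines n r \<union> mat_tees n r)"
  have n2: "2 \<le> n" using n by simp
  define \<phi> where "\<phi> = unit_mat n"
  define f where "f = unit2 n"
  define u v w where "u = unit2 0" and "v = unit2 1" and "w = unit2 2"
  have \<phi>: "\<phi> \<in> full_rank n r" unfolding \<phi>_def by (rule unit_mat_full_rank) (use n in simp)
  have f: "f \<in> space2 r" "f \<notin> row_space n \<phi>"
    unfolding f_def \<phi>_def row_space_unit_mat using n unit2_notin_space2 [of n n] by auto
  have f0: "f \<noteq> 0" unfolding f_def by simp
  have uvw: "u \<in> space2 n" "v \<in> space2 n" "w \<in> space2 n" "u \<noteq> 0" "v \<noteq> 0" "w \<noteq> 0"
    using n by (simp_all add: u_def v_def w_def)
  have uvw_i: "u 0 = 1" "v 0 = 0" "w 0 = 0" "u 1 = 0" "v 1 = 1" "w 1 = 0" "u 2 = 0" "v 2 = 0" "w 2 = 1"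
    by (simp_all add: u_def v_def w_def unit2_apply)
  define P where "P = (\<lambda>c. \<phi> + outer c f)"
  have Pinj: "P c = P d \<longleftrightarrow> c = d" for c d
  proof
    assume "P c = P d"
    then have *: "outer c f = outer d f" by (simp add: P_def)
    obtain j where "f j = 1" using f0 by (rule nonzeroE)
    then have "c i = d i" for i using fun_cong [OF fun_cong [OF *, of i], of j] by simp
    then show "c = d" by (rule ext)
  qed simp
  have P0: "P 0 = \<phi>" by (simp add: P_def)
  define L where "L = line n \<phi> f"
  have PL: "P c \<in> L" if "c \<in> space2 n" for c using that by (simp add: L_def line_def P_def)
  have L: "L \<in> mat_lines n r" using \<phi> f by (auto simp: mat_lines_def L_def)
  have LFR: "L \<subseteq> full_rank n r" by (rule mat_lines_subset [OF L])
  \<comment> \<open>The exchange breaks the parallelogram \<open>0\<close>, \<open>u\<close>,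
    \<open>v\<close>, \<open>u + v\<close>. It needs a third independent vector \<open>w\<close>,
    hence three rows.\<close>
  define \<pi> where "\<pi> = (\<lambda>x. if x = P (u + v) then P w else if x = P w then P (u + v) else x)"
  have \<pi>\<pi>: "\<pi> (\<pi> x) = x" for x by (simp add: \<pi>_def)
  have \<pi>L: "\<pi> x \<in> L" if "x \<in> L" for x using that PL uvw by (simp add: \<pi>_def)
  have VL: "verts (induced ?M L) = L" using LFR by auto
  have "graph_iso \<pi> (induced ?M L) (induced ?M L)"
    unfolding graph_iso_def VL
  proof (intro conjI ballI)
    show "bij_betw \<pi> L L" by (rule bij_betw_byWitness [where f' = \<pi>]) (use \<pi>\<pi> \<pi>L in auto)
    fix x y assume xy: "x \<in> L" "y \<in> L"
    have clique: "madj n r a b \<longleftrightarrow> a \<noteq> b" if "a \<in> L" "b \<in> L" for a b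
      using madj_line [OF \<phi> f, of a b] that madj_neq by (auto simp: L_def)
    have "\<pi> x \<noteq> \<pi> y \<longleftrightarrow> x \<noteq> y" using \<pi>\<pi> by metis
    then show "{x, y} \<in> edges (induced ?M L) \<longleftrightarrow> {\<pi> x, \<pi> y} \<in> edges (induced ?M L)"
      using clique xy \<pi>L by (simp only: induced_mat_edge_iff [OF LFR])
  qed
  then obtain h where h: "automorphism ?M h" "\<forall>y\<in>L. h y = \<pi> y"
    using ultra L unfolding ultrahomogeneous_wrt_def by blast
  have hP: "h (P c) = P c" if "c \<in> space2 n" "c \<noteq> u + v" "c \<noteq> w" for c
    using h(2) PL [OF that(1)] that by (simp add: \<pi>_def Pinj)
  have ne: "u \<noteq> u + v" "v \<noteq> u + v" "u \<noteq> w" "v \<noteq> w" "0 \<noteq> u + v" "0 \<noteq> w" "u \<noteq> v"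
    by (simp_all add: u_def v_def w_def)
  have h1: "h \<phi> = \<phi>" using hP [of 0] ne uvw by (simp add: P0)
  have h2: "h (P u) = P u" by (rule hP) (use ne uvw in simp_all)
  have h3: "h (P v) = P v" by (rule hP) (use ne uvw in simp_all)
  have h4: "h (P (u + v)) = P w" using h(2) PL [of "u + v"] uvw by (simp add: \<pi>_def)
  have hL: "h ` L = L"
  proof -
    have "h ` L = \<pi> ` L" using h(2) by (intro image_cong) auto
    moreover have "\<pi> ` L = L" using \<pi>L \<pi>\<pi> by (auto simp: image_iff) metis
    ultimately show ?thesis by simp
  qed
  have PFR: "P c \<in> full_rank n r" if "c \<in> space2 n" for c using PL [OF that] LFR by blast
  \<comment> \<open>The vertices \<open>x\<close> and \<open>y\<close> lie in the tees of the two
    parallel edges, are adjacent, and \<open>x\<close> is off the line. Here \<open>v\<close>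
    doubles as a row vector.\<close>
  define x where "x = \<phi> + outer u v"
  have vsp: "v \<in> space2 r" using uvw(2) space2_mono [of n r] n by auto
  have xFR: "x \<in> full_rank n r"
    unfolding x_def full_rank_add_outer_iff [OF \<phi> uvw(1) vsp]
  proof (intro ballI impI)
    fix a assume a: "a \<in> space2 n" "dot n a u = 1"
    then have "a 0 = 1" using n by (simp add: u_def)
    then have "v \<noteq> a" using uvw_i(2) by auto
    then show "v \<noteq> comb n a \<phi>" unfolding \<phi>_def comb_unit_mat [OF a(1)] .
  qed
  define y where "y = x + outer v f"
  have fx: "f \<notin> row_space n x"
  proof
    assume "f \<in> row_space n x"
    then obtain a where a: "a \<in> space2 n" "f = a + scale2 (dot n a u) v"
      by (auto simp: row_space_def x_def \<phi>_def comb_unit_mat)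
    then have "f \<in> space2 n" using uvw(2) by simp
    then show False using unit2_notin_space2 [of n n] by (simp add: f_def)
  qed
  have adj: "madj n r x y" unfolding madj_def y_def using uvw f(1) fx by blast
  have yFR: "y \<in> full_rank n r" by (rule madj_full_rank [OF adj xFR])
  have yP: "y = P v + outer u v" unfolding y_def x_def P_def by (simp add: add.assoc add.commute)
  have xX: "x \<in> tee n r \<phi> u" using xFR vsp by (auto simp: tee_def x_def)
  have yY: "y \<in> tee n r (P v) u" using yFR vsp by (auto simp: tee_def yP)
  have X: "tee n r \<phi> u \<in> mat_tees n r" using \<phi> uvw by (auto simp: mat_tees_def)
  have Y: "tee n r (P v) u \<in> mat_tees n r" using PFR [OF uvw(2)] uvw by (auto simp: mat_tees_def)
  have PuX: "P u \<in> tee n r \<phi> u" using PFR [OF uvw(1)] f(1) by (auto simp: tee_def P_def)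
  have Puv: "P (u + v) = P v + outer u f" by (simp add: P_def outer_add_left add.assoc add.commute)
  have PuvY: "P (u + v) \<in> tee n r (P v) u"
    using PFR [of "u + v"] f(1) uvw by (auto simp: tee_def Puv)
  have "h ` tee n r \<phi> u = tee n r \<phi> u"
  proof (rule mat_tees_unique [OF automorphism_image_mat_tees [OF n2 n(2) h(1) X] _ _ uvw(4) f0])
    show "\<phi> \<in> h ` tee n r \<phi> u" using tee_self [OF \<phi>] h1 by (metis imageI)
    have "P u \<in> h ` tee n r \<phi> u" using PuX h2 by (metis imageI)
    then show "\<phi> + outer u f \<in> h ` tee n r \<phi> u" by (simp add: P_def)
  qed
  then have hx: "h x \<in> tee n r \<phi> u" using xX by blast
  have vw0: "v + w \<noteq> 0" using ne by simp
  \<comment> \<open>The edge from \<open>P v\<close> to \<open>P (u + v)\<close> is mapped to the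
    edge from \<open>P v\<close> to \<open>P w\<close>, whose column vector is
    \<open>v + w\<close>.\<close>
  have "h ` tee n r (P v) u = tee n r (P v) (v + w)"
  proof (rule mat_tees_unique [OF automorphism_image_mat_tees [OF n2 n(2) h(1) Y] _ _ vw0 f0])
    show "P v \<in> h ` tee n r (P v) u" using tee_self [OF PFR [OF uvw(2)]] h3 by (metis imageI)
    have "P w \<in> h ` tee n r (P v) u" using PuvY h4 by (metis imageI)
    moreover have "P v + outer (v + w) f = P w" by (simp add: P_def outer_add_left add.assoc)
    ultimately show "P v + outer (v + w) f \<in> h ` tee n r (P v) u" by simp
  qed
  then have hy: "h y \<in> tee n r (P v) (v + w)" using yY by blast
  obtain g where g: "h x = \<phi> + outer u g" using hx by (auto simp: tee_def)
  obtain k where k: "h y = P v + outer (v + w) k" using hy by (auto simp: tee_def)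
  have "madj n r (h x) (h y)" by (rule automorphism_madj [OF h(1) xFR adj])
  then obtain e m where em: "h y = h x + outer e m" by (rule madjE)
  \<comment> \<open>Coordinates \<open>0\<close>, \<open>1\<close> and \<open>2\<close> separate
    \<open>u\<close>, \<open>v\<close> and \<open>w\<close>. They force \<open>m = f\<close>, and
    then \<open>h x\<close> would lie on the line although \<open>x\<close> does not.\<close>
  have rows: "scale2 (v i) f + scale2 (v i + w i) k = scale2 (u i) g + scale2 (e i) m" for i
    using fun_cong [OF em [unfolded g k P_def], of i] by (simp add: add.assoc)
  have r0: "g = scale2 (e 0) m" using rows [of 0] uvw_i by simp
  have r1: "f + k = scale2 (e 1) m" using rows [of 1] uvw_i by simp
  have r2: "k = scale2 (e 2) m" using rows [of 2] uvw_i by simp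
  have "f = scale2 (e 1) m + k" using r1 by (metis add.commute add_self_left)
  also have "\<dots> = scale2 (e 1 + e 2) m" unfolding r2 by (simp add: fun_eq_iff distrib_right)
  finally have "f = m" using scale2_eq_self f0 by blast
  then have "outer u g = outer (scale2 (e 0) u) f" unfolding r0 by (simp add: fun_eq_iff mult.assoc mult.left_commute)
  then have "h x = P (scale2 (e 0) u)" using g by (simp add: P_def)
  then have "h x \<in> h ` L" using PL [of "scale2 (e 0) u"] uvw hL by simp
  moreover have "x \<notin> L"
  proof
    assume "x \<in> L"
    then obtain c where "\<phi> + outer u v = \<phi> + outer c f" by (auto simp: L_def line_def x_def)
    then have "outer u v = outer c f" by simp
    then have "v = f" using outer_eq_outer(2) uvw by blast
    then show False using n by (simp add: v_def f_def)
  qed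
  ultimately show False using automorphism_notin_image [OF h(1) LFR xFR] by blast
qed

text \<open>
  Dually, two edges in the same direction \<open>f\<close> of a tee span lines that have edges between them outside
  the tee, whereas the parts of a tee can be permuted arbitrarily.
\<close>

lemma not_ultrahomogeneous_tees:
  assumes n: "2 \<le> n" "Suc n < r"
  shows "\<not> ultrahomogeneous_wrt (mat_graph n r) (mat_lines n r \<union> mat_tees n r)"
proof
  let ?M = "mat_graph n r"
  assume ultra: "ultrahomogeneous_wrt ?M (mat_lines n r \<union> mat_tees n r)"
  have nr: "n < r" using n by simp
  define \<phi> where "\<phi> = unit_mat n"
  define f g where "f = unit2 n" and "g = unit2 (Suc n)"
  define u v where "u = unit2 0" and "v = unit2 1"
  \<comment> \<open>At this vertex \<open>U\<close> is the space whose cosets are the parts of the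
    tee with column vector \<open>u\<close>.\<close>
  define U where "U = {a \<in> space2 n. a 0 = 0}"
  have \<phi>: "\<phi> \<in> full_rank n r" unfolding \<phi>_def by (rule unit_mat_full_rank) (use n in simp)
  have uv: "u \<in> space2 n" "v \<in> space2 n" "u \<noteq> 0" "v \<noteq> 0" "u \<noteq> v"
    using n by (simp_all add: u_def v_def)
  have ur: "u \<in> space2 r" using n by (simp add: u_def)
  have fg: "f \<in> space2 r" "g \<in> space2 r" "f \<noteq> 0" "g \<noteq> 0"
    using n by (simp_all add: f_def g_def)
  have at: "u 0 = 1" "u n = 0" "u (Suc n) = 0" "f 0 = 0" "f n = 1" "f (Suc n) = 0" "g 0 = 0" "g n = 0" "g (Suc n) = 1"
    using n by (simp_all add: u_def f_def g_def unit2_apply)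
  have Un: "a n = 0" "a (Suc n) = 0" "a 0 = 0" if "a \<in> U" for a using that by (simp_all add: U_def space2_def)
  have Uadd: "a + b \<in> U" if "a \<in> U" "b \<in> U" for a b using that by (simp add: U_def)
  have U0: "0 \<in> U" by (simp add: U_def)
  have Ucomb: "(\<lambda>a. comb n a \<phi>) ` {a \<in> space2 n. dot n a u = 0} = U"
  proof -
    have "{a \<in> space2 n. dot n a u = 0} = U" unfolding U_def u_def using n by simp
    moreover have "(\<lambda>a. comb n a \<phi>) ` U = (\<lambda>a. a) ` U"
      by (rule image_cong) (simp_all add: U_def \<phi>_def comb_unit_mat)
    ultimately show ?thesis by simp
  qed
  define P where "P = (\<lambda>k. \<phi> + outer u k)"
  have P0: "P 0 = \<phi>" by (simp add: P_def)
  have FR: "P k \<in> full_rank n r \<longleftrightarrow> \<not> (k \<in> space2 n \<and> k 0 = 1)" if k: "k \<in> space2 r" for k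
  proof -
    have "(\<forall>a\<in>space2 n. dot n a u = 1 \<longrightarrow> k \<noteq> comb n a \<phi>) \<longleftrightarrow> (\<forall>a\<in>space2 n. a 0 = 1 \<longrightarrow> k \<noteq> a)"
      by (rule ball_cong [OF refl]) (use n in \<open>simp add: \<phi>_def comb_unit_mat u_def\<close>)
    then show ?thesis unfolding P_def full_rank_add_outer_iff [OF \<phi> uv(1) k] by blast
  qed
  have FRn: "P k \<in> full_rank n r" if "k \<in> space2 r" "k n = 1 \<or> k (Suc n) = 1" for k
    using FR [OF that(1)] that(2) by (auto simp: space2_def)
  define X where "X = tee n r \<phi> u"
  have X: "X \<in> mat_tees n r" using \<phi> uv by (auto simp: mat_tees_def X_def)
  have XFR: "X \<subseteq> full_rank n r" by (rule mat_tees_subset [OF X])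
  have PX: "P k \<in> X" if "k \<in> space2 r" "P k \<in> full_rank n r" for k
    using that by (auto simp: X_def tee_def P_def)
  have XP: "\<exists>k. k \<in> space2 r \<and> x = P k \<and> P k \<in> full_rank n r" if "x \<in> X" for x
    using that by (auto simp: X_def tee_def P_def)
  have Padj: "madj n r (P k) (P l) \<longleftrightarrow> k + l \<notin> U"
    if "k \<in> space2 r" "P k \<in> full_rank n r" "l \<in> space2 r" "P l \<in> full_rank n r" for k l
    using madj_tee_iff [OF \<phi> uv(1,3), of k l] that unfolding Ucomb P_def by blast
  \<comment> \<open>Translation by \<open>w\<close> exchanges the parts of \<open>f + g\<close> and
    \<open>f + u\<close>. The predicate \<open>Q\<close> describes their union, the only region that
    the permutation moves. Here \<open>u\<close> doubles as a row vector.\<close>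
  define w where "w = g + u"
  have w: "w \<in> space2 r" using fg ur by (simp add: w_def)
  define Q where "Q = (\<lambda>k. k + f + g \<in> U \<or> k + f + u \<in> U)"
  have Qw: "Q (k + w) \<longleftrightarrow> Q k" for k
  proof -
    have *: "k + w + f + g = k + f + u" "k + w + f + u = k + f + g"
      by (simp_all add: w_def add.assoc add.commute add.left_commute)
    show ?thesis unfolding Q_def * by blast
  qed
  have Qn: "k n = 1" if "Q k" for k
    using that Un(1) [of "k + f + g"] Un(1) [of "k + f + u"] at by (cases "k n") (auto simp: Q_def)
  \<comment> \<open>Since \<open>u 0 = 1\<close>, row \<open>0\<close> of \<open>P k\<close> plus
    row \<open>0\<close> of \<open>\<phi>\<close> is \<open>k\<close>.\<close>
  define \<pi> where "\<pi> = (\<lambda>x. if Q (x 0 + \<phi> 0) then x + outer u w else x)"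
  have \<pi>P: "\<pi> (P k) = P (if Q k then k + w else k)" for k
  proof -
    have "P k 0 = \<phi> 0 + k" using at by (simp add: P_def)
    then have "P k 0 + \<phi> 0 = k" by (metis add.commute add_self_left)
    then show ?thesis by (simp add: \<pi>_def P_def outer_add_right add.assoc)
  qed
  have sw: "(if Q k then k + w else k) \<in> space2 r" if "k \<in> space2 r" for k using that w by simp
  have sFR: "P (if Q k then k + w else k) \<in> full_rank n r" if "k \<in> space2 r" "P k \<in> full_rank n r" for k
  proof (cases "Q k")
    case True
    then have "Q (k + w)" using Qw by blast
    then have "(k + w) n = 1" by (rule Qn)
    then show ?thesis using FRn [of "k + w"] that(1) w True by simp
  qed (use that in simp)
  have \<pi>X: "\<pi> x \<in> X" and \<pi>\<pi>: "\<pi> (\<pi> x) = x" if x: "x \<in> X" for x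
  proof -
    obtain k where k: "k \<in> space2 r" "x = P k" "P k \<in> full_rank n r" using XP [OF x] by blast
    show "\<pi> x \<in> X" unfolding k(2) \<pi>P by (rule PX [OF sw [OF k(1)] sFR [OF k(1,3)]])
    show "\<pi> (\<pi> x) = x" unfolding k(2) \<pi>P using Qw by (simp add: add.assoc)
  qed
  have VX: "verts (induced ?M X) = X" using XFR by auto
  have "graph_iso \<pi> (induced ?M X) (induced ?M X)"
    unfolding graph_iso_def VX
  proof (intro conjI ballI)
    show "bij_betw \<pi> X X" by (rule bij_betw_byWitness [where f' = \<pi>]) (use \<pi>\<pi> \<pi>X in auto)
    fix x y assume xy: "x \<in> X" "y \<in> X"
    obtain k where k: "k \<in> space2 r" "x = P k" "P k \<in> full_rank n r" using XP [OF xy(1)] by blast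
    obtain l where l: "l \<in> space2 r" "y = P l" "P l \<in> full_rank n r" using XP [OF xy(2)] by blast
    \<comment> \<open>The region \<open>Q\<close> is a union of parts, so points inside and outside
      it are always adjacent.\<close>
    have mixed: "a + b \<notin> U" if ab: "Q a" "\<not> Q b" for a b
    proof
      assume U: "a + b \<in> U"
      have "b + f + z = (a + b) + (a + f + z)" for z
        by (simp add: add.assoc add.commute add.left_commute)
      then have "a + f + z \<in> U \<Longrightarrow> b + f + z \<in> U" for z using Uadd [OF U] by metis
      then show False using ab by (auto simp: Q_def)
    qed
    let ?k = "if Q k then k + w else k" and ?l = "if Q l then l + w else l"
    have "?k + ?l \<in> U \<longleftrightarrow> k + l \<in> U"
    proof (cases "Q k = Q l")
      case True
      have "(k + w) + (l + w) = k + l" by (simp add: add.assoc add.commute add.left_commute)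
      then show ?thesis using True by auto
    next
      case False
      then show ?thesis
      proof (cases "Q k")
        case True
        then show ?thesis using False mixed [of k l] mixed [of "k + w" l] Qw by simp
      next
        case nk: False
        then have ql: "Q l" using False by simp
        have "l + k \<notin> U" "(l + w) + k \<notin> U" using mixed [of l k] mixed [of "l + w" k] Qw nk ql by blast+
        moreover have "l + k = k + l" "(l + w) + k = k + (l + w)" by (simp_all add: add.commute)
        ultimately show ?thesis using nk ql by simp
      qed
    qed
    then have "madj n r (\<pi> x) (\<pi> y) \<longleftrightarrow> madj n r x y"
      unfolding k(2) l(2) \<pi>P Padj [OF k(1,3) l(1,3)] Padj [OF sw [OF k(1)] sFR [OF k(1,3)] sw [OF l(1)] sFR [OF l(1,3)]]
      by simp
    then show "{x, y} \<in> edges (induced ?M X) \<longleftrightarrow> {\<pi> x, \<pi> y} \<in> edges (induced ?M X)"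
      using xy \<pi>X by (simp only: induced_mat_edge_iff [OF XFR])
  qed
  then obtain h where h: "automorphism ?M h" "\<forall>y\<in>X. h y = \<pi> y"
    using ultra X unfolding ultrahomogeneous_wrt_def by blast
  have hX: "h ` X = X"
  proof -
    have "h ` X = \<pi> ` X" using h(2) by (intro image_cong) auto
    moreover have "\<pi> ` X = X" using \<pi>X \<pi>\<pi> by (auto simp: image_iff) metis
    ultimately show ?thesis by simp
  qed
  have hP: "h (P k) = P (if Q k then k + w else k)" if "k \<in> space2 r" "P k \<in> full_rank n r" for k
    using h(2) PX [OF that] \<pi>P by simp
  have nU: "a \<notin> U" if "a n = 1 \<or> a (Suc n) = 1 \<or> a 0 = 1" for a using Un [of a] that by auto
  have nQ: "\<not> Q 0" "\<not> Q f" "\<not> Q g" unfolding Q_def using at by (simp_all add: nU)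
  have Qfg: "Q (f + g)" unfolding Q_def using U0 by (simp add: add.assoc add.commute add.left_commute)
  have fgw: "f + g + w = f + u" by (simp add: w_def add.assoc)
  have FRs: "P 0 \<in> full_rank n r" "P f \<in> full_rank n r" "P g \<in> full_rank n r" "P (f + g) \<in> full_rank n r"
    using \<phi> FRn [of f] FRn [of g] FRn [of "f + g"] at fg by (simp_all add: P0)
  have h1: "h \<phi> = \<phi>" using hP [OF space2_0 FRs(1)] nQ(1) by (simp add: P0)
  have h2: "h (P f) = P f" using hP [OF fg(1) FRs(2)] nQ(2) by simp
  have h3: "h (P g) = P g" using hP [OF fg(2) FRs(3)] nQ(3) by simp
  have h4: "h (P (f + g)) = P (f + u)" using hP [of "f + g"] fg FRs(4) Qfg fgw by simp
  have fn: "f \<notin> row_space n \<phi>"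
    unfolding f_def \<phi>_def row_space_unit_mat by (rule unit2_notin_space2) simp
  have rsP: "row_space n (\<phi> + outer c k) \<subseteq> {x. \<exists>a\<in>space2 n. \<exists>b. x = a + scale2 b k}" for c k
    by (auto simp: row_space_def \<phi>_def comb_unit_mat)
  have fPg: "f \<notin> row_space n (P g)"
  proof
    assume "f \<in> row_space n (P g)"
    then obtain a b where ab: "a \<in> space2 n" "f = a + scale2 b g" using rsP unfolding P_def by blast
    from fun_cong [OF ab(2), of n] show False using ab(1) at by (simp add: space2_def)
  qed
  have L: "line n \<phi> f \<in> mat_lines n r" using \<phi> fg fn by (auto simp: mat_lines_def)
  have M: "line n (P g) f \<in> mat_lines n r" using FRs fg fPg by (auto simp: mat_lines_def)
  \<comment> \<open>The vertices \<open>x\<close> and \<open>y\<close> lie on the two lines with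
    direction \<open>f\<close> through \<open>\<phi>\<close> and \<open>P g\<close>; they are
    adjacent and \<open>x\<close> is outside the tee.\<close>
  define x where "x = \<phi> + outer v f"
  define y where "y = x + outer u g"
  have xL: "x \<in> line n \<phi> f" using uv by (simp add: x_def line_def)
  have yP: "y = P g + outer v f" unfolding y_def x_def P_def by (simp add: add.assoc add.commute)
  have yM: "y \<in> line n (P g) f" using uv by (simp add: yP line_def)
  have xFR: "x \<in> full_rank n r" using xL mat_lines_subset [OF L] by blast
  have gx: "g \<notin> row_space n x"
  proof
    assume "g \<in> row_space n x"
    then obtain a b where ab: "a \<in> space2 n" "g = a + scale2 b f" using rsP unfolding x_def by blast
    from fun_cong [OF ab(2), of "Suc n"] show False using ab(1) at by (simp add: space2_def)
  qed
  have adj: "madj n r x y" unfolding madj_def y_def using uv fg gx by blast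
  have "h ` line n \<phi> f = line n \<phi> f"
  proof (rule mat_lines_unique [OF automorphism_image_mat_lines [OF n(1) nr h(1) L] _ _ uv(3) fg(3)])
    show "\<phi> \<in> h ` line n \<phi> f" using line_self h1 by (metis imageI)
    have "P f \<in> line n \<phi> f" using uv by (simp add: line_def P_def)
    then have "P f \<in> h ` line n \<phi> f" using h2 by (metis imageI)
    then show "\<phi> + outer u f \<in> h ` line n \<phi> f" by (simp add: P_def)
  qed
  then have hx: "h x \<in> line n \<phi> f" using xL by blast
  \<comment> \<open>The direction of the image of the second line: it joins \<open>P g\<close> to
    \<open>P (f + u)\<close>, the image of \<open>P (f + g)\<close>.\<close>
  define k where "k = g + f + u"
  have k0: "k \<noteq> 0" using at by (auto simp: k_def fun_eq_iff intro!: exI [of _ "Suc n"])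
  have "h ` line n (P g) f = line n (P g) k"
  proof (rule mat_lines_unique [OF automorphism_image_mat_lines [OF n(1) nr h(1) M] _ _ uv(3) k0])
    show "P g \<in> h ` line n (P g) f" using line_self h3 by (metis imageI)
    have "P (f + g) = P g + outer u f" by (simp add: P_def outer_add_right add.assoc add.commute)
    then have "P (f + g) \<in> line n (P g) f" using uv by (simp add: line_def)
    then have "P (f + u) \<in> h ` line n (P g) f" using h4 by (metis imageI)
    moreover have "P g + outer u k = P (f + u)" by (simp add: P_def k_def outer_add_right add.assoc)
    ultimately show "P g + outer u k \<in> h ` line n (P g) f" by simp
  qed
  then have hy: "h y \<in> line n (P g) k" using yM by blast
  obtain c where c: "h x = \<phi> + outer c f" using hx by (auto simp: line_def)
  obtain d where d: "h y = P g + outer d k" using hy by (auto simp: line_def)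
  have "madj n r (h x) (h y)" by (rule automorphism_madj [OF h(1) xFR adj])
  then obtain e m where em: "h y = h x + outer e m" by (rule madjE)
  \<comment> \<open>Columns \<open>0\<close>, \<open>n\<close> and \<open>Suc n\<close> separate
    \<open>u\<close>, \<open>f\<close> and \<open>g\<close>. They force \<open>e = u\<close> and
    make \<open>c\<close> a multiple of \<open>u\<close>, so \<open>h x\<close> would lie in the tee
    although \<open>x\<close> does not.\<close>
  have entry: "u i * g j + d i * k j = c i * f j + e i * m j" for i j
    using fun_cong [OF fun_cong [OF em [unfolded c d P_def], of i], of j] by (simp add: add.assoc)
  have kat: "k 0 = 1" "k n = 1" "k (Suc n) = 1" using at by (simp_all add: k_def)
  have c0: "d = scale2 (m 0) e"
    using entry [of _ 0] at kat by (intro ext) (simp add: mult.commute)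
  have cn: "d + c = scale2 (m n) e"
  proof
    fix i
    have "d i = c i + e i * m n" using entry [of i n] at kat by simp
    then show "(d + c) i = scale2 (m n) e i" by (simp add: add.commute add.left_commute mult.commute)
  qed
  have cg: "u + d = scale2 (m (Suc n)) e"
    using entry [of _ "Suc n"] at kat by (intro ext) (simp add: mult.commute)
  have sum: "scale2 a e + scale2 b e = scale2 (a + b) e" for a b
    by (simp add: fun_eq_iff distrib_right)
  have "u = scale2 (m (Suc n)) e + d" using cg by (metis add.commute add_self_left)
  then have "u = e" using scale2_eq_self [of u "m (Suc n) + m 0" e] uv(3) by (simp add: c0 sum)
  moreover have "c = scale2 (m n) e + d" using cn by (metis add.commute add_self_left)
  ultimately have "c = scale2 (m n + m 0) u" by (simp add: c0 sum)
  then have "outer c f = outer u (scale2 (m n + m 0) f)" by (simp add: fun_eq_iff mult.assoc mult.left_commute)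
  then have "h x = P (scale2 (m n + m 0) f)" using c by (simp add: P_def)
  moreover have "h x \<in> full_rank n r" using graph_isoD(4) [OF h(1), of x] xFR by simp
  ultimately have "h x \<in> h ` X" using PX [of "scale2 (m n + m 0) f"] fg hX by simp
  moreover have "x \<notin> X"
  proof
    assume "x \<in> X"
    then obtain k where "\<phi> + outer v f = \<phi> + outer u k" by (auto simp: X_def tee_def x_def)
    then have "outer v f = outer u k" by simp
    then have "v = u" using outer_eq_outer(1) uv fg by blast
    then show False using uv by simp
  qed
  ultimately show False using automorphism_notin_image [OF h(1) XFR xFR] by blast
qed

section \<open>Subspaces and binary representation\<close>

lemma subspace2_iff: "F2.subspace S \<longleftrightarrow> 0 \<in> S \<and> (\<forall>x\<in>S. \<forall>y\<in>S. x + y \<in> S)"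
proof
  assume "F2.subspace S"
  then show "0 \<in> S \<and> (\<forall>x\<in>S. \<forall>y\<in>S. x + y \<in> S)"
    by (simp add: F2.subspace_0 F2.subspace_add)
next
  assume S: "0 \<in> S \<and> (\<forall>x\<in>S. \<forall>y\<in>S. x + y \<in> S)"
  have "scale2 c x \<in> S" if "x \<in> S" for c x
    using S that by (cases c) simp_all
  then show "F2.subspace S" using S by (intro F2.subspaceI) simp_all
qed

text \<open>Each new independent vector adds a disjoint translate of the span and so doubles
  it.\<close>

lemma card_span2:
  notes scale2_apply [simp del]
  assumes "finite B" "\<not> F2.dependent B"
  shows "finite (F2.span B) \<and> card (F2.span B) = 2 ^ card B"
  using assms
proof (induction B rule: finite_induct)
  case (insert b B)
  have ind: "\<not> F2.dependent B" "b \<notin> F2.span B"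
    using insert.prems insert.hyps(2) by (metis F2.independent_insert)+
  let ?S = "F2.span B"
  have IH: "finite ?S" "card ?S = 2 ^ card B" using insert.IH [OF ind(1)] by simp_all
  have "F2.span (insert b B) = ?S \<union> (\<lambda>x. b + x) ` ?S"
  proof (intro equalityI subsetI)
    fix x assume "x \<in> F2.span (insert b B)"
    then obtain k where k: "x + scale2 k b \<in> ?S" by (auto simp: F2.span_insert)
    show "x \<in> ?S \<union> (\<lambda>x. b + x) ` ?S"
    proof (cases k)
      case zero
      then show ?thesis using k by simp
    next
      case one
      have "x = b + (x + b)" by (simp add: add.commute [of x])
      then show ?thesis using k one by (metis UnI2 imageI scale2_1)
    qed
  next
    fix x assume "x \<in> ?S \<union> (\<lambda>x. b + x) ` ?S"
    moreover have "?S \<subseteq> F2.span (insert b B)" by (rule F2.span_mono) auto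
    moreover have "b \<in> F2.span (insert b B)" by (rule F2.span_base) simp
    ultimately show "x \<in> F2.span (insert b B)" by (auto intro: F2.span_add)
  qed
  moreover have "?S \<inter> (\<lambda>x. b + x) ` ?S = {}"
  proof (rule ccontr)
    assume "?S \<inter> (\<lambda>x. b + x) ` ?S \<noteq> {}"
    then obtain x where x: "x \<in> ?S" "b + x \<in> ?S" by auto
    then have "b + x + x \<in> ?S" using F2.span_add by blast
    then have "b \<in> ?S" by (simp only: add.assoc add_self add_0_right)
    with ind(2) show False ..
  qed
  moreover have "card ((\<lambda>x. b + x) ` ?S) = card ?S" by (intro card_image) (simp add: inj_on_def)
  ultimately show ?case
    using IH insert.hyps by (simp add: card_Un_disjoint)
qed (simp add: F2.span_empty)

text \<open>Dimension is replaced by cardinality, so that the dimension conditions on pencils become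
  counting.\<close>

lemma linear_subspace_iff:
  "linear_subspace r d S \<longleftrightarrow>
     S \<subseteq> space2 r \<and> 0 \<in> S \<and> (\<forall>x\<in>S. \<forall>y\<in>S. x + y \<in> S) \<and> card S = 2 ^ d"
proof -
  have "card S = 2 ^ F2.dim S" if S: "S \<subseteq> space2 r" "F2.subspace S"
  proof -
    obtain B where B: "B \<subseteq> S" "\<not> F2.dependent B" "S \<subseteq> F2.span B" "card B = F2.dim S"
      by (rule F2.basis_exists)
    have "F2.span B = S" using B S(2) F2.span_minimal by blast
    moreover have "finite B" using B(1) S(1) finite_space2 finite_subset by metis
    ultimately show ?thesis using card_span2 [of B] B(2,4) by simp
  qed
  then show ?thesis
    unfolding linear_subspace_def subspace2_iff by (metis nat_power_eq_Suc_0_iff power_inject_exp one_less_numeral_iff semiring_norm(76))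
qed

section \<open>Integers as binary vectors\<close>

lemma vec_of_nat_space2: "k < 2 ^ n \<Longrightarrow> vec_of_nat k \<in> space2 n"
  unfolding space2_def vec_of_nat_def
  by (auto simp: not_le) (metis bit_take_bit_iff linorder_not_less take_bit_nat_eq_self_iff)

lemma vec_of_nat_eq_iff: "vec_of_nat k = vec_of_nat l \<longleftrightarrow> k = l"
proof
  assume eq: "vec_of_nat k = vec_of_nat l"
  have "bit k i \<longleftrightarrow> bit l i" for i
    using fun_cong [OF eq, of i] by (simp add: vec_of_nat_def of_bool_def split: if_splits)
  then show "k = l" by (simp add: bit_eq_iff)
qed simp

lemma vec_of_nat_0 [simp]: "vec_of_nat 0 = 0"
  by (simp add: vec_of_nat_def fun_eq_iff)

lemma vec_of_nat_eq_0_iff [simp]: "vec_of_nat k = 0 \<longleftrightarrow> k = 0"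
  using vec_of_nat_eq_iff [of k 0] by simp

lemma image_vec_of_nat: "vec_of_nat ` {..<2 ^ n} = space2 n"
proof (rule card_subset_eq)
  show "vec_of_nat ` {..<2 ^ n} \<subseteq> space2 n" using vec_of_nat_space2 by auto
  have "inj_on vec_of_nat {..<2 ^ n}" by (simp add: inj_on_def vec_of_nat_eq_iff)
  then show "card (vec_of_nat ` {..<2 ^ n}) = card (space2 n)" by (simp add: card_image)
qed simp

section \<open>Pencils of full rank matrices\<close>

text \<open>The condition \<open>x \<noteq> 0\<close> only affects the class with label
  \<open>0\<close>, which has to omit the zero vector.\<close>

definition pencil_of :: "nat \<Rightarrow> nat \<Rightarrow> (nat \<Rightarrow> vec2) \<Rightarrow> pencil" where
  "pencil_of n r \<phi> = map (\<lambda>i. {x \<in> space2 r. x \<noteq> 0 \<and> mv r \<phi> x = vec_of_nat i}) [0..<2 ^ n]"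

lemma length_pencil_of [simp]: "length (pencil_of n r \<phi>) = 2 ^ n"
  by (simp add: pencil_of_def)

lemma nth_pencil_of: "i < 2 ^ n \<Longrightarrow> pencil_of n r \<phi> ! i = {x \<in> space2 r. x \<noteq> 0 \<and> mv r \<phi> x = vec_of_nat i}"
  by (simp add: pencil_of_def)

lemma nth_pencil_of_pos:
  "i < 2 ^ n \<Longrightarrow> 0 < i \<Longrightarrow> pencil_of n r \<phi> ! i = {x \<in> space2 r. mv r \<phi> x = vec_of_nat i}"
proof -
  assume i: "i < 2 ^ n" "0 < i"
  have "vec_of_nat i \<noteq> 0" using i(2) by (simp only: vec_of_nat_eq_0_iff)
  then have "x \<noteq> 0" if "mv r \<phi> x = vec_of_nat i" for x using that mv_0 [of r \<phi>] by metis
  then show ?thesis using nth_pencil_of [OF i(1)] by auto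
qed

lemma insert_0_kernel:
  "insert 0 {x \<in> space2 r. x \<noteq> 0 \<and> mv r \<phi> x = 0} = {x \<in> space2 r. mv r \<phi> x = 0}"
proof -
  have "x \<in> insert 0 {x \<in> space2 r. x \<noteq> 0 \<and> mv r \<phi> x = 0} \<longleftrightarrow> x \<in> {x \<in> space2 r. mv r \<phi> x = 0}" for x
    by (cases "x = 0") simp_all
  then show ?thesis by blast
qed

lemma insert_0_nth_pencil_of: "insert 0 (pencil_of n r \<phi> ! 0) = {x \<in> space2 r. mv r \<phi> x = 0}"
proof -
  have eq: "pencil_of n r \<phi> ! 0 = {x \<in> space2 r. x \<noteq> 0 \<and> mv r \<phi> x = 0}"
    using nth_pencil_of [of 0 n r \<phi>] by simp
  show ?thesis unfolding eq by (rule insert_0_kernel)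
qed

lemma set_tl_nth: "length v = Suc m \<Longrightarrow> set (tl v) = (!) v ` {1..m}"
proof -
  assume len: "length v = Suc m"
  have "set (tl v) = (!) (tl v) ` {..<m}"
    using nth_image [of m "tl v"] len by (simp add: lessThan_atLeast0)
  also have "\<dots> = (\<lambda>i. v ! Suc i) ` {..<m}" using len by (intro image_cong) (simp_all add: nth_tl)
  also have "\<dots> = (!) v ` Suc ` {..<m}" by (simp add: image_image)
  also have "Suc ` {..<m} = {1..m}" by (simp add: lessThan_atLeast0 image_Suc_atLeastLessThan atLeastLessThanSuc_atLeastAtMost)
  finally show ?thesis .
qed

lemma distinct_tl_nth: "length v = Suc m \<Longrightarrow> distinct (tl v) \<longleftrightarrow> inj_on ((!) v) {1..m}"
proof -
  assume len: "length v = Suc m"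
  have "distinct (tl v) \<longleftrightarrow> card (set (tl v)) = length (tl v)"
    by (metis card_distinct distinct_card)
  also have "\<dots> \<longleftrightarrow> card ((!) v ` {1..m}) = card {1..m}" using len by (simp add: set_tl_nth)
  also have "\<dots> \<longleftrightarrow> inj_on ((!) v) {1..m}" by (simp add: inj_on_iff_eq_card)
  finally show ?thesis .
qed

text \<open>The tail of the list is replaced by the indices from \<open>1\<close> on, since these
  are the labels.\<close>

lemma ordered_pencil_iff:
  "ordered_pencil r \<sigma> v \<longleftrightarrow> length v = 2 ^ (r - \<sigma>) \<and> 0 \<notin> v ! 0 \<and>
     linear_subspace r \<sigma> (insert 0 (v ! 0)) \<and> inj_on ((!) v) {1..2 ^ (r - \<sigma>) - 1} \<and>
     (!) v ` {1..2 ^ (r - \<sigma>) - 1} = cosets r (insert 0 (v ! 0)) - {insert 0 (v ! 0)}"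
proof (cases "length v = 2 ^ (r - \<sigma>)")
  case True
  then have len: "length v = Suc (2 ^ (r - \<sigma>) - 1)" by simp
  show ?thesis
    unfolding ordered_pencil_def Let_def set_tl_nth [OF len] distinct_tl_nth [OF len] by blast
qed (simp add: ordered_pencil_def)

lemma mv_surjE:
  assumes "\<phi> \<in> full_rank n r" "y \<in> space2 n"
  obtains a where "a \<in> space2 r" "mv r \<phi> a = y"
proof -
  have "y \<in> mv r \<phi> ` space2 r" unfolding mv_surj [OF assms(1)] by (rule assms(2))
  then show ?thesis by (elim imageE) (rule that, simp_all)
qed

lemma coset_kernel_eq:
  assumes a: "a \<in> space2 r"
  shows "(\<lambda>x. a + x) ` {x \<in> space2 r. mv r \<phi> x = 0} = {x \<in> space2 r. mv r \<phi> x = mv r \<phi> a}"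
proof (intro equalityI subsetI)
  fix x assume x: "x \<in> {x \<in> space2 r. mv r \<phi> x = mv r \<phi> a}"
  show "x \<in> (\<lambda>x. a + x) ` {x \<in> space2 r. mv r \<phi> x = 0}"
    by (rule image_eqI [of _ _ "a + x"]) (use x a in simp_all)
next
  fix x assume "x \<in> (\<lambda>x. a + x) ` {x \<in> space2 r. mv r \<phi> x = 0}"
  then obtain b where "b \<in> {x \<in> space2 r. mv r \<phi> x = 0}" "x = a + b" by (elim imageE)
  then show "x \<in> {x \<in> space2 r. mv r \<phi> x = mv r \<phi> a}" using a by simp
qed

lemma cosets_kernel:
  assumes \<phi>: "\<phi> \<in> full_rank n r"
  shows "cosets r {x \<in> space2 r. mv r \<phi> x = 0} = (\<lambda>y. {x \<in> space2 r. mv r \<phi> x = y}) ` space2 n"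
proof -
  have "cosets r {x \<in> space2 r. mv r \<phi> x = 0} = (\<lambda>a. {x \<in> space2 r. mv r \<phi> x = mv r \<phi> a}) ` space2 r"
    unfolding cosets_def by (rule image_cong [OF refl coset_kernel_eq])
  also have "\<dots> = (\<lambda>y. {x \<in> space2 r. mv r \<phi> x = y}) ` mv r \<phi> ` space2 r"
    by (simp only: image_image)
  finally show ?thesis unfolding mv_surj [OF \<phi>] .
qed

lemma mv_class_coset:
  assumes "\<phi> \<in> full_rank n r" "y \<in> space2 n"
  shows "{x \<in> space2 r. mv r \<phi> x = y} \<in> cosets r {x \<in> space2 r. mv r \<phi> x = 0}"
  unfolding cosets_kernel [OF assms(1)] using assms(2)
  by (rule imageI [where f = "\<lambda>y. {x \<in> space2 r. mv r \<phi> x = y}"])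

lemma inj_on_mv_class:
  assumes \<phi>: "\<phi> \<in> full_rank n r"
  shows "inj_on (\<lambda>y. {x \<in> space2 r. mv r \<phi> x = y}) (space2 n)"
proof (rule inj_onI)
  fix y z assume y: "y \<in> space2 n" and eq: "{x \<in> space2 r. mv r \<phi> x = y} = {x \<in> space2 r. mv r \<phi> x = z}"
  obtain a where a: "a \<in> space2 r" "mv r \<phi> a = y" by (rule mv_surjE [OF \<phi> y])
  then have "a \<in> {x \<in> space2 r. mv r \<phi> x = z}" unfolding eq [symmetric] by simp
  then show "y = z" using a(2) by simp
qed

lemma linear_subspace_kernel:
  assumes "\<phi> \<in> full_rank n r"
  shows "linear_subspace r (r - n) {x \<in> space2 r. mv r \<phi> x = 0}"
  unfolding linear_subspace_iff using card_mv_fibre [OF assms space2_0] by auto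

lemma ordered_pencil_of:
  assumes \<phi>: "\<phi> \<in> full_rank (r - \<sigma>) r" and \<sigma>: "\<sigma> \<le> r"
  shows "ordered_pencil r \<sigma> (pencil_of (r - \<sigma>) r \<phi>)"
proof -
  let ?n = "r - \<sigma>" and ?v = "pencil_of (r - \<sigma>) r \<phi>"
  let ?C = "\<lambda>y. {x \<in> space2 r. mv r \<phi> x = y}"
  have nth: "?v ! i = ?C (vec_of_nat i)" if "i \<in> {1..2 ^ ?n - 1}" for i
    by (rule nth_pencil_of_pos) (use that in auto)
  have I: "vec_of_nat ` {1..2 ^ ?n - 1} = space2 ?n - {0}"
  proof -
    have "{1..2 ^ ?n - 1} = {..<2 ^ ?n} - {0::nat}" by auto
    then have "vec_of_nat ` {1..2 ^ ?n - 1} = vec_of_nat ` ({..<2 ^ ?n} - {0})" by simp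
    also have "\<dots> = vec_of_nat ` {..<2 ^ ?n} - vec_of_nat ` {0}"
      by (rule inj_on_image_set_diff [of _ UNIV]) (simp_all add: inj_on_def vec_of_nat_eq_iff)
    finally show ?thesis unfolding image_vec_of_nat by simp
  qed
  have "(!) ?v ` {1..2 ^ ?n - 1} = ?C ` vec_of_nat ` {1..2 ^ ?n - 1}"
    unfolding image_image by (rule image_cong [OF refl nth])
  also have "\<dots> = ?C ` space2 ?n - ?C ` {0}"
    unfolding I by (rule inj_on_image_set_diff [OF inj_on_mv_class [OF \<phi>]]) auto
  finally have im: "(!) ?v ` {1..2 ^ ?n - 1} = cosets r (?C 0) - {?C 0}"
    unfolding cosets_kernel [OF \<phi>] by simp
  have "inj_on ((!) ?v) {1..2 ^ ?n - 1}"
  proof (rule inj_onI)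
    fix i j assume ij: "i \<in> {1..2 ^ ?n - 1}" "j \<in> {1..2 ^ ?n - 1}" "?v ! i = ?v ! j"
    have "vec_of_nat i \<in> space2 ?n" "vec_of_nat j \<in> space2 ?n" using ij I by blast+
    then have "vec_of_nat i = vec_of_nat j"
      using inj_onD [OF inj_on_mv_class [OF \<phi>]] ij(3) unfolding nth [OF ij(1)] nth [OF ij(2)] by blast
    then show "i = j" by (simp add: vec_of_nat_eq_iff)
  qed
  moreover have "linear_subspace r \<sigma> (?C 0)"
    using linear_subspace_kernel [OF \<phi>] \<sigma> by simp
  moreover have "0 \<notin> ?v ! 0" using nth_pencil_of [of 0 ?n r \<phi>] by simp
  ultimately show ?thesis
    unfolding ordered_pencil_iff insert_0_nth_pencil_of using im by simp
qed

section \<open>From ordered pencils to labellings and matrices\<close>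

lemma coset_mem_eq:
  assumes S: "0 \<in> S" "\<And>x y. x \<in> S \<Longrightarrow> y \<in> S \<Longrightarrow> x + y \<in> S"
  shows "(\<lambda>z. x + z) ` S = (\<lambda>z. y + z) ` S \<longleftrightarrow> (x::vec2) + y \<in> S"
proof
  assume "(\<lambda>z. x + z) ` S = (\<lambda>z. y + z) ` S"
  moreover have "x \<in> (\<lambda>z. x + z) ` S" by (rule image_eqI [of _ _ 0]) (simp_all add: S)
  ultimately obtain s where s: "s \<in> S" "x = y + s" by blast
  then have "x + y = s" by (metis add.commute add_self_left)
  then show "x + y \<in> S" using s(1) by simp
next
  assume xy: "x + y \<in> S"
  have "(\<lambda>z. a + z) ` S \<subseteq> (\<lambda>z. b + z) ` S" if "a + b \<in> S" for a b
  proof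
    fix w assume "w \<in> (\<lambda>z. a + z) ` S"
    then obtain s where s: "s \<in> S" "w = a + s" by blast
    show "w \<in> (\<lambda>z. b + z) ` S"
    proof (rule image_eqI)
      show "w = b + ((a + b) + s)" unfolding s(2) by (simp add: add.assoc add.left_commute [of a b])
      show "(a + b) + s \<in> S" using S(2) that s(1) by blast
    qed
  qed
  from this [of x y] this [of y x] xy show "(\<lambda>z. x + z) ` S = (\<lambda>z. y + z) ` S"
    by (simp add: add.commute [of y x] subset_antisym)
qed

text \<open>An ordered pencil is a surjective labelling whose fibres are the cosets of
  \<open>S\<close>. Additivity is not claimed; it may fail for a single pencil and comes from
  adjacency.\<close>

lemma pencil_label:
  assumes v: "ordered_pencil r \<sigma> v" and n: "n = r - \<sigma>" and S: "S = insert 0 (v ! 0)"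
  obtains \<theta> where "\<theta> ` space2 r = space2 n"
    "\<And>x y. x \<in> space2 r \<Longrightarrow> y \<in> space2 r \<Longrightarrow> \<theta> x = \<theta> y \<longleftrightarrow> x + y \<in> S"
    "\<And>i. i < 2 ^ n \<Longrightarrow> v ! i = {x \<in> space2 r. x \<noteq> 0 \<and> \<theta> x = vec_of_nat i}"
proof -
  have v0: "0 \<notin> v ! 0" and lin: "linear_subspace r \<sigma> S" and inj: "inj_on ((!) v) {1..2 ^ n - 1}"
    and cos: "(!) v ` {1..2 ^ n - 1} = cosets r S - {S}"
    using v unfolding ordered_pencil_iff S n by blast+
  have Ssub: "S \<subseteq> space2 r" and S0: "0 \<in> S" and Sadd: "\<And>x y. x \<in> S \<Longrightarrow> y \<in> S \<Longrightarrow> x + y \<in> S"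
    using lin by (auto simp: linear_subspace_iff)
  let ?c = "\<lambda>x. (\<lambda>z. x + z) ` S"
  have c_eq: "?c x = ?c y \<longleftrightarrow> x + y \<in> S" for x y by (rule coset_mem_eq [OF S0 Sadd])
  have c0: "?c 0 = S" by simp
  have cS: "?c x = S \<longleftrightarrow> x \<in> S" for x using c_eq [of x 0] c0 by simp
  have c_self: "x \<in> ?c x" for x by (rule image_eqI [of _ _ 0]) (simp_all add: S0)
  have ex: "\<exists>i. i \<in> {1..2 ^ n - 1} \<and> v ! i = ?c x" if "x \<in> space2 r" "x \<notin> S" for x
  proof -
    have "?c x \<in> cosets r S - {S}" using that cS by (auto simp: cosets_def)
    then have "?c x \<in> (!) v ` {1..2 ^ n - 1}" unfolding cos .
    then show ?thesis by (elim imageE) (auto intro: exI)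
  qed
  \<comment> \<open>The subspace \<open>S\<close> gets label \<open>0\<close>; any other vector gets
    the position of its coset in the list.\<close>
  define lab where "lab = (\<lambda>x. if x \<in> S then 0 else SOME i. i \<in> {1..2 ^ n - 1} \<and> v ! i = ?c x)"
  have lab: "lab x \<in> {1..2 ^ n - 1}" "v ! lab x = ?c x" if "x \<in> space2 r" "x \<notin> S" for x
    using someI_ex [OF ex [OF that]] that(2) by (simp_all add: lab_def)
  have lab0: "lab x = 0 \<longleftrightarrow> x \<in> S" if "x \<in> space2 r" for x
    using lab(1) [OF that] by (cases "x \<in> S") (auto simp: lab_def)
  have lab_less: "lab x < 2 ^ n" if "x \<in> space2 r" for x
    using lab(1) [OF that] lab0 [OF that] by (cases "x \<in> S") auto
  have lab_eq: "lab x = lab y \<longleftrightarrow> x + y \<in> S" if xy: "x \<in> space2 r" "y \<in> space2 r" for x y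
  proof (cases "x \<in> S \<or> y \<in> S")
    case True
    have "x + y \<in> S \<longleftrightarrow> x \<in> S \<and> y \<in> S"
    proof
      assume s: "x + y \<in> S"
      have "x + (x + y) = y" "(x + y) + y = x" by (simp_all add: add.assoc)
      then show "x \<in> S \<and> y \<in> S" using True Sadd s by metis
    qed (use Sadd in blast)
    moreover have "lab x = lab y \<longleftrightarrow> x \<in> S \<and> y \<in> S"
      using True lab0 [OF xy(1)] lab0 [OF xy(2)] by metis
    ultimately show ?thesis by simp
  next
    case False
    then have x: "lab x \<in> {1..2 ^ n - 1}" "v ! lab x = ?c x" and y: "lab y \<in> {1..2 ^ n - 1}" "v ! lab y = ?c y"
      using lab xy by blast+
    have "lab x = lab y \<longleftrightarrow> v ! lab x = v ! lab y"
      using inj_on_eq_iff [OF inj x(1) y(1)] by simp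
    then show ?thesis unfolding x(2) y(2) c_eq .
  qed
  have nth: "v ! i = {x \<in> space2 r. lab x = i}" if i: "i \<in> {1..2 ^ n - 1}" for i
  proof -
    have vi: "v ! i \<in> cosets r S - {S}" unfolding cos [symmetric] using i by (rule imageI)
    then obtain a where a: "a \<in> space2 r" "v ! i = ?c a" by (auto simp: cosets_def)
    have aS: "a \<notin> S" using vi a(2) cS by auto
    have la: "lab a = i"
      using inj_on_eq_iff [OF inj lab(1) [OF a(1) aS] i] lab(2) [OF a(1) aS] a(2) by simp
    show ?thesis
    proof (intro equalityI subsetI)
      fix x assume "x \<in> v ! i"
      then obtain s where s: "s \<in> S" "x = a + s" using a(2) by auto
      then have "x \<in> space2 r" "x + a \<in> S" using a(1) Ssub by (auto simp: add.commute)
      moreover from this have "lab x = lab a" using lab_eq a(1) by blast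
      ultimately show "x \<in> {x \<in> space2 r. lab x = i}" using la by simp
    next
      fix x assume "x \<in> {x \<in> space2 r. lab x = i}"
      then have "x \<in> space2 r" "lab x = lab a" using la by simp_all
      then have cx: "?c x = ?c a" using lab_eq a(1) c_eq by simp
      show "x \<in> v ! i" unfolding a(2) cx [symmetric] by (rule c_self)
    qed
  qed
  have nth0: "v ! 0 = {x \<in> space2 r. x \<noteq> 0 \<and> lab x = 0}"
  proof -
    have "v ! 0 = S - {0}" using v0 S by auto
    then show ?thesis using lab0 Ssub by auto
  qed
  have labz: "lab 0 = 0" using S0 by (simp add: lab_def)
  have nth': "v ! i = {x \<in> space2 r. x \<noteq> 0 \<and> lab x = i}" if "i < 2 ^ n" for i
  proof (cases "i = 0")
    case False
    then show ?thesis using nth [of i] that labz by auto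
  qed (simp add: nth0)
  have lab_im: "lab ` space2 r = {..<2 ^ n}"
  proof (intro equalityI subsetI)
    fix i assume i: "i \<in> {..<(2::nat) ^ n}"
    show "i \<in> lab ` space2 r"
    proof (cases "i = 0")
      case True
      then show ?thesis using labz by (intro image_eqI [of _ _ 0]) simp_all
    next
      case False
      then have i': "i \<in> {1..2 ^ n - 1}" using i by auto
      have "v ! i \<in> cosets r S" using cos i' by blast
      then have "v ! i \<noteq> {}" using S0 by (auto simp: cosets_def)
      then show ?thesis unfolding nth [OF i'] by blast
    qed
  qed (use lab_less in auto)
  show ?thesis
  proof (rule that [of "\<lambda>x. vec_of_nat (lab x)"])
    have "(\<lambda>x. vec_of_nat (lab x)) ` space2 r = vec_of_nat ` lab ` space2 r" by (simp add: image_image)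
    then show "(\<lambda>x. vec_of_nat (lab x)) ` space2 r = space2 n" unfolding lab_im image_vec_of_nat .
  qed (use lab_eq nth' in \<open>simp_all add: vec_of_nat_eq_iff\<close>)
qed

lemma mv_ext:
  assumes "\<And>i. \<phi> i \<in> space2 r" "\<And>i. \<psi> i \<in> space2 r" "\<And>x. x \<in> space2 r \<Longrightarrow> mv r \<phi> x = mv r \<psi> x"
  shows "\<phi> = \<psi>"
proof (intro ext)
  fix i j
  show "\<phi> i j = \<psi> i j"
  proof (cases "j < r")
    case True
    then show ?thesis using fun_cong [OF assms(3) [of "unit2 j"], of i] by (simp add: mv_apply)
  next
    case False
    then show ?thesis using assms(1) [of i] assms(2) [of i] by (simp add: space2_def)
  qed
qed

lemma pencil_of_inj: "inj_on (pencil_of n r) (full_rank n r)"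
proof (rule inj_onI)
  fix \<phi> \<psi> assume FR: "\<phi> \<in> full_rank n r" "\<psi> \<in> full_rank n r" and eq: "pencil_of n r \<phi> = pencil_of n r \<psi>"
  show "\<phi> = \<psi>"
  proof (rule mv_ext [OF full_rankD(1) [OF FR(1)] full_rankD(1) [OF FR(2)]])
    fix x assume x: "x \<in> space2 r"
    have "mv r \<phi> x \<in> vec_of_nat ` {..<2 ^ n}" unfolding image_vec_of_nat by (rule mv_full_rank [OF FR(1)])
    then obtain i where i: "i < 2 ^ n" "mv r \<phi> x = vec_of_nat i" by auto
    show "mv r \<phi> x = mv r \<psi> x"
    proof (cases "x = 0")
      case False
      then have "x \<in> pencil_of n r \<phi> ! i" using x i by (simp add: nth_pencil_of)
      then have "x \<in> pencil_of n r \<psi> ! i" unfolding eq .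
      then show ?thesis using i by (simp add: nth_pencil_of)
    qed simp
  qed
qed

text \<open>The columns of the matrix are the labels of the unit vectors, and surjectivity of the
  labelling gives full rank.\<close>

lemma additive_label:
  assumes add: "additive_on (space2 r) \<theta>" and im: "\<theta> ` space2 r = space2 n"
    and len: "length v = 2 ^ n" and nth: "\<And>i. i < 2 ^ n \<Longrightarrow> v ! i = {x \<in> space2 r. x \<noteq> 0 \<and> \<theta> x = vec_of_nat i}"
  shows "\<exists>\<phi>\<in>full_rank n r. v = pencil_of n r \<phi> \<and> (\<forall>x\<in>space2 r. \<theta> x = mv r \<phi> x)"
proof -
  define \<phi> where "\<phi> = (\<lambda>i j. if i < n \<and> j < r then \<theta> (unit2 j) i else 0)"
  have sp: "\<phi> i \<in> space2 r" for i by (simp add: \<phi>_def space2_def)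
  have z: "\<phi> i = 0" if "i \<ge> n" for i using that by (simp add: \<phi>_def fun_eq_iff)
  have eq: "\<theta> x = mv r \<phi> x" if "x \<in> space2 r" for x
  proof (rule additive_on_eqI [OF add additive_mv _ that])
    fix k assume k: "k < r"
    show "\<theta> (unit2 k) = mv r \<phi> (unit2 k)"
    proof
      fix i
      have "\<theta> (unit2 k) \<in> space2 n" using im k by (metis imageI unit2_space2)
      then show "\<theta> (unit2 k) i = mv r \<phi> (unit2 k) i"
        using k by (simp add: mv_apply) (simp add: \<phi>_def space2_def)
    qed
  qed
  have FR: "\<phi> \<in> full_rank n r"
  proof (rule full_rankI_surj [OF sp z])
    have "mv r \<phi> ` space2 r = \<theta> ` space2 r" by (rule image_cong) (simp_all add: eq)
    then show "space2 n \<subseteq> mv r \<phi> ` space2 r" unfolding im by simp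
  qed
  have "v = pencil_of n r \<phi>"
  proof (rule nth_equalityI)
    fix i assume "i < length v"
    then have "i < 2 ^ n" using len by simp
    then show "v ! i = pencil_of n r \<phi> ! i" using nth eq by (auto simp: nth_pencil_of)
  qed (simp add: len)
  then show ?thesis using FR eq by (intro bexI [of _ \<phi>] conjI ballI)
qed

text \<open>The stacked row adds the coordinate \<open>dot r f x\<close>, which is \<open>0\<close>
  in \<open>z\<close>. Thus the vectors labelled \<open>z\<close> on the hyperplane of
  \<open>f\<close> form a fibre of the stacked matrix.\<close>

lemma mv_stack_eq_iff:
  assumes "\<phi> \<in> full_rank n r" "z \<in> space2 n"
  shows "mv r (\<phi>(n := f)) x = z \<longleftrightarrow> mv r \<phi> x = z \<and> dot r f x = 0"
proof -
  have st: "mv r (\<phi>(n := f)) x = (mv r \<phi> x)(n := dot r f x)"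
    by (rule ext) (simp add: mv_apply)
  have "z n = 0" "mv r \<phi> x n = 0"
    using assms(2) mv_full_rank [OF assms(1), of x] by (simp_all add: space2_def)
  then show ?thesis unfolding st by (metis fun_upd_idem_iff fun_upd_same fun_upd_triv fun_upd_upd)
qed

section \<open>Adjacency of pencils as adjacency of matrices\<close>

lemma pencil_adjacent_commute: "pencil_adjacent r \<sigma> v v' \<longleftrightarrow> pencil_adjacent r \<sigma> v' v"
  by (simp add: pencil_adjacent_def Int_commute Let_def)

text \<open>The two labels of \<open>x\<close> agree exactly if \<open>f\<close> vanishes at
  \<open>x\<close>. So the intersections of classes are fibres of the matrix stacked from
  \<open>\<phi>\<close> and \<open>f\<close>, whose kernel has dimension
  \<open>r - n - 1 = \<sigma> - 1\<close>.\<close>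

lemma pencil_adjacent_of_madj:
  assumes \<sigma>: "0 < \<sigma>" "\<sigma> < r" and n: "n = r - \<sigma>" and \<phi>: "\<phi> \<in> full_rank n r" and adj: "madj n r \<phi> \<psi>"
  shows "pencil_adjacent r \<sigma> (pencil_of n r \<phi>) (pencil_of n r \<psi>)"
  using adj
proof (rule madjE)
  fix c f assume cf: "c \<in> space2 n" "c \<noteq> 0" "f \<in> space2 r" "f \<notin> row_space n \<phi>" "f \<noteq> 0" "\<psi> = \<phi> + outer c f"
  let ?\<Psi> = "\<phi>(n := f)" and ?P = "pencil_of n r \<phi>" and ?Q = "pencil_of n r \<psi>"
  have \<Psi>: "?\<Psi> \<in> full_rank (Suc n) r" by (rule full_rank_stack [OF \<phi> cf(3,4)])
  have agree: "mv r \<psi> x = mv r \<phi> x \<longleftrightarrow> dot r f x = 0" for x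
    using cf(2) by (cases "dot r f x") (simp_all add: cf(6))
  have both: "mv r \<phi> x = z \<and> mv r \<psi> x = z \<longleftrightarrow> mv r ?\<Psi> x = z" if "z \<in> space2 n" for x z
    unfolding mv_stack_eq_iff [OF \<phi> that] agree [symmetric] by auto
  have Int: "?P ! i \<inter> ?Q ! i = {x \<in> space2 r. x \<noteq> 0 \<and> mv r ?\<Psi> x = vec_of_nat i}" if "i < 2 ^ n" for i
    using both [OF vec_of_nat_space2 [OF that]] by (auto simp: nth_pencil_of [OF that])
  have "?P ! 0 \<inter> ?Q ! 0 = {x \<in> space2 r. x \<noteq> 0 \<and> mv r ?\<Psi> x = 0}"
    using Int [of 0] by simp
  then have T: "insert 0 (?P ! 0 \<inter> ?Q ! 0) = {x \<in> space2 r. mv r ?\<Psi> x = 0}"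
    by (simp only: insert_0_kernel)
  have 1: "linear_subspace r (\<sigma> - 1) {x \<in> space2 r. mv r ?\<Psi> x = 0}"
    using linear_subspace_kernel [OF \<Psi>] \<sigma> n by simp
  have 2: "?P ! i \<inter> ?Q ! i \<in> cosets r {x \<in> space2 r. mv r ?\<Psi> x = 0} - {{x \<in> space2 r. mv r ?\<Psi> x = 0}}"
    if i: "i \<in> {1..2 ^ n - 1}" for i
  proof -
    have i': "i < 2 ^ n" "i \<noteq> 0" using i by auto
    then have v0: "vec_of_nat i \<noteq> 0" by (simp only: vec_of_nat_eq_0_iff) simp
    then have "x \<noteq> 0" if "mv r ?\<Psi> x = vec_of_nat i" for x using that by (metis mv_0)
    then have eq: "?P ! i \<inter> ?Q ! i = {x \<in> space2 r. mv r ?\<Psi> x = vec_of_nat i}" using Int [OF i'(1)] by auto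
    have "vec_of_nat i \<in> space2 (Suc n)" using vec_of_nat_space2 [OF i'(1)] space2_mono [of n "Suc n"] by auto
    then have "?P ! i \<inter> ?Q ! i \<in> cosets r {x \<in> space2 r. mv r ?\<Psi> x = 0}"
      unfolding eq by (rule mv_class_coset [OF \<Psi>])
    moreover have "?P ! i \<inter> ?Q ! i \<noteq> {x \<in> space2 r. mv r ?\<Psi> x = 0}"
    proof
      assume eq: "?P ! i \<inter> ?Q ! i = {x \<in> space2 r. mv r ?\<Psi> x = 0}"
      have "0 \<in> ?P ! i \<inter> ?Q ! i" unfolding eq by simp
      then show False unfolding Int [OF i'(1)] by simp
    qed
    ultimately show ?thesis by (simp only: Diff_iff singleton_iff) simp
  qed
  \<comment> \<open>Every vector carries some label, so the union of the intersections is the whole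
    hyperplane of \<open>f\<close>.\<close>
  have 3: "insert 0 (\<Union>i\<in>{0..2 ^ n - 1}. ?P ! i \<inter> ?Q ! i) = {x \<in> space2 r. dot r x f = 0}"
  proof (intro equalityI subsetI)
    fix x assume "x \<in> insert 0 (\<Union>i\<in>{0..2 ^ n - 1}. ?P ! i \<inter> ?Q ! i)"
    then consider "x = 0" | i where "i \<le> 2 ^ n - 1" "x \<in> ?P ! i \<inter> ?Q ! i" by auto
    then show "x \<in> {x \<in> space2 r. dot r x f = 0}"
    proof cases
      case 2
      have "(0::nat) < 2 ^ n" by simp
      with 2(1) have i: "i < 2 ^ n" by linarith
      then have "mv r ?\<Psi> x = vec_of_nat i" "x \<in> space2 r" using 2(2) Int [OF i] by blast+
      then show ?thesis
        using mv_stack_eq_iff [OF \<phi> vec_of_nat_space2 [OF i]] by (simp add: dot_commute [of r x])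
    qed simp
  next
    fix x assume x: "x \<in> {x \<in> space2 r. dot r x f = 0}"
    show "x \<in> insert 0 (\<Union>i\<in>{0..2 ^ n - 1}. ?P ! i \<inter> ?Q ! i)"
    proof (cases "x = 0")
      case False
      have "mv r \<phi> x \<in> vec_of_nat ` {..<2 ^ n}" unfolding image_vec_of_nat by (rule mv_full_rank [OF \<phi>])
      then obtain i where i: "i < 2 ^ n" "mv r \<phi> x = vec_of_nat i" by auto
      then have "mv r ?\<Psi> x = vec_of_nat i"
        using mv_stack_eq_iff [OF \<phi> vec_of_nat_space2 [OF i(1)]] x by (simp add: dot_commute [of r f])
      then have "x \<in> ?P ! i \<inter> ?Q ! i" using Int [OF i(1)] x False by blast
      moreover have "i \<in> {0..2 ^ n - 1}" using i(1) by auto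
      ultimately show ?thesis by blast
    qed simp
  qed
  have "linear_subspace r (r - 1) {x \<in> space2 r. dot r x f = 0}"
    unfolding linear_subspace_iff using card_dot_eq [OF cf(3,5)] by auto
  then show ?thesis
    unfolding pencil_adjacent_def Let_def n [symmetric] T 3 using 1 2 by blast
qed

text \<open>A hyperplane has just one other coset, so the indicator of its complement is additive
  and hence a functional.\<close>

lemma hyperplane_functional:
  assumes W: "linear_subspace r (r - 1) W" and r: "0 < r"
  obtains f z where "f \<in> space2 r" "\<And>x. x \<in> space2 r \<Longrightarrow> dot r f x = of_bool (x \<notin> W)"
    "z \<in> space2 r" "z \<notin> W" "\<And>x. x \<in> space2 r \<Longrightarrow> x \<notin> W \<Longrightarrow> z + x \<in> W"
proof -
  have Ws: "W \<subseteq> space2 r" and W0: "0 \<in> W" and Wadd: "\<And>x y. x \<in> W \<Longrightarrow> y \<in> W \<Longrightarrow> x + y \<in> W"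
    and cW: "card W = 2 ^ (r - 1)"
    using W by (auto simp: linear_subspace_iff)
  have two: "(2::nat) ^ r = 2 ^ (r - 1) + 2 ^ (r - 1)" using r by (cases r) auto
  have "card W < card (space2 r)" using cW two by simp
  then obtain z where z: "z \<in> space2 r" "z \<notin> W" using Ws by (metis less_irrefl subsetI subset_antisym)
  have "W \<union> (\<lambda>x. z + x) ` W = space2 r"
  proof (rule card_subset_eq)
    show "W \<union> (\<lambda>x. z + x) ` W \<subseteq> space2 r" using Ws z(1) by auto
    have disj: "W \<inter> (\<lambda>x. z + x) ` W = {}"
    proof (rule ccontr)
      assume "W \<inter> (\<lambda>x. z + x) ` W \<noteq> {}"
      then obtain x where x: "x \<in> W" "z + x \<in> W" by auto
      then have "(z + x) + x \<in> W" using Wadd by blast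
      then show False using z(2) by (simp add: add.assoc)
    qed
    have fin: "finite W" using Ws finite_space2 finite_subset by blast
    have "card ((\<lambda>x. z + x) ` W) = card W" by (intro card_image) (simp add: inj_on_def)
    then show "card (W \<union> (\<lambda>x. z + x) ` W) = card (space2 r)"
      using card_Un_disjoint [OF fin _ disj] fin cW two by simp
  qed simp
  then have zx: "z + x \<in> W" if "x \<in> space2 r" "x \<notin> W" for x
    using that by auto
  have iff: "x + y \<in> W \<longleftrightarrow> (x \<in> W \<longleftrightarrow> y \<in> W)" if xy: "x \<in> space2 r" "y \<in> space2 r" for x y
  proof -
    have l: "x + y \<in> W \<Longrightarrow> x \<in> W \<Longrightarrow> y \<in> W" "x + y \<in> W \<Longrightarrow> y \<in> W \<Longrightarrow> x \<in> W"
      using Wadd [of x "x + y"] Wadd [of "x + y" y] by (simp_all add: add.assoc)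
    have "x + y \<in> W" if "x \<notin> W" "y \<notin> W"
    proof -
      have "(z + x) + (z + y) \<in> W" using zx xy that Wadd by blast
      moreover have "(z + x) + (z + y) = x + y" by (simp add: add.assoc add.left_commute [of x z])
      ultimately show ?thesis by simp
    qed
    then show ?thesis using l Wadd [of x y] by blast
  qed
  have "additive_on (space2 r) (\<lambda>x. of_bool (x \<notin> W) :: bit)"
    unfolding additive_on_def
  proof (intro ballI)
    fix x y assume xy: "x \<in> space2 r" "y \<in> space2 r"
    show "(of_bool (x + y \<notin> W) :: bit) = of_bool (x \<notin> W) + of_bool (y \<notin> W)"
      using iff [OF xy] by (cases "x \<in> W"; cases "y \<in> W") simp_all
  qed
  then obtain f where f: "f \<in> space2 r" "\<And>x. x \<in> space2 r \<Longrightarrow> of_bool (x \<notin> W) = dot r f x"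
    by (rule additive_functional) blast
  show ?thesis by (rule that [of f z]) (use f z zx in auto)
qed

text \<open>On the hyperplane \<open>W\<close> of agreement the labelling of \<open>v\<close>
  coincides with the linear one. Every label occurs on \<open>W\<close>, so additivity spreads from
  \<open>W\<close> to the whole space. The two linear labellings then differ by a constant off
  \<open>W\<close>, which is a matrix of rank one.\<close>

lemma pencil_adjacentD:
  assumes \<sigma>: "0 < \<sigma>" "\<sigma> < r" and n: "n = r - \<sigma>" and \<phi>: "\<phi> \<in> full_rank n r"
    and v: "ordered_pencil r \<sigma> v" and adj: "pencil_adjacent r \<sigma> (pencil_of n r \<phi>) v"
  obtains \<psi> where "madj n r \<phi> \<psi>" "v = pencil_of n r \<psi>"
proof -
  let ?P = "pencil_of n r \<phi>"
  define S where "S = insert 0 (v ! 0)"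
  obtain \<theta> where im: "\<theta> ` space2 r = space2 n"
    and \<theta>eq: "\<And>x y. x \<in> space2 r \<Longrightarrow> y \<in> space2 r \<Longrightarrow> \<theta> x = \<theta> y \<longleftrightarrow> x + y \<in> S"
    and nth: "\<And>i. i < 2 ^ n \<Longrightarrow> v ! i = {x \<in> space2 r. x \<noteq> 0 \<and> \<theta> x = vec_of_nat i}"
    by (rule pencil_label [OF v n S_def]) blast
  have len: "length v = 2 ^ n" and linS: "linear_subspace r \<sigma> S"
    using v unfolding ordered_pencil_iff S_def n by blast+
  have Ss: "S \<subseteq> space2 r" and S0: "0 \<in> S" and Sadd: "\<And>x y. x \<in> S \<Longrightarrow> y \<in> S \<Longrightarrow> x + y \<in> S"
    using linS by (auto simp: linear_subspace_iff)
  define W where "W = insert 0 (\<Union>i\<in>{0..2 ^ n - 1}. ?P ! i \<inter> v ! i)"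
  define T where "T = insert 0 (?P ! 0 \<inter> v ! 0)"
  have T: "linear_subspace r (\<sigma> - 1) T" and cos: "\<And>i. i \<in> {1..2 ^ n - 1} \<Longrightarrow> ?P ! i \<inter> v ! i \<in> cosets r T - {T}"
    and linW: "linear_subspace r (r - 1) W"
    using adj unfolding pencil_adjacent_def Let_def n [symmetric] W_def T_def by blast+
  have Wadd: "\<And>x y. x \<in> W \<Longrightarrow> y \<in> W \<Longrightarrow> x + y \<in> W" and Ws: "W \<subseteq> space2 r"
    using linW by (auto simp: linear_subspace_iff)
  have S_iff: "x \<in> S \<longleftrightarrow> \<theta> x = 0" if "x \<in> space2 r" for x
  proof -
    have "x \<in> S \<longleftrightarrow> x = 0 \<or> \<theta> x = 0" using nth [of 0] that by (auto simp: S_def)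
    moreover have "\<theta> 0 = 0"
    proof -
      have "0 \<in> \<theta> ` space2 r" unfolding im by simp
      then obtain y where y: "y \<in> space2 r" "\<theta> y = 0" by auto
      then have "y \<in> S" using nth [of 0] by (auto simp: S_def)
      then show ?thesis using \<theta>eq [of y 0] y by simp
    qed
    ultimately show ?thesis by auto
  qed
  have \<theta>0: "\<theta> 0 = 0" using S_iff [OF space2_0] S0 by simp
  have index: "\<exists>i<2 ^ n. \<theta> x = vec_of_nat i" if "x \<in> space2 r" for x
  proof -
    have "\<theta> x \<in> vec_of_nat ` {..<2 ^ n}" unfolding image_vec_of_nat im [symmetric] using that by (rule imageI)
    then show ?thesis by auto
  qed
  have W_iff: "x \<in> W \<longleftrightarrow> mv r \<phi> x = \<theta> x" if x: "x \<in> space2 r" for x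
  proof
    assume "x \<in> W"
    then consider "x = 0" | i where "i \<in> {0..2 ^ n - 1}" "x \<in> ?P ! i \<inter> v ! i" unfolding W_def by auto
    then show "mv r \<phi> x = \<theta> x"
    proof cases
      case 2
      have "(0::nat) < 2 ^ n" by simp
      moreover have "i \<le> 2 ^ n - 1" using 2(1) by simp
      ultimately have i: "i < 2 ^ n" by linarith
      show ?thesis using 2(2) unfolding nth [OF i] nth_pencil_of [OF i] by simp
    qed (simp add: \<theta>0)
  next
    assume eq: "mv r \<phi> x = \<theta> x"
    obtain i where i: "i < 2 ^ n" "\<theta> x = vec_of_nat i" using index [OF x] by blast
    show "x \<in> W"
    proof (cases "x = 0")
      case False
      then have "x \<in> ?P ! i \<inter> v ! i" using i x eq nth [OF i(1)] nth_pencil_of [OF i(1), of r \<phi>] by simp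
      moreover have "i \<in> {0..2 ^ n - 1}" using i(1) by auto
      ultimately show ?thesis unfolding W_def by blast
    qed (simp add: W_def)
  qed
  \<comment> \<open>The second adjacency condition enters here: each intersection is a coset, hence
    nonempty, so every label has a representative in \<open>W\<close>.\<close>
  have rep: "\<exists>w\<in>W. w \<in> space2 r \<and> \<theta> w = \<theta> x" if x: "x \<in> space2 r" for x
  proof -
    obtain i where i: "i < 2 ^ n" "\<theta> x = vec_of_nat i" using index [OF x] by blast
    show ?thesis
    proof (cases "i = 0")
      case True
      then show ?thesis using i \<theta>0 by (intro bexI [of _ 0]) (simp_all add: W_def)
    next
      case False
      then have i': "i \<in> {1..2 ^ n - 1}" using i(1) by auto
      have "0 \<in> T" by (simp add: T_def)
      then have "?P ! i \<inter> v ! i \<noteq> {}" using cos [OF i'] by (auto simp: cosets_def)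
      then obtain w where w: "w \<in> ?P ! i \<inter> v ! i" by blast
      have "w \<in> space2 r" "\<theta> w = \<theta> x" using w nth [OF i(1)] i(2) by auto
      moreover have "w \<in> W" using w i' unfolding W_def by auto
      ultimately show ?thesis by blast
    qed
  qed
  have "additive_on (space2 r) \<theta>"
    unfolding additive_on_def
  proof (intro ballI)
    fix x y assume xy: "x \<in> space2 r" "y \<in> space2 r"
    obtain a where a: "a \<in> W" "a \<in> space2 r" "\<theta> a = \<theta> x" using rep [OF xy(1)] by blast
    obtain b where b: "b \<in> W" "b \<in> space2 r" "\<theta> b = \<theta> y" using rep [OF xy(2)] by blast
    have "a + x \<in> S" "b + y \<in> S" using \<theta>eq a b xy by blast+
    then have "(a + x) + (b + y) \<in> S" by (rule Sadd)
    moreover have "(a + x) + (b + y) = (a + b) + (x + y)" by (simp add: add.assoc add.left_commute [of x])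
    ultimately have "\<theta> (a + b) = \<theta> (x + y)" using \<theta>eq [of "a + b" "x + y"] a(2) b(2) xy by simp
    moreover have "\<theta> (a + b) = mv r \<phi> (a + b)" using W_iff [of "a + b"] Wadd [OF a(1) b(1)] a(2) b(2) by simp
    moreover have "mv r \<phi> (a + b) = \<theta> a + \<theta> b" using W_iff [OF a(2)] W_iff [OF b(2)] a(1) b(1) by simp
    ultimately show "\<theta> (x + y) = \<theta> x + \<theta> y" using a(3) b(3) by simp
  qed
  from additive_label [OF this im len nth]
  obtain \<psi> where \<psi>: "\<psi> \<in> full_rank n r" "v = pencil_of n r \<psi>" and \<theta>\<psi>: "\<forall>x\<in>space2 r. \<theta> x = mv r \<psi> x"
    by blast
  have r: "0 < r" using \<sigma> by simp
  obtain f z where f: "f \<in> space2 r" "\<And>x. x \<in> space2 r \<Longrightarrow> dot r f x = of_bool (x \<notin> W)"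
    and z: "z \<in> space2 r" "z \<notin> W" "\<And>x. x \<in> space2 r \<Longrightarrow> x \<notin> W \<Longrightarrow> z + x \<in> W"
    by (rule hyperplane_functional [OF linW r]) blast
  \<comment> \<open>The difference of the two labels is the same at all points off \<open>W\<close>,
    because any two of them differ by an element of \<open>W\<close>.\<close>
  define c where "c = mv r \<phi> z + mv r \<psi> z"
  have cs: "c \<in> space2 n" unfolding c_def using \<phi> \<psi>(1) by simp
  have c0: "c \<noteq> 0" unfolding c_def using z(1,2) W_iff [OF z(1)] bspec [OF \<theta>\<psi> z(1)] by simp
  have "\<psi> = \<phi> + outer c f"
  proof (rule mv_ext)
    show "\<psi> i \<in> space2 r" for i by (rule full_rankD(1) [OF \<psi>(1)])
    show "(\<phi> + outer c f) i \<in> space2 r" for i using full_rankD(1) [OF \<phi>] f(1) by simp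
    fix x assume x: "x \<in> space2 r"
    show "mv r \<psi> x = mv r (\<phi> + outer c f) x"
    proof (cases "x \<in> W")
      case True
      then show ?thesis using W_iff [OF x] bspec [OF \<theta>\<psi> x] f(2) [OF x] by simp
    next
      case False
      have "z + x \<in> W" by (rule z(3) [OF x False])
      then have "mv r \<phi> (z + x) = mv r \<psi> (z + x)" using W_iff [of "z + x"] bspec [OF \<theta>\<psi>, of "z + x"] z(1) x by simp
      then have "mv r \<psi> x = mv r \<phi> x + c"
        unfolding c_def mv_add_right by (metis add.assoc add.commute add_self_left)
      then show ?thesis using f(2) [OF x] False by simp
    qed
  qed
  \<comment> \<open>Otherwise \<open>f\<close> would vanish on the kernel of \<open>\<phi>\<close>.
    Then \<open>T\<close> would be the whole kernel, of dimension \<open>\<sigma>\<close> instead of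
    \<open>\<sigma> - 1\<close>.\<close>
  moreover have "f \<notin> row_space n \<phi>"
  proof
    assume "f \<in> row_space n \<phi>"
    then obtain a where a: "f = comb n a \<phi>" by (auto simp: row_space_def)
    have "T = {x \<in> space2 r. mv r \<phi> x = 0}"
    proof -
      have "T = insert 0 (?P ! 0) \<inter> S" unfolding T_def S_def by auto
      also have "insert 0 (?P ! 0) = {x \<in> space2 r. mv r \<phi> x = 0}" by (rule insert_0_nth_pencil_of)
      also have "\<dots> \<subseteq> S"
      proof
        fix x assume "x \<in> {x \<in> space2 r. mv r \<phi> x = 0}"
        then have x: "x \<in> space2 r" "mv r \<phi> x = 0" by simp_all
        have "dot r f x = 0" unfolding a using dot_mv [of n a r \<phi> x] x(2) by simp
        then have "x \<in> W" using f(2) [OF x(1)] by (simp split: if_splits)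
        then show "x \<in> S" using W_iff [OF x(1)] S_iff [OF x(1)] x(2) by simp
      qed
      ultimately show ?thesis by blast
    qed
    then have "(2::nat) ^ (\<sigma> - 1) = 2 ^ \<sigma>"
      using T card_mv_fibre [OF \<phi> space2_0] n \<sigma> by (simp add: linear_subspace_iff)
    then show False using \<sigma> by simp
  qed
  ultimately have "madj n r \<phi> \<psi>" unfolding madj_def using cs c0 f(1) by blast
  then show ?thesis using that \<psi>(2) by blast
qed

text \<open>The label of the integer \<open>k\<close> is \<open>k div 2 ^ \<sigma>\<close>, so the
  matrix reads off the binary digits from position \<open>\<sigma>\<close> on.\<close>

lemma base_pencil_eq:
  assumes \<sigma>: "\<sigma> \<le> r"
  obtains \<phi> where "\<phi> \<in> full_rank (r - \<sigma>) r" "base_pencil r \<sigma> = pencil_of (r - \<sigma>) r \<phi>"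
proof -
  let ?n = "r - \<sigma>"
  define \<phi> where "\<phi> = (\<lambda>i. if i < ?n then unit2 (\<sigma> + i) else 0)"
  have FR: "\<phi> \<in> full_rank ?n r"
  proof (rule full_rank_of_preimages [where q = "\<lambda>i. unit2 (\<sigma> + i)"])
    show "dot r (\<phi> i) (unit2 (\<sigma> + j)) = of_bool (i = j)" if "i < ?n" "j < ?n" for i j
      using that by (simp add: \<phi>_def unit2_apply eq_commute)
  qed (simp_all add: \<phi>_def)
  have mv: "mv r \<phi> (vec_of_nat k) = vec_of_nat (k div 2 ^ \<sigma>)" if k: "k < 2 ^ r" for k
  proof
    fix i
    show "mv r \<phi> (vec_of_nat k) i = vec_of_nat (k div 2 ^ \<sigma>) i"
    proof (cases "i < ?n")
      case True
      then have "mv r \<phi> (vec_of_nat k) i = vec_of_nat k (\<sigma> + i)" by (simp add: mv_apply \<phi>_def)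
      then show ?thesis by (simp add: vec_of_nat_def bit_drop_bit_eq flip: drop_bit_eq_div)
    next
      case False
      have "k div 2 ^ \<sigma> < 2 ^ ?n" using k \<sigma> by (simp add: less_mult_imp_div_less flip: power_add)
      then have "vec_of_nat (k div 2 ^ \<sigma>) \<in> space2 ?n" by (rule vec_of_nat_space2)
      then show ?thesis using False by (simp add: mv_apply \<phi>_def space2_def)
    qed
  qed
  have cls: "{x \<in> space2 r. x \<noteq> 0 \<and> mv r \<phi> x = vec_of_nat i} = vec_of_nat ` {k. k < 2 ^ r \<and> k \<noteq> 0 \<and> k div 2 ^ \<sigma> = i}" for i
  proof (intro equalityI subsetI)
    fix x assume x: "x \<in> {x \<in> space2 r. x \<noteq> 0 \<and> mv r \<phi> x = vec_of_nat i}"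
    then have "x \<in> vec_of_nat ` {..<2 ^ r}" unfolding image_vec_of_nat by simp
    then obtain k where k: "k < 2 ^ r" "x = vec_of_nat k" by auto
    have "k div 2 ^ \<sigma> = i" using x mv [OF k(1)] unfolding k(2) by (simp add: vec_of_nat_eq_iff)
    moreover have "k \<noteq> 0" using x k(2) by auto
    ultimately show "x \<in> vec_of_nat ` {k. k < 2 ^ r \<and> k \<noteq> 0 \<and> k div 2 ^ \<sigma> = i}" using k by blast
  next
    fix x assume "x \<in> vec_of_nat ` {k. k < 2 ^ r \<and> k \<noteq> 0 \<and> k div 2 ^ \<sigma> = i}"
    then obtain k where "k < 2 ^ r" "k \<noteq> 0" "k div 2 ^ \<sigma> = i" "x = vec_of_nat k" by blast
    then show "x \<in> {x \<in> space2 r. x \<noteq> 0 \<and> mv r \<phi> x = vec_of_nat i}"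
      using mv vec_of_nat_space2 by simp
  qed
  have rng: "k < 2 ^ r \<and> k div 2 ^ \<sigma> = i \<longleftrightarrow> i * 2 ^ \<sigma> \<le> k \<and> k \<le> (i + 1) * 2 ^ \<sigma> - 1"
    if i: "i < 2 ^ ?n" for i k :: nat
  proof -
    have "(i + 1) * 2 ^ \<sigma> \<le> 2 ^ ?n * 2 ^ \<sigma>" using i by (intro mult_le_mono1) simp
    also have "\<dots> = 2 ^ r" using \<sigma> by (simp flip: power_add)
    finally have le: "(i + 1) * 2 ^ \<sigma> \<le> (2::nat) ^ r" .
    \<comment> \<open>The upper bound is written with truncated subtraction; positivity turns it
      into a strict inequality.\<close>
    have pos: "(0::nat) < (i + 1) * 2 ^ \<sigma>" by simp
    have "k div 2 ^ \<sigma> = i \<longleftrightarrow> i * 2 ^ \<sigma> \<le> k \<and> k < (i + 1) * 2 ^ \<sigma>"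
    proof
      assume "k div 2 ^ \<sigma> = i"
      then show "i * 2 ^ \<sigma> \<le> k \<and> k < (i + 1) * 2 ^ \<sigma>"
        using div_times_less_eq_dividend [of k "2 ^ \<sigma>"] dividend_less_div_times [of "2 ^ \<sigma>" k]
        by simp
    next
      assume "i * 2 ^ \<sigma> \<le> k \<and> k < (i + 1) * 2 ^ \<sigma>"
      then show "k div 2 ^ \<sigma> = i" by (intro div_nat_eqI) (simp_all add: mult.commute)
    qed
    then show ?thesis using le pos by linarith
  qed
  have "base_pencil r \<sigma> = pencil_of ?n r \<phi>"
  proof (rule nth_equalityI)
    show "length (base_pencil r \<sigma>) = length (pencil_of ?n r \<phi>)"
      by (simp add: base_pencil_def)
    fix i assume "i < length (base_pencil r \<sigma>)"
    then have i: "i < 2 ^ ?n" by (simp add: base_pencil_def)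
    show "base_pencil r \<sigma> ! i = pencil_of ?n r \<phi> ! i"
    proof (cases i)
      case 0
      have "{k. k < 2 ^ r \<and> k \<noteq> 0 \<and> k div 2 ^ \<sigma> = (0::nat)} = {1..2 ^ \<sigma> - 1}"
      proof (intro set_eqI)
        fix k :: nat
        have "k \<in> {k. k < 2 ^ r \<and> k \<noteq> 0 \<and> k div 2 ^ \<sigma> = 0} \<longleftrightarrow> (k < 2 ^ r \<and> k div 2 ^ \<sigma> = 0) \<and> k \<noteq> 0"
          by blast
        also have "\<dots> \<longleftrightarrow> k \<le> 2 ^ \<sigma> - 1 \<and> k \<noteq> 0" using rng [of 0 k] by simp
        also have "\<dots> \<longleftrightarrow> k \<in> {1..2 ^ \<sigma> - 1}" by auto
        finally show "k \<in> {k. k < 2 ^ r \<and> k \<noteq> 0 \<and> k div 2 ^ \<sigma> = 0} \<longleftrightarrow> k \<in> {1..2 ^ \<sigma> - 1}" .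
      qed
      then show ?thesis using nth_pencil_of [OF i, of r \<phi>] cls [of i] 0 by (simp add: base_pencil_def)
    next
      case (Suc j)
      have "{k. k < 2 ^ r \<and> k \<noteq> 0 \<and> k div 2 ^ \<sigma> = i} = {i * 2 ^ \<sigma>..(i + 1) * 2 ^ \<sigma> - 1}"
      proof (intro equalityI subsetI)
        fix k assume "k \<in> {k. k < 2 ^ r \<and> k \<noteq> 0 \<and> k div 2 ^ \<sigma> = i}"
        then show "k \<in> {i * 2 ^ \<sigma>..(i + 1) * 2 ^ \<sigma> - 1}" using rng [OF i, of k] by auto
      next
        fix k assume k: "k \<in> {i * 2 ^ \<sigma>..(i + 1) * 2 ^ \<sigma> - 1}"
        have "0 < i * 2 ^ \<sigma>" using Suc by simp
        then have "k \<noteq> 0" using k by (metis atLeastAtMost_iff not_less)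
        then show "k \<in> {k. k < 2 ^ r \<and> k \<noteq> 0 \<and> k div 2 ^ \<sigma> = i}" using rng [OF i, of k] k by auto
      qed
      then show ?thesis
        using nth_pencil_of [OF i, of r \<phi>] cls [of i] Suc i by (simp add: base_pencil_def)
    qed
  qed
  then show ?thesis using that FR by blast
qed

section \<open>The component of the base pencil\<close>

lemma edge_pencil_graph_iff:
  "{v, v'} \<in> edges (pencil_graph r \<sigma>) \<longleftrightarrow>
     ordered_pencil r \<sigma> v \<and> ordered_pencil r \<sigma> v' \<and> pencil_adjacent r \<sigma> v v'"
  using pencil_adjacent_commute [of r \<sigma> v v'] by (auto simp: pencil_graph_def doubleton_eq_iff)

lemma rtrancl_image:
  assumes "(x, y) \<in> R\<^sup>*" "\<And>a b. (a, b) \<in> R \<Longrightarrow> (f a, f b) \<in> S"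
  shows "(f x, f y) \<in> S\<^sup>*"
  using assms(1) by (induction rule: rtrancl_induct) (auto intro: rtrancl_into_rtrancl assms(2))

text \<open>Naming the number of rows \<open>n\<close> keeps subtraction out of the statements about
  matrices.\<close>

locale pencil_parameters =
  fixes r \<sigma> n :: nat
  assumes \<sigma>: "0 < \<sigma>" "\<sigma> < r" and n: "n = r - \<sigma>"
begin

abbreviation "M \<equiv> mat_graph n r"
abbreviation "\<P> \<equiv> pencil_of n r"
abbreviation "G \<equiv> pencil_component r \<sigma>"

lemma nr: "n < r" "0 < n"
  using \<sigma> n by simp_all

lemma ordered_pencil_of': "\<phi> \<in> full_rank n r \<Longrightarrow> ordered_pencil r \<sigma> (\<P> \<phi>)"
  using ordered_pencil_of [of \<phi> r \<sigma>] \<sigma> n by simp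

lemma edge_pencil_of_iff:
  assumes "\<phi> \<in> full_rank n r" "\<psi> \<in> full_rank n r"
  shows "{\<P> \<phi>, \<P> \<psi>} \<in> edges (pencil_graph r \<sigma>) \<longleftrightarrow> madj n r \<phi> \<psi>"
proof
  assume "{\<P> \<phi>, \<P> \<psi>} \<in> edges (pencil_graph r \<sigma>)"
  then have "ordered_pencil r \<sigma> (\<P> \<psi>)" "pencil_adjacent r \<sigma> (\<P> \<phi>) (\<P> \<psi>)"
    by (simp_all add: edge_pencil_graph_iff)
  then obtain \<chi> where \<chi>: "madj n r \<phi> \<chi>" "\<P> \<psi> = \<P> \<chi>"
    by (rule pencil_adjacentD [OF \<sigma> n assms(1)])
  have "\<psi> = \<chi>" by (rule inj_onD [OF pencil_of_inj \<chi>(2) assms(2) madj_full_rank [OF \<chi>(1) assms(1)]])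
  then show "madj n r \<phi> \<psi>" using \<chi>(1) by simp
next
  assume "madj n r \<phi> \<psi>"
  then show "{\<P> \<phi>, \<P> \<psi>} \<in> edges (pencil_graph r \<sigma>)"
    using pencil_adjacent_of_madj [OF \<sigma> n assms(1)] ordered_pencil_of' assms
    by (simp add: edge_pencil_graph_iff)
qed

text \<open>By \<open>pencil_adjacentD\<close> no edge leaves the set of pencils that come from
  matrices, and by \<open>mat_graph_connected\<close> all of them are reached.\<close>

lemma verts_component: "verts G = \<P> ` full_rank n r"
proof -
  obtain \<phi>0 where \<phi>0: "\<phi>0 \<in> full_rank n r" "base_pencil r \<sigma> = \<P> \<phi>0"
    using base_pencil_eq [of \<sigma> r] \<sigma> n by (metis less_imp_le_nat)
  have "verts G = {w. ordered_pencil r \<sigma> w \<and> (\<P> \<phi>0, w) \<in> (arcs (pencil_graph r \<sigma>))\<^sup>*}"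
    by (auto simp: pencil_component_def component_def \<phi>0(2) pencil_graph_def)
  also have "\<dots> = \<P> ` full_rank n r"
  proof (intro equalityI subsetI)
    fix w assume "w \<in> {w. ordered_pencil r \<sigma> w \<and> (\<P> \<phi>0, w) \<in> (arcs (pencil_graph r \<sigma>))\<^sup>*}"
    then have "(\<P> \<phi>0, w) \<in> (arcs (pencil_graph r \<sigma>))\<^sup>*" by simp
    then show "w \<in> \<P> ` full_rank n r"
    proof (induction rule: rtrancl_induct)
      case (step w v)
      then obtain \<phi> where \<phi>: "\<phi> \<in> full_rank n r" "w = \<P> \<phi>" by blast
      have "{w, v} \<in> edges (pencil_graph r \<sigma>)" using step.hyps(2) by (simp add: arcs_def)
      then have "ordered_pencil r \<sigma> v" "pencil_adjacent r \<sigma> (\<P> \<phi>) v"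
        unfolding \<phi>(2) edge_pencil_graph_iff by simp_all
      then obtain \<psi> where "madj n r \<phi> \<psi>" "v = \<P> \<psi>" by (rule pencil_adjacentD [OF \<sigma> n \<phi>(1)])
      then show ?case using madj_full_rank \<phi>(1) by blast
    qed (use \<phi>0 in blast)
  next
    fix w assume "w \<in> \<P> ` full_rank n r"
    then obtain \<psi> where \<psi>: "\<psi> \<in> full_rank n r" "w = \<P> \<psi>" by blast
    have "(\<P> \<phi>0, \<P> \<psi>) \<in> (arcs (pencil_graph r \<sigma>))\<^sup>*"
    proof (rule rtrancl_image [OF mat_graph_connected [OF nr(1) \<phi>0(1) \<psi>(1)]])
      fix a b assume "(a, b) \<in> arcs M"
      then have ab: "a \<in> full_rank n r" "madj n r a b" by (simp_all add: arcs_mat_graph)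
      have b: "b \<in> full_rank n r" by (rule madj_full_rank [OF ab(2,1)])
      show "(\<P> a, \<P> b) \<in> arcs (pencil_graph r \<sigma>)"
        using edge_pencil_of_iff [OF ab(1) b] ab(2) ordered_pencil_of' ab(1) b
        by (simp add: arcs_def) (simp add: pencil_graph_def)
    qed
    then show "w \<in> {w. ordered_pencil r \<sigma> w \<and> (\<P> \<phi>0, w) \<in> (arcs (pencil_graph r \<sigma>))\<^sup>*}"
      using ordered_pencil_of' \<psi> by simp
  qed
  finally show ?thesis .
qed

lemma component_eq_induced: "G = induced (pencil_graph r \<sigma>) (\<P> ` full_rank n r)"
proof -
  define W where "W = {w \<in> verts (pencil_graph r \<sigma>). (base_pencil r \<sigma>, w) \<in> (arcs (pencil_graph r \<sigma>))\<^sup>*}"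
  have G: "G = induced (pencil_graph r \<sigma>) W" by (simp add: pencil_component_def component_def W_def)
  have "W \<subseteq> verts (pencil_graph r \<sigma>)" by (auto simp: W_def)
  then have "verts G = W" unfolding G by auto
  then show ?thesis using G verts_component by simp
qed

text \<open>The properties proved for the matrix graph reach the component along this
  isomorphism.\<close>

lemma pencil_iso: "graph_iso \<P> M G"
proof -
  have "{\<P> u, \<P> v} \<in> edges G \<longleftrightarrow> {u, v} \<in> edges M" if "u \<in> full_rank n r" "v \<in> full_rank n r" for u v
    using edge_pencil_of_iff [OF that] edge_mat_graph_iff [OF that] that
    by (simp add: component_eq_induced)
  then show ?thesis
    using pencil_of_inj verts_component by (simp add: graph_iso_def bij_betw_def)
qed

lemma finite_simple_component: "finite_simple_graph G"
  unfolding finite_simple_graph_def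
proof (intro conjI ballI)
  show "finite (verts G)" unfolding verts_component by simp
  fix e assume e: "e \<in> edges G"
  then have "e \<in> edges (pencil_graph r \<sigma>)" and sub: "e \<subseteq> \<P> ` full_rank n r"
    by (simp_all add: component_eq_induced)
  then obtain v w where vw: "e = {v, w}" by (auto simp: pencil_graph_def)
  then obtain \<phi> \<psi> where \<phi>: "v = \<P> \<phi>" "\<phi> \<in> full_rank n r" and \<psi>: "w = \<P> \<psi>" "\<psi> \<in> full_rank n r"
    using sub by blast
  have "madj n r \<phi> \<psi>"
    using edge_pencil_of_iff [OF \<phi>(2) \<psi>(2)] \<open>e \<in> edges (pencil_graph r \<sigma>)\<close> vw \<phi>(1) \<psi>(1) by simp
  then have "v \<noteq> w" using \<phi> \<psi> inj_onD [OF pencil_of_inj _ \<phi>(2) \<psi>(2)] by auto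
  then show "\<exists>u\<in>verts G. \<exists>v\<in>verts G. u \<noteq> v \<and> e = {u, v}"
    using vw \<phi> \<psi> unfolding verts_component by blast
qed

lemma connected_component: "connected_graph G"
  unfolding connected_graph_def
proof (intro conjI ballI)
  show "verts G \<noteq> {}"
    unfolding verts_component using unit_mat_full_rank [of n r] nr(1) by auto
  fix v w assume "v \<in> verts G" "w \<in> verts G"
  then obtain \<phi> \<psi> where \<phi>: "\<phi> \<in> full_rank n r" "v = \<P> \<phi>" and \<psi>: "\<psi> \<in> full_rank n r" "w = \<P> \<psi>"
    unfolding verts_component by blast
  show "(v, w) \<in> (arcs G)\<^sup>*"
    unfolding \<phi>(2) \<psi>(2)
  proof (rule rtrancl_image [OF mat_graph_connected [OF nr(1) \<phi>(1) \<psi>(1)]])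
    fix a b assume "(a, b) \<in> arcs M"
    then show "(\<P> a, \<P> b) \<in> arcs G"
      using graph_isoD(4,5) [OF pencil_iso] by (simp add: arcs_def)
  qed
qed

lemma regular_component: "regular G ((2 ^ n - 1) * (2 ^ r - 2 ^ n))"
proof (rule regular_iso [OF pencil_iso])
  fix v assume v: "v \<in> verts M"
  have "{w \<in> verts M. {v, w} \<in> edges M} = {w. madj n r v w}"
  proof (intro set_eqI)
    fix w
    show "w \<in> {w \<in> verts M. {v, w} \<in> edges M} \<longleftrightarrow> w \<in> {w. madj n r v w}"
      using v edge_mat_graph_iff [of v n r w] madj_full_rank [of n r v w] by auto
  qed
  then show "card {w \<in> verts M. {v, w} \<in> edges M} = (2 ^ n - 1) * (2 ^ r - 2 ^ n)"
    using card_degree [of v n r] v by simp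
qed

text \<open>Any enumeration of the three nonzero elements of a Klein four-group is additive.\<close>

lemma component_eq_pencil_graph:
  assumes n2: "n = 2"
  shows "G = pencil_graph r \<sigma>"
proof -
  have "v \<in> \<P> ` full_rank n r" if v: "ordered_pencil r \<sigma> v" for v
  proof -
    define S where "S = insert 0 (v ! 0)"
    obtain \<theta> where im: "\<theta> ` space2 r = space2 n"
      and \<theta>eq: "\<And>x y. x \<in> space2 r \<Longrightarrow> y \<in> space2 r \<Longrightarrow> \<theta> x = \<theta> y \<longleftrightarrow> x + y \<in> S"
      and nth: "\<And>i. i < 2 ^ n \<Longrightarrow> v ! i = {x \<in> space2 r. x \<noteq> 0 \<and> \<theta> x = vec_of_nat i}"
      by (rule pencil_label [OF v n S_def]) blast
    have len: "length v = 2 ^ n" using v unfolding ordered_pencil_iff n by blast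
    have S: "x \<in> S \<longleftrightarrow> \<theta> x = \<theta> 0" if "x \<in> space2 r" for x using \<theta>eq [OF that space2_0] by simp
    have \<theta>0: "\<theta> 0 = 0"
    proof -
      have "0 \<in> \<theta> ` space2 r" unfolding im by simp
      then obtain y where y: "y \<in> space2 r" "\<theta> y = 0" by auto
      then have "y \<in> S" using nth [of 0] by (cases "y = 0") (simp_all add: S_def)
      then show ?thesis using S y by simp
    qed
    have sp: "\<theta> x \<in> space2 2" if "x \<in> space2 r" for x using im that n2 by blast
    have "additive_on (space2 r) \<theta>"
      unfolding additive_on_def
    proof (intro ballI)
      fix x y assume xy: "x \<in> space2 r" "y \<in> space2 r"
      have xys: "x + y \<in> space2 r" using xy by simp
      \<comment> \<open>Equality of labels is congruence modulo \<open>S\<close>, so the label of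
        \<open>x + y\<close> coincides with that of \<open>x\<close>, that of \<open>y\<close> or
        \<open>0\<close> only in the evident cases. In a group of four elements this leaves one
        value for it.\<close>
      have e1: "\<theta> (x + y) = \<theta> x \<longleftrightarrow> \<theta> y = 0"
        using \<theta>eq [OF xys xy(1)] S [OF xy(2)] \<theta>0 by (simp add: add.commute [of _ x])
      have e2: "\<theta> (x + y) = \<theta> y \<longleftrightarrow> \<theta> x = 0"
        using \<theta>eq [OF xys xy(2)] S [OF xy(1)] \<theta>0 by (simp add: add.assoc)
      have e3: "\<theta> (x + y) = 0 \<longleftrightarrow> \<theta> x = \<theta> y"
        using \<theta>eq [OF xy] S [OF xys] \<theta>0 by simp
      show "\<theta> (x + y) = \<theta> x + \<theta> y"
      proof (cases "\<theta> x = 0 \<or> \<theta> y = 0 \<or> \<theta> x = \<theta> y")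
        case True
        then show ?thesis using e1 e2 e3 by auto
      next
        case False
        then show ?thesis
          by (intro space2_2_klein sp xy xys) (use e1 e2 e3 in auto)
      qed
    qed
    from additive_label [OF this im len nth] show ?thesis by blast
  qed
  then have "verts (pencil_graph r \<sigma>) \<subseteq> \<P> ` full_rank n r" by (auto simp: pencil_graph_def)
  moreover have "e \<subseteq> verts (pencil_graph r \<sigma>)" if "e \<in> edges (pencil_graph r \<sigma>)" for e
    using that by (auto simp: pencil_graph_def)
  ultimately have "verts (pencil_graph r \<sigma>) \<inter> \<P> ` full_rank n r = verts (pencil_graph r \<sigma>)"
    "{e \<in> edges (pencil_graph r \<sigma>). e \<subseteq> \<P> ` full_rank n r} = edges (pencil_graph r \<sigma>)" by blast+
  then show ?thesis unfolding component_eq_induced induced_def by simp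
qed

text \<open>Exchanging the cosets with labels \<open>3\<close> and \<open>4\<close> destroys the linearity of the labelling.\<close>

lemma component_neq_pencil_graph:
  assumes n3: "3 \<le> n"
  shows "G \<noteq> pencil_graph r \<sigma>"
proof
  assume eq: "G = pencil_graph r \<sigma>"
  obtain \<phi> where \<phi>: "\<phi> \<in> full_rank n r" using unit_mat_full_rank [of n r] nr(1) by auto
  \<comment> \<open>Label \<open>4\<close> exists from three rows on.\<close>
  have "(2::nat) ^ 3 \<le> 2 ^ n" using n3 by (intro power_increasing) auto
  then have n8: "8 \<le> (2::nat) ^ n" by simp
  define w where "w = \<P> \<phi>"
  define v where "v = w[3 := w ! 4, 4 := w ! 3]"
  have len: "length w = 2 ^ n" "length v = 2 ^ n" by (simp_all add: w_def v_def)
  have w: "length w = 2 ^ n" "0 \<notin> w ! 0" "linear_subspace r \<sigma> (insert 0 (w ! 0))" "inj_on ((!) w) {1..2 ^ n - 1}"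
    "(!) w ` {1..2 ^ n - 1} = cosets r (insert 0 (w ! 0)) - {insert 0 (w ! 0)}"
    using ordered_pencil_of' [OF \<phi>] unfolding ordered_pencil_iff n w_def by blast+
  define \<pi> where "\<pi> = transpose (3::nat) 4"
  have v_nth: "v ! i = w ! \<pi> i" if "i < 2 ^ n" for i
    using that n8 len by (auto simp: v_def \<pi>_def transpose_def nth_list_update)
  have \<pi>: "bij_betw \<pi> {1..2 ^ n - 1} {1..2 ^ n - 1}"
    unfolding \<pi>_def by (rule bij_betw_transpose_iff) (use n8 in auto)
  have lt: "i < 2 ^ n" if "i \<in> {1..2 ^ n - 1}" for i :: nat
  proof -
    have "(0::nat) < 2 ^ n" by simp
    moreover have "i \<le> 2 ^ n - 1" using that by simp
    ultimately show ?thesis by linarith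
  qed
  have v0: "v ! 0 = w ! 0" using v_nth [of 0] by (simp add: \<pi>_def transpose_def)
  have "(!) v ` {1..2 ^ n - 1} = (\<lambda>i. w ! \<pi> i) ` {1..2 ^ n - 1}"
    by (rule image_cong [OF refl v_nth [OF lt]])
  also have "\<dots> = (!) w ` \<pi> ` {1..2 ^ n - 1}" by (simp only: image_image)
  finally have im: "(!) v ` {1..2 ^ n - 1} = (!) w ` {1..2 ^ n - 1}"
    by (simp only: bij_betw_imp_surj_on [OF \<pi>])
  have "inj_on ((!) v) {1..2 ^ n - 1}"
  proof (rule inj_onI)
    fix i j assume ij: "i \<in> {1..2 ^ n - 1}" "j \<in> {1..2 ^ n - 1}" "v ! i = v ! j"
    then have "w ! \<pi> i = w ! \<pi> j" using v_nth lt by metis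
    then have "\<pi> i = \<pi> j" using inj_onD [OF w(4)] bij_betwE [OF \<pi>] ij by blast
    then show "i = j" using inj_onD [OF bij_betw_imp_inj_on [OF \<pi>]] ij by blast
  qed
  then have "ordered_pencil r \<sigma> v"
    unfolding ordered_pencil_iff n [symmetric] v0 im using w len by blast
  then have "v \<in> verts G" unfolding eq by (simp add: pencil_graph_def)
  then obtain \<psi> where \<psi>: "\<psi> \<in> full_rank n r" "v = \<P> \<psi>" unfolding verts_component by blast
  have sp: "vec_of_nat i \<in> space2 n" if "i < 8" for i
    using that n8 by (intro vec_of_nat_space2) simp
  have sp12: "vec_of_nat 1 \<in> space2 n" "vec_of_nat 2 \<in> space2 n" by (rule sp, simp)+
  \<comment> \<open>The sum of a vector with label \<open>1\<close> and one with label
    \<open>2\<close> has label \<open>3\<close> in \<open>w\<close>, hence label \<open>4\<close> in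
    \<open>v\<close>. If \<open>v\<close> came from a matrix, that label would be
    \<open>3\<close>.\<close>
  obtain a where a: "a \<in> space2 r" "mv r \<phi> a = vec_of_nat 1" by (rule mv_surjE [OF \<phi> sp12(1)])
  obtain b where b: "b \<in> space2 r" "mv r \<phi> b = vec_of_nat 2" by (rule mv_surjE [OF \<phi> sp12(2)])
  have vec3: "vec_of_nat 1 + vec_of_nat 2 = vec_of_nat 3"
  proof
    fix i :: nat
    consider "i = 0" | "i = 1" | "i \<ge> 2" by linarith
    then show "(vec_of_nat 1 + vec_of_nat 2) i = vec_of_nat 3 i"
    proof cases
      case 3
      have "vec_of_nat k i = 0" if "k < 2 ^ 2" for k
        using vec_of_nat_space2 [OF that] 3 by (simp add: space2_def)
      from this [of 1] this [of 2] this [of 3] show ?thesis by simp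
    qed (simp_all add: vec_of_nat_def bit_iff_odd)
  qed
  have nthw: "w ! i = {x \<in> space2 r. mv r \<phi> x = vec_of_nat i}" if "0 < i" "i < 8" for i
    unfolding w_def using that n8 by (intro nth_pencil_of_pos) simp_all
  have nthv: "v ! i = {x \<in> space2 r. mv r \<psi> x = vec_of_nat i}" if "0 < i" "i < 8" for i
    unfolding \<psi>(2) using that n8 by (intro nth_pencil_of_pos) simp_all
  have v124: "v ! 1 = w ! 1" "v ! 2 = w ! 2" "v ! 4 = w ! 3"
    using v_nth [of 1] v_nth [of 2] v_nth [of 4] n8 by (simp_all add: \<pi>_def transpose_def)
  have "mv r \<psi> a = vec_of_nat 1" using a nthw [of 1] nthv [of 1] v124(1) by auto
  moreover have "mv r \<psi> b = vec_of_nat 2" using b nthw [of 2] nthv [of 2] v124(2) by auto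
  ultimately have "mv r \<psi> (a + b) = vec_of_nat 3" by (simp only: mv_add_right vec3)
  moreover have "a + b \<in> w ! 3"
    using nthw [of 3] a b vec3 by (simp only: mv_add_right mem_Collect_eq) simp
  then have "mv r \<psi> (a + b) = vec_of_nat 4" unfolding v124(3) [symmetric] using nthv [of 4] by simp
  ultimately show False using vec_of_nat_eq_iff [of 3 4] by simp
qed

end

text \<open>The witnesses for \<open>l0\<close> and \<open>l1\<close> are the numbers of lines and
  tees. The witness for \<open>m0\<close> is \<open>2 ^ r - 2 ^ n\<close>, the number of directions
  outside a row space.\<close>

theorem theorem6p2:
  fixes r \<sigma> \<rho> s t m1 :: nat and G :: "pencil graph" and K T :: "nat graph"
  assumes "r \<ge> 3" and "0 < \<sigma>" and "\<sigma> < r - 1" and "r \<le> 8"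
    and "\<rho> = r - \<sigma>" and "\<rho> \<le> 5"
    and "s = 2 ^ (\<rho> - 1)" and "t = 2 ^ (\<sigma> + 1) - 1" and "m1 = 2 ^ \<rho> - 1"
    and "G = pencil_component r \<sigma>"
    and "K = complete_graph (2 * s)" and "T = complete_multipartite t s"
  shows "connected_graph G \<and> regular G (s * (t - 1) * m1) \<and>
    (\<exists>l0 l1 m0.
       indexed_homogeneous G K T l0 l1 m0 m1 \<and>
       (r > 3 \<longrightarrow> \<not> indexed_ultrahomogeneous G K T l0 l1 m0 m1) \<and>
       (\<exists>J0 J1 S.
          double_decomposition G K T l0 l1 m0 m1 J0 J1 \<and>
          S = \<lparr>points = verts G, lines = J0, incident = (\<in>)\<rparr> \<and>
          configuration S (card (verts G)) m0 l0 (2 * s) \<and>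
          G = menger_graph S \<and>
          (\<sigma> = 1 \<longrightarrow> card (verts G) = l0 \<and> m0 = 2 * s \<and> self_dual S \<and>
             isomorphic G (menger_graph (dual S))))) \<and>
    (G = pencil_graph r \<sigma> \<longleftrightarrow> r - \<sigma> = 2) \<and>
    (r - \<sigma> = 2 \<longrightarrow> ultrahomogeneous_wrt G (free_copies G (complete_graph 4) T))"
proof -
  define n where "n = r - \<sigma>"
  interpret pencil_parameters r \<sigma> n
    by unfold_locales (use assms(1-3) n_def in auto)
  have n2: "2 \<le> n" and rn: "r - n = \<sigma>" using assms(1-3) by (auto simp: n_def)
  have \<rho>n: "\<rho> = n" unfolding n_def by (rule assms(5))
  have s: "s = 2 ^ (n - 1)" and t: "t = 2 ^ (r - n + 1) - 1" and m1: "m1 = 2 ^ n - 1"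
    unfolding rn using assms(7-9) unfolding \<rho>n by blast+
  have s2: "2 * s = 2 ^ n" unfolding s using nr(2) by (cases n) simp_all
  have K: "K = complete_graph (2 ^ n)" using assms(11) s2 by simp
  have T: "T = complete_multipartite (2 ^ (r - n + 1) - 1) (2 ^ (n - 1))" unfolding assms(12) s t ..
  have GG: "G = pencil_component r \<sigma>" by (rule assms(10))
  have iso: "graph_iso (pencil_of n r) (mat_graph n r) G" unfolding GG by (rule pencil_iso)
  have simple: "finite_simple_graph G" unfolding GG by (rule finite_simple_component)
  have less: "(2::nat) ^ n < 2 ^ r" using nr(1) by (intro power_strict_increasing) auto
  let ?p = "pencil_of n r" and ?M = "mat_graph n r"
  define J0 J1 where "J0 = (`) ?p ` mat_lines n r" and "J1 = (`) ?p ` mat_tees n r"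
  define m0 :: nat where "m0 = 2 ^ r - 2 ^ n"
  have J0: "free_copies G K T = J0"
    unfolding free_copies_iso_eq [OF iso] K T free_copies_mat_complete [OF n2 nr(1)] J0_def ..
  have J1: "copies G T = J1"
    unfolding copies_iso_eq [OF iso] T copies_mat_multipartite [OF n2 nr(1)] J1_def ..
  have sub: "mat_lines n r \<subseteq> Pow (verts ?M)" "mat_tees n r \<subseteq> Pow (verts ?M)"
    unfolding verts_mat_graph
    by (rule subsetI, rule PowI, erule mat_lines_subset) (rule subsetI, rule PowI, erule mat_tees_subset)
  have J01: "J0 \<union> J1 = (`) ?p ` (mat_lines n r \<union> mat_tees n r)" by (simp only: J0_def J1_def image_Un)
  have sub01: "mat_lines n r \<union> mat_tees n r \<subseteq> Pow (verts ?M)" using sub by blast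
  have decomposition_pair: "decomposition_pair G (free_copies G K T) (copies G T) m0 m1"
    unfolding J0 J1 J0_def J1_def m0_def m1
    by (rule decomposition_pair_iso [OF iso sub finite_simple_mat_graph simple decomposition_pair_mat_graph [OF nr(2,1)]])
  have "m0 > 0" using less by (simp add: m0_def)
  moreover have "m1 > 0" unfolding m1 using one_less_power [of "2::nat" n] nr(2) by simp
  ultimately have dd: "double_decomposition G K T (card J0) (card J1) m0 m1 J0 J1"
    using double_decompositionI [OF simple decomposition_pair] unfolding J0 J1 by blast
  \<comment> \<open>The graphs \<open>K\<close> and \<open>T\<close> are told apart by their
    orders.\<close>
  have "card (verts T) = 2 ^ r - 2 ^ (n - 1)"
    unfolding T verts_complete_multipartite card_lessThan pow_diff_eq [OF nr(2,1)] ..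
  moreover have "(2::nat) ^ n + 2 ^ (n - 1) < 2 ^ n + 2 ^ n" using nr(2) by simp
  moreover have "(2::nat) ^ n + 2 ^ n \<le> 2 ^ r"
    using power_increasing [of "Suc n" r "2::nat"] nr(1) by simp
  ultimately have "card (verts K) \<noteq> card (verts T)"
    unfolding K verts_complete_graph card_lessThan by linarith
  then have KT: "\<not> isomorphic K T" using isomorphic_card_verts by blast
  have homog: "homogeneous_wrt G (free_copies G K T \<union> copies G T)"
    unfolding J0 J1 J01 by (rule homogeneous_iso [OF iso sub01 homogeneous_mat_graph [OF n2 nr(1)]])
  have AK: "arc_transitive K" unfolding K by (rule arc_transitive_complete_graph)
  have AT: "arc_transitive T" unfolding T by (rule arc_transitive_complete_multipartite)
  have indexed: "indexed_homogeneous G K T (card J0) (card J1) m0 m1"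
    unfolding indexed_homogeneous_def
    by (intro conjI exI [of _ J0] exI [of _ J1] simple AK AT KT homog dd)
  have not_ultra: "\<not> indexed_ultrahomogeneous G K T (card J0) (card J1) m0 m1" if r3: "r > 3"
  proof -
    have "\<not> ultrahomogeneous_wrt ?M (mat_lines n r \<union> mat_tees n r)"
    \<comment> \<open>Lines with at least eight points admit permutations that do not extend. For
      \<open>n = 2\<close> lines are rigid enough, but \<open>r > 3\<close> leaves two directions
      outside the row space and the tees give the obstruction.\<close>
    proof (cases "3 \<le> n")
      case True
      then show ?thesis by (rule not_ultrahomogeneous_lines [OF _ nr(1)])
    next
      case False
      then have "Suc n < r" using r3 by simp
      then show ?thesis by (rule not_ultrahomogeneous_tees [OF n2])
    qed
    then have "\<not> ultrahomogeneous_wrt G (free_copies G K T \<union> copies G T)"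
      unfolding J0 J1 J01 ultrahomogeneous_iso_iff [OF iso sub01] .
    then show ?thesis by (simp add: indexed_ultrahomogeneous_def)
  qed
  define S where "S = \<lparr>points = verts G, lines = J0, incident = (\<in>)\<rparr>"
  have J0K: "J0 \<subseteq> copies G (complete_graph (2 * s))"
    using free_copies_subset [of G K T, unfolded J0] unfolding assms(11) .
  have config: "configuration S (card (verts G)) m0 (card J0) (2 * s)"
    unfolding S_def
    by (rule configuration_copies [OF simple J0K]) (use decomposition_pairD(1) [OF decomposition_pair] in \<open>simp only: J0\<close>)
  have cover: "\<exists>H\<in>J0. e \<subseteq> H" if "e \<in> edges G" for e
    using decomposition_pairD(3) [OF decomposition_pair that, of J0] unfolding J0 by blast
  have menger: "G = menger_graph S" unfolding S_def by (rule eq_menger_graph [OF simple J0K cover])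
  have dual: "card (verts G) = card J0 \<and> m0 = 2 * s \<and> self_dual S \<and> isomorphic G (menger_graph (dual S))"
    if "\<sigma> = 1"
  proof -
    have r: "r = Suc n" using that nr(1) rn by linarith
    have pol: "bij_betw (right_inverses n r) (verts ?M) (mat_lines n r)"
      using bij_right_inverses [OF nr(2)] by (simp add: r)
    have rs: "u \<in> right_inverses n r v \<longleftrightarrow> v \<in> right_inverses n r u" if "u \<in> verts ?M" "v \<in> verts ?M" for u v
      using right_inverses_sym [of u n r v] that by simp
    have "\<exists>E. bij_betw E (verts G) J0 \<and> (\<forall>u\<in>verts G. \<forall>v\<in>verts G. u \<in> E v \<longleftrightarrow> v \<in> E u)"
      unfolding J0_def by (rule polarity_iso [OF iso sub(1) pol], rule rs)
    then obtain E where E: "bij_betw E (verts G) J0"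
      and "\<forall>u\<in>verts G. \<forall>v\<in>verts G. u \<in> E v \<longleftrightarrow> v \<in> E u"
      by (elim exE conjE)
    then have E_sym: "u \<in> E v \<longleftrightarrow> v \<in> E u" if "u \<in> verts G" "v \<in> verts G" for u v
      using that by simp
    have "m0 = 2 * s" unfolding m0_def s2 r by simp
    moreover have "isomorphic G (menger_graph (dual S))"
      using menger_dual_polarity [OF E E_sym S_def] menger by simp
    ultimately show ?thesis
      using bij_betw_same_card [OF E] self_dual_polarity [OF E E_sym] by (simp add: S_def)
  qed
  have "s * (t - 1) * m1 = (2 ^ n - 1) * (2 ^ r - 2 ^ n)"
  proof -
    \<comment> \<open>The factor \<open>t - 1\<close> is \<open>2 ^ (r - n + 1) - 2\<close>, so the
      product becomes the number of directions outside a row space.\<close>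
    have "s * (t - 1) = s * 2 ^ (r - n + 1) - 2 * s"
      unfolding t by (simp add: diff_mult_distrib2)
    also have "s * 2 ^ (r - n + 1) = 2 ^ r"
      unfolding s power_add [symmetric] using nr by simp
    finally show ?thesis unfolding s2 m1 by (simp only: mult.commute)
  qed
  then have regular: "regular G (s * (t - 1) * m1)" using regular_component GG by simp
  have connected: "connected_graph G" unfolding GG by (rule connected_component)
  have all: "G = pencil_graph r \<sigma> \<longleftrightarrow> r - \<sigma> = 2"
  proof
    assume eq: "G = pencil_graph r \<sigma>"
    have "\<not> 3 \<le> n"
    proof
      assume "3 \<le> n"
      from component_neq_pencil_graph [OF this] show False using eq unfolding GG ..
    qed
    then show "r - \<sigma> = 2" using n2 by (simp add: n_def)
  next
    assume "r - \<sigma> = 2"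
    then have "n = 2" by (simp add: n_def)
    from component_eq_pencil_graph [OF this] show "G = pencil_graph r \<sigma>" unfolding GG .
  qed
  have K4: "ultrahomogeneous_wrt G (free_copies G (complete_graph 4) T)" if "r - \<sigma> = 2"
  proof -
    have n: "n = 2" using that by (simp add: n_def)
    have "complete_graph 4 = K" unfolding K n by simp
    moreover have "ultrahomogeneous_wrt ?M (mat_lines n r)"
      using ultrahomogeneous_lines_2 [of r] nr(1) by (simp add: n)
    ultimately show ?thesis
      using ultrahomogeneous_iso [OF iso sub(1)] J0 by (simp add: J0_def)
  qed
  have nu: "r > 3 \<longrightarrow> \<not> indexed_ultrahomogeneous G K T (card J0) (card J1) m0 m1"
    by (rule impI, rule not_ultra)
  have du: "\<sigma> = 1 \<longrightarrow> card (verts G) = card J0 \<and> m0 = 2 * s \<and> self_dual S \<and> isomorphic G (menger_graph (dual S))"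
    by (rule impI, rule dual)
  have k4: "r - \<sigma> = 2 \<longrightarrow> ultrahomogeneous_wrt G (free_copies G (complete_graph 4) T)"
    by (rule impI, rule K4)
  note inner = conjI [OF dd conjI [OF S_def conjI [OF config conjI [OF menger du]]]]
  have ex: "\<exists>J0' J1' S'.
      double_decomposition G K T (card J0) (card J1) m0 m1 J0' J1' \<and>
      S' = \<lparr>points = verts G, lines = J0', incident = (\<in>)\<rparr> \<and>
      configuration S' (card (verts G)) m0 (card J0) (2 * s) \<and>
      G = menger_graph S' \<and>
      (\<sigma> = 1 \<longrightarrow> card (verts G) = card J0 \<and> m0 = 2 * s \<and> self_dual S' \<and>
         isomorphic G (menger_graph (dual S')))"
    by (rule exI [of _ J0], rule exI [of _ J1], rule exI [of _ S], rule inner)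
  show ?thesis
    by (rule conjI [OF connected conjI [OF regular conjI [OF _ conjI [OF all k4]]]])
      (rule exI [of _ "card J0"], rule exI [of _ "card J1"], rule exI [of _ m0],
        rule conjI [OF indexed conjI [OF nu ex]])
qed

end
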